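(* Let $R$ be a commutative Noetherian ring, $\alpha$ an automorphism of $R$ and $S=R[\theta;\alpha]$. Let $V$ be a simple right $S$-module with annihilator $Q=\mathrm{Ann}_S(V)$. If $(Q\cap R)S\subsetneq Q$, then $S/Q$ is Artinian and every finitely generated essential extension of $V$ is Artinian.
   Context: $R[\theta;\alpha]$ denotes the skew polynomial ring of polynomials $\sum r_i\theta^i$ ($r_i\in R$) with multiplication determined by $\theta r=\alpha(r)\theta$ for $r\in R$. Modules are right modules. *)

theory Defs
  imports "HOL-Algebra.Algebra"
begin

text \<open>A skew polynomial sum_i r_i theta^i is represented by its coefficient
  sequence (finitely supported, coefficients in carrier R).  Multiplication is
  determined by theta r = alpha(r) theta, i.e.
  (f g)_n = sum_{i+j=n} f_i alpha^i(g_j).\<close>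

definition skew_poly_ring :: "('a, 'b) ring_scheme \<Rightarrow> ('a \<Rightarrow> 'a) \<Rightarrow> (nat \<Rightarrow> 'a) ring" where
  "skew_poly_ring R \<alpha> =
    \<lparr> partial_object.carrier = {f. (\<forall>n. f n \<in> carrier R) \<and> finite {n. f n \<noteq> \<zero>\<^bsub>R\<^esub>}},
      monoid.mult = (\<lambda>f g. \<lambda>n. finsum R (\<lambda>i. f i \<otimes>\<^bsub>R\<^esub> (\<alpha> ^^ i) (g (n - i))) {..n}),
      monoid.one = (\<lambda>n. if n = 0 then \<one>\<^bsub>R\<^esub> else \<zero>\<^bsub>R\<^esub>),
      ring.zero = (\<lambda>n. \<zero>\<^bsub>R\<^esub>),
      ring.add = (\<lambda>f g. \<lambda>n. f n \<oplus>\<^bsub>R\<^esub> g n) \<rparr>"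

definition skew_const :: "('a, 'b) ring_scheme \<Rightarrow> 'a \<Rightarrow> (nat \<Rightarrow> 'a)" where
  "skew_const R r = (\<lambda>n. if n = 0 then r else \<zero>\<^bsub>R\<^esub>)"

text \<open>A right module: an abelian group (fields carrier/add/zero of a ring record;
  mult/one unused) together with a right action ract x s = x s.\<close>
record ('s, 'm) rmod = "'m ring" +
  ract :: "'m \<Rightarrow> 's \<Rightarrow> 'm"

definition right_module :: "('s, 'c) ring_scheme \<Rightarrow> ('s, 'm, 'd) rmod_scheme \<Rightarrow> bool" where
  "right_module S M \<longleftrightarrow> ring S \<and> abelian_group M \<and>
    (\<forall>x \<in> carrier M. \<forall>s \<in> carrier S. ract M x s \<in> carrier M) \<and>
    (\<forall>x \<in> carrier M. \<forall>y \<in> carrier M. \<forall>s \<in> carrier S.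
        ract M (x \<oplus>\<^bsub>M\<^esub> y) s = ract M x s \<oplus>\<^bsub>M\<^esub> ract M y s) \<and>
    (\<forall>x \<in> carrier M. \<forall>s \<in> carrier S. \<forall>t \<in> carrier S.
        ract M x (s \<oplus>\<^bsub>S\<^esub> t) = ract M x s \<oplus>\<^bsub>M\<^esub> ract M x t) \<and>
    (\<forall>x \<in> carrier M. \<forall>s \<in> carrier S. \<forall>t \<in> carrier S.
        ract M x (s \<otimes>\<^bsub>S\<^esub> t) = ract M (ract M x s) t) \<and>
    (\<forall>x \<in> carrier M. ract M x \<one>\<^bsub>S\<^esub> = x)"

definition rsubmodule :: "('s, 'c) ring_scheme \<Rightarrow> 'm set \<Rightarrow> ('s, 'm, 'd) rmod_scheme \<Rightarrow> bool" where
  "rsubmodule S N M \<longleftrightarrow> N \<subseteq> carrier M \<and> additive_subgroup N M \<and>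
    (\<forall>x \<in> N. \<forall>s \<in> carrier S. ract M x s \<in> N)"

definition simple_rmodule :: "('s, 'c) ring_scheme \<Rightarrow> ('s, 'm, 'd) rmod_scheme \<Rightarrow> bool" where
  "simple_rmodule S M \<longleftrightarrow> right_module S M \<and> carrier M \<noteq> {\<zero>\<^bsub>M\<^esub>} \<and>
    (\<forall>N. rsubmodule S N M \<longrightarrow> N = {\<zero>\<^bsub>M\<^esub>} \<or> N = carrier M)"

definition rannihilator :: "('s, 'c) ring_scheme \<Rightarrow> ('s, 'm, 'd) rmod_scheme \<Rightarrow> 's set" where
  "rannihilator S M = {s \<in> carrier S. \<forall>x \<in> carrier M. ract M x s = \<zero>\<^bsub>M\<^esub>}"

definition rspan :: "('s, 'c) ring_scheme \<Rightarrow> ('s, 'm, 'd) rmod_scheme \<Rightarrow> 'm set \<Rightarrow> 'm set" where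
  "rspan S M A = \<Inter> {N. rsubmodule S N M \<and> A \<subseteq> N}"

definition fin_gen_rmodule :: "('s, 'c) ring_scheme \<Rightarrow> ('s, 'm, 'd) rmod_scheme \<Rightarrow> bool" where
  "fin_gen_rmodule S M \<longleftrightarrow> (\<exists>A. finite A \<and> A \<subseteq> carrier M \<and> rspan S M A = carrier M)"

definition artinian_rmodule :: "('s, 'c) ring_scheme \<Rightarrow> ('s, 'm, 'd) rmod_scheme \<Rightarrow> bool" where
  "artinian_rmodule S M \<longleftrightarrow>
    (\<forall>N :: nat \<Rightarrow> 'm set. (\<forall>n. rsubmodule S (N n) M) \<and> (\<forall>n. N (Suc n) \<subseteq> N n) \<longrightarrow>
       (\<exists>k. \<forall>n \<ge> k. N n = N k))"

definition rmod_hom :: "('s, 'c) ring_scheme \<Rightarrow> ('s, 'm, 'd) rmod_scheme \<Rightarrow> ('s, 'e, 'f) rmod_scheme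
    \<Rightarrow> ('m \<Rightarrow> 'e) \<Rightarrow> bool" where
  "rmod_hom S M E f \<longleftrightarrow> f ` carrier M \<subseteq> carrier E \<and>
    (\<forall>x \<in> carrier M. \<forall>y \<in> carrier M. f (x \<oplus>\<^bsub>M\<^esub> y) = f x \<oplus>\<^bsub>E\<^esub> f y) \<and>
    (\<forall>x \<in> carrier M. \<forall>s \<in> carrier S. f (ract M x s) = ract E (f x) s)"

definition essential_rsubmodule :: "('s, 'c) ring_scheme \<Rightarrow> 'e set \<Rightarrow> ('s, 'e, 'f) rmod_scheme \<Rightarrow> bool" where
  "essential_rsubmodule S N E \<longleftrightarrow> rsubmodule S N E \<and>
    (\<forall>K. rsubmodule S K E \<and> K \<noteq> {\<zero>\<^bsub>E\<^esub>} \<longrightarrow> N \<inter> K \<noteq> {\<zero>\<^bsub>E\<^esub>})"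

definition essential_extension :: "('s, 'c) ring_scheme \<Rightarrow> ('s, 'm, 'd) rmod_scheme
    \<Rightarrow> ('s, 'e, 'f) rmod_scheme \<Rightarrow> bool" where
  "essential_extension S M E \<longleftrightarrow> right_module S E \<and>
    (\<exists>f. rmod_hom S M E f \<and> inj_on f (carrier M) \<and> essential_rsubmodule S (f ` carrier M) E)"

definition right_ideal :: "'a set \<Rightarrow> ('a, 'b) ring_scheme \<Rightarrow> bool" where
  "right_ideal I R \<longleftrightarrow> additive_subgroup I R \<and>
    (\<forall>a \<in> I. \<forall>r \<in> carrier R. a \<otimes>\<^bsub>R\<^esub> r \<in> I)"

definition right_artinian_ring :: "('a, 'b) ring_scheme \<Rightarrow> bool" where
  "right_artinian_ring R \<longleftrightarrow> ring R \<and>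
    (\<forall>I :: nat \<Rightarrow> 'a set. (\<forall>n. right_ideal (I n) R) \<and> (\<forall>n. I (Suc n) \<subseteq> I n) \<longrightarrow>
       (\<exists>k. \<forall>n \<ge> k. I n = I k))"

definition right_ideal_prod :: "('a, 'b) ring_scheme \<Rightarrow> 'a set \<Rightarrow> 'a set" where
  "right_ideal_prod S A = {finsum S (\<lambda>i. a i \<otimes>\<^bsub>S\<^esub> s i) {..<(n::nat)} | n a s.
      (\<forall>i < n. a i \<in> A \<and> s i \<in> carrier S)}"

end

theory Submission
  imports Defs
begin

text \<open>Write \<open>P = Q \<inter> R\<close>. If \<open>\<theta>\<close> annihilates \<open>V\<close>, then \<open>V\<close> is simple over \<open>R\<close>, \<open>S/Q\<close> is the field \<open>R/P\<close>,
  and by a Fitting argument \<open>\<theta>\<close> is nilpotent on every finitely generated essential extension \<open>E\<close>, so that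
  one is reduced to the kernel of \<open>\<theta>\<close>, a module over \<open>R\<close>. Otherwise \<open>\<theta>\<close> is bijective on \<open>V\<close>, and an element
  of minimal degree in \<open>Q\<close> outside \<open>PS\<close> shows that some power \<open>\<alpha>\<^sup>n\<close> induces the identity on \<open>R/P\<close>. On modules
  annihilated by \<open>P\<close> the operators of \<open>R\<close> and \<open>x = \<theta>\<^sup>n\<close> therefore commute, \<open>V\<close> has finite length over
  \<open>R[x]\<close>, and so has \<open>S/Q\<close>.

  The Artin-Rees property of the \<open>\<alpha>\<close>-stable ideal \<open>P\<close> gives \<open>E P\<^sup>k = 0\<close> for some \<open>k\<close>. Let \<open>D\<^sub>i\<close> be the annihilator
  of \<open>P\<^sup>i\<close> in \<open>E\<close>. An operator from \<open>R[x]\<close> that vanishes on \<open>V\<close> is nilpotent on \<open>D\<^sub>1\<close>, again by Artin-Rees, whence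
  \<open>D\<^sub>1\<close> is Artinian over \<open>R[x]\<close>. Finally \<open>D\<^sub>i\<^sub>+\<^sub>1/D\<^sub>i\<close> embeds into the module of \<open>R\<close>-linear maps from \<open>P\<^sup>i\<close> to
  \<open>D\<^sub>1\<close>, on which \<open>x\<close> acts with a twist by \<open>\<alpha>\<^sup>n\<close>; this module is Noetherian and \<open>\<pi>\<close>-regular, hence Artinian,
  over the twisted action.\<close>

section \<open>Chain conditions for groups with operators\<close>

text \<open>The same abelian group has to be viewed over R, over R[x], over S and over a twisted
  R[x]. Modules are therefore groups with a set of operators, submodules are stable subgroups, and
  factor modules are intervals of stable subgroups; a change of rings is a change of the operator
  set. The obstacle is that R and \<theta> do not commute: commutative algebra is available only for
  x = \<theta>^n on a group killed by P. There the descending chain condition is drawn from a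
  Noetherian module on which every polynomial t in the operators is pi-regular, that is,
  \<open>t^k (1 - t u)\<close> is nilpotent for some u and k. This criterion is lifted from V to
  \<open>D1\<close> modulo nilpotent operators. It also bridges the pointwise and the twisted action
  on linear maps: their submodules differ, but the images of \<open>t^k\<close> are submodules for
  both. For S/Q, the elements of S that are polynomials in \<theta>^n act on V by operators
  commuting with R[x], so that modulo Q they embed into finitely many copies of V.\<close>

definition ACC :: "'x set set \<Rightarrow> bool" where
  "ACC F \<longleftrightarrow> (\<forall>N :: nat \<Rightarrow> 'x set. (\<forall>i. N i \<in> F \<and> N i \<subseteq> N (Suc i)) \<longrightarrow> (\<exists>k. \<forall>i\<ge>k. N i = N k))"

definition DCC :: "'x set set \<Rightarrow> bool" where
  "DCC F \<longleftrightarrow> (\<forall>N :: nat \<Rightarrow> 'x set. (\<forall>i. N i \<in> F \<and> N (Suc i) \<subseteq> N i) \<longrightarrow> (\<exists>k. \<forall>i\<ge>k. N i = N k))"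

lemma ACC_D:
  assumes "ACC F" "\<And>i. N i \<in> F" "\<And>i. N i \<subseteq> N (Suc i)"
  obtains k where "\<And>i. i \<ge> k \<Longrightarrow> N i = N k"
  using assms unfolding ACC_def by blast

lemma DCC_D:
  assumes "DCC F" "\<And>i. N i \<in> F" "\<And>i. N (Suc i) \<subseteq> N i"
  obtains k where "\<And>i. i \<ge> k \<Longrightarrow> N i = N k"
  using assms unfolding DCC_def by blast

text \<open>A chain only ever compares nested sets, so \<open>h\<close> need not be injective: it
  suffices that it tells comparable members apart. Most chain conditions below are moved in this way
  along an image, a preimage or an evaluation map.\<close>

lemma ACC_transfer:
  assumes "ACC F'" "\<And>N. N \<in> F \<Longrightarrow> h N \<in> F'"
    and "\<And>N M. N \<in> F \<Longrightarrow> M \<in> F \<Longrightarrow> N \<subseteq> M \<Longrightarrow> h N \<subseteq> h M"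
    and "\<And>N M. N \<in> F \<Longrightarrow> M \<in> F \<Longrightarrow> N \<subseteq> M \<Longrightarrow> h M = h N \<Longrightarrow> M \<subseteq> N"
  shows "ACC F"
  unfolding ACC_def
proof (intro allI impI)
  fix N assume N: "\<forall>i. N i \<in> F \<and> N i \<subseteq> N (Suc i)"
  obtain k where k: "\<And>i. i \<ge> k \<Longrightarrow> h (N i) = h (N k)"
    by (rule ACC_D[OF assms(1), of "\<lambda>i. h (N i)"]) (use N assms(2,3) in auto)
  have "N i = N k" if "i \<ge> k" for i
  proof -
    have "N k \<subseteq> N i" using N that by (metis lift_Suc_mono_le)
    then show ?thesis using assms(4)[of "N k" "N i"] N k[OF that] by blast
  qed
  then show "\<exists>k. \<forall>i\<ge>k. N i = N k" by blast
qed

lemma DCC_transfer: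
  assumes "DCC F'" "\<And>N. N \<in> F \<Longrightarrow> h N \<in> F'"
    and "\<And>N M. N \<in> F \<Longrightarrow> M \<in> F \<Longrightarrow> N \<subseteq> M \<Longrightarrow> h N \<subseteq> h M"
    and "\<And>N M. N \<in> F \<Longrightarrow> M \<in> F \<Longrightarrow> N \<subseteq> M \<Longrightarrow> h M = h N \<Longrightarrow> M \<subseteq> N"
  shows "DCC F"
  unfolding DCC_def
proof (intro allI impI)
  fix N assume N: "\<forall>i. N i \<in> F \<and> N (Suc i) \<subseteq> N i"
  obtain k where k: "\<And>i. i \<ge> k \<Longrightarrow> h (N i) = h (N k)"
    by (rule DCC_D[OF assms(1), of "\<lambda>i. h (N i)"]) (use N assms(2,3) in auto)
  have "N i = N k" if "i \<ge> k" for i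
  proof -
    have "N i \<subseteq> N k" using N that by (metis lift_Suc_antimono_le)
    then show ?thesis using assms(4)[of "N i" "N k"] N k[OF that] by blast
  qed
  then show "\<exists>k. \<forall>i\<ge>k. N i = N k" by blast
qed

lemma ACC_subset: "ACC F' \<Longrightarrow> F \<subseteq> F' \<Longrightarrow> ACC F"
  unfolding ACC_def by (meson subsetD)

lemma DCC_subset: "DCC F' \<Longrightarrow> F \<subseteq> F' \<Longrightarrow> DCC F"
  unfolding DCC_def by (meson subsetD)

text \<open>Serves two extremes: a simple factor, whose only intermediate submodules are its ends,
  and, with \<open>A = B\<close>, a trivial factor.\<close>

lemma DCC_subset_pair:
  assumes "F \<subseteq> {A, B}" shows "DCC F"
proof -
  have "\<exists>k. \<forall>i\<ge>k. N i = N k" if N: "\<forall>i. N i \<in> F \<and> N (Suc i) \<subseteq> N i" for N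
  proof (cases "\<exists>k. N k \<noteq> N 0")
    case True
    then obtain k where k: "N k \<noteq> N 0" by blast
    have mono: "N j \<subseteq> N i" if "i \<le> j" for i j using N that by (metis lift_Suc_antimono_le)
    have "N i = N k" if "i \<ge> k" for i
    proof -
      have "N i \<subseteq> N k" "N k \<subseteq> N 0" using mono that by auto
      moreover have "N i \<in> {A, B}" "N k \<in> {A,B}" "N 0 \<in> {A,B}" using N assms by blast+
      ultimately show ?thesis using k by auto
    qed
    then show ?thesis by blast
  next
    case False
    then show ?thesis by (intro exI[of _ 0]) blast
  qed
  then show ?thesis unfolding DCC_def by blast
qed

lemma ACC_subset_single: assumes "F \<subseteq> {A}" shows "ACC F"
proof -
  have "\<exists>k. \<forall>i\<ge>k. N i = N k" if "\<forall>i. N i \<in> F \<and> N i \<subseteq> N (Suc i)" for N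
  proof -
    have "N i = A" for i using that assms by blast
    then show ?thesis by simp
  qed
  then show ?thesis unfolding ACC_def by blast
qed

lemma ACC_maximal:
  assumes "ACC F" "C \<subseteq> F" "U \<in> C"
  obtains N where "N \<in> C" "\<forall>M\<in>C. N \<subseteq> M \<longrightarrow> M = N"
proof (rule ccontr)
  assume "\<not> thesis"
  then have "\<forall>N\<in>C. \<exists>M\<in>C. N \<subset> M" using that by blast
  then obtain h where h: "\<And>N. N \<in> C \<Longrightarrow> h N \<in> C \<and> N \<subset> h N" by metis
  define N where "N i = (h ^^ i) U" for i
  have N: "N i \<in> C" for i by (induction i) (auto simp: N_def assms h)
  have "N i \<subset> N (Suc i)" for i using h[OF N[of i]] by (simp add: N_def)
  moreover from this obtain k where "\<And>i. i \<ge> k \<Longrightarrow> N i = N k"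
    by (rule_tac ACC_D[OF assms(1), of N]) (use N assms(2) in auto)
  ultimately show False by (metis le_Suc_eq less_irrefl order_refl)
qed

text \<open>Subgroups stable under a set of operators. Inverses are expressed through the zero element
  rather than \<open>a_inv\<close>, whose value depends on the carrier; this makes the notion invariant under
  replacing the carrier of \<open>G\<close> by a subgroup.\<close>

definition opsub :: "('m, 'b) ring_scheme \<Rightarrow> ('m \<Rightarrow> 'm) set \<Rightarrow> 'm set \<Rightarrow> bool" where
  "opsub G W N \<longleftrightarrow> N \<subseteq> carrier G \<and> \<zero>\<^bsub>G\<^esub> \<in> N \<and> (\<forall>a\<in>N. \<forall>b\<in>N. a \<oplus>\<^bsub>G\<^esub> b \<in> N)
     \<and> (\<forall>a\<in>N. \<exists>b\<in>N. a \<oplus>\<^bsub>G\<^esub> b = \<zero>\<^bsub>G\<^esub>) \<and> (\<forall>w\<in>W. \<forall>a\<in>N. w a \<in> N)"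

text \<open>The interval between \<open>A\<close> and \<open>B\<close> stands for the submodules of
  the factor module B/A, so that no factor group has to be formed.\<close>

definition subs :: "('m, 'b) ring_scheme \<Rightarrow> ('m \<Rightarrow> 'm) set \<Rightarrow> 'm set \<Rightarrow> 'm set \<Rightarrow> 'm set set" where
  "subs G W A B = {N. opsub G W N \<and> A \<subseteq> N \<and> N \<subseteq> B}"

definition endo :: "('m, 'b) ring_scheme \<Rightarrow> ('m \<Rightarrow> 'm) set" where
  "endo G = {w. (\<forall>a\<in>carrier G. w a \<in> carrier G) \<and>
     (\<forall>a\<in>carrier G. \<forall>b\<in>carrier G. w (a \<oplus>\<^bsub>G\<^esub> b) = w a \<oplus>\<^bsub>G\<^esub> w b)}"

definition gen :: "('m, 'b) ring_scheme \<Rightarrow> ('m \<Rightarrow> 'm) set \<Rightarrow> 'm set \<Rightarrow> 'm set" where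
  "gen G W A = \<Inter>{N. opsub G W N \<and> A \<subseteq> N}"

abbreviation noeth :: "('m, 'b) ring_scheme \<Rightarrow> ('m \<Rightarrow> 'm) set \<Rightarrow> 'm set \<Rightarrow> bool" where
  "noeth G W U \<equiv> ACC (subs G W {\<zero>\<^bsub>G\<^esub>} U)"

abbreviation artin :: "('m, 'b) ring_scheme \<Rightarrow> ('m \<Rightarrow> 'm) set \<Rightarrow> 'm set \<Rightarrow> bool" where
  "artin G W U \<equiv> DCC (subs G W {\<zero>\<^bsub>G\<^esub>} U)"

lemma opsub_restrict:
  "opsub (G\<lparr>carrier := U\<rparr>) W N \<longleftrightarrow> (opsub G W N \<and> N \<subseteq> U)" if "U \<subseteq> carrier G"
  using that unfolding opsub_def by auto

lemma subs_restrict: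
  "U \<subseteq> carrier G \<Longrightarrow> B \<subseteq> U \<Longrightarrow> subs (G\<lparr>carrier := U\<rparr>) W A B = subs G W A B"
  unfolding subs_def using opsub_restrict by blast

lemma subs_mono: "A' \<subseteq> A \<Longrightarrow> B \<subseteq> B' \<Longrightarrow> subs G W A B \<subseteq> subs G W A' B'"
  unfolding subs_def by blast

lemma subs_antimono_ops: "W \<subseteq> W' \<Longrightarrow> subs G W' A B \<subseteq> subs G W A B"
  unfolding subs_def opsub_def by blast

lemma opsub_antimono: "opsub G W' N \<Longrightarrow> W \<subseteq> W' \<Longrightarrow> opsub G W N"
  unfolding opsub_def by blast

lemma opsub_carrier: "opsub G W N \<Longrightarrow> a \<in> N \<Longrightarrow> a \<in> carrier G"
  and opsub_sub: "opsub G W N \<Longrightarrow> N \<subseteq> carrier G"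
  and opsub_zero: "opsub G W N \<Longrightarrow> \<zero>\<^bsub>G\<^esub> \<in> N"
  and opsub_add: "opsub G W N \<Longrightarrow> a \<in> N \<Longrightarrow> b \<in> N \<Longrightarrow> a \<oplus>\<^bsub>G\<^esub> b \<in> N"
  and opsub_op: "opsub G W N \<Longrightarrow> w \<in> W \<Longrightarrow> a \<in> N \<Longrightarrow> w a \<in> N"
  unfolding opsub_def by blast+

lemma gen_incl: "A \<subseteq> gen G W A" and gen_incl1: "a \<in> A \<Longrightarrow> a \<in> gen G W A"
  and gen_min: "opsub G W N \<Longrightarrow> A \<subseteq> N \<Longrightarrow> gen G W A \<subseteq> N"
  unfolding gen_def by blast+

lemma endo_closed: "w \<in> endo G \<Longrightarrow> a \<in> carrier G \<Longrightarrow> w a \<in> carrier G"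
  and endo_add: "w \<in> endo G \<Longrightarrow> a \<in> carrier G \<Longrightarrow> b \<in> carrier G \<Longrightarrow> w (a \<oplus>\<^bsub>G\<^esub> b) = w a \<oplus>\<^bsub>G\<^esub> w b"
  unfolding endo_def by blast+

lemma endo_comp: "w \<in> endo G \<Longrightarrow> w' \<in> endo G \<Longrightarrow> (\<lambda>a. w (w' a)) \<in> endo G"
  unfolding endo_def by simp

lemma endo_id: "(\<lambda>a. a) \<in> endo G" unfolding endo_def by simp

lemma endo_pow: "w \<in> endo G \<Longrightarrow> w ^^ k \<in> endo G"
  by (induction k) (auto simp: endo_def)

lemma endo_restrict:
  "w \<in> endo G \<Longrightarrow> opsub G {w} U \<Longrightarrow> w \<in> endo (G\<lparr>carrier := U\<rparr>)"
  unfolding endo_def opsub_def by (auto simp: subset_iff)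

context abelian_group begin

lemma opsub_neg: assumes "opsub G W N" "a \<in> N" shows "\<ominus> a \<in> N"
proof -
  obtain b where "b \<in> N" "a \<oplus> b = \<zero>" using assms unfolding opsub_def by blast
  then show ?thesis using assms minus_equality[of b a] opsub_carrier[OF assms(1)]
    by (simp add: a_comm)
qed

lemma opsub_minus: "opsub G W N \<Longrightarrow> a \<in> N \<Longrightarrow> b \<in> N \<Longrightarrow> a \<ominus> b \<in> N"
  unfolding a_minus_def by (blast intro: opsub_add opsub_neg)

lemma opsubI:
  assumes "N \<subseteq> carrier G" "\<zero> \<in> N" "\<And>a b. a \<in> N \<Longrightarrow> b \<in> N \<Longrightarrow> a \<oplus> b \<in> N"
    "\<And>a. a \<in> N \<Longrightarrow> \<ominus> a \<in> N" "\<And>w a. w \<in> W \<Longrightarrow> a \<in> N \<Longrightarrow> w a \<in> N"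
  shows "opsub G W N"
  unfolding opsub_def using assms by (meson r_neg subsetD)

lemma endo_zero: assumes "w \<in> endo G" shows "w \<zero> = \<zero>"
proof -
  have c: "w \<zero> \<in> carrier G" using endo_closed[OF assms] by simp
  have "w \<zero> \<oplus> w \<zero> = w \<zero>" using endo_add[OF assms, of \<zero> \<zero>] by simp
  then show ?thesis using c by (metis add.l_cancel_one')
qed

lemma endo_neg: assumes "w \<in> endo G" "a \<in> carrier G" shows "w (\<ominus> a) = \<ominus> w a"
proof -
  have "w (\<ominus> a) \<oplus> w a = \<zero>"
    using endo_add[OF assms(1), of "\<ominus> a" a] endo_zero[OF assms(1)] assms(2) by (simp add: l_neg)
  then show ?thesis using assms endo_closed[OF assms(1)] by (metis minus_equality a_inv_closed)
qed

lemma endo_minus: "w \<in> endo G \<Longrightarrow> a \<in> carrier G \<Longrightarrow> b \<in> carrier G \<Longrightarrow> w (a \<ominus> b) = w a \<ominus> w b"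
  unfolding a_minus_def by (simp add: endo_add endo_neg)

lemma add_minus_cancel: "a \<in> carrier G \<Longrightarrow> b \<in> carrier G \<Longrightarrow> (a \<oplus> b) \<ominus> a = b"
  by (metis a_comm a_minus_def add.inv_solve_right add.m_closed)

lemma minus_add_cancel: "a \<in> carrier G \<Longrightarrow> b \<in> carrier G \<Longrightarrow> (a \<ominus> b) \<oplus> b = a"
  by (simp add: a_minus_def a_assoc l_neg)

lemma eq_of_minus_zero:
  "a \<ominus> b = \<zero> \<Longrightarrow> a \<in> carrier G \<Longrightarrow> b \<in> carrier G \<Longrightarrow> a = b"
  using minus_add_cancel[of a b] by simp

lemma opsub_top: "W \<subseteq> endo G \<Longrightarrow> opsub G W (carrier G)"
  by (rule opsubI) (auto simp: endo_def)

lemma opsub_bot: "W \<subseteq> endo G \<Longrightarrow> opsub G W {\<zero>}"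
  by (rule opsubI) (use endo_zero in auto)

lemma opsub_Int: "opsub G W N \<Longrightarrow> opsub G W M \<Longrightarrow> opsub G W (N \<inter> M)"
  by (rule opsubI) (auto intro: opsub_carrier opsub_zero opsub_add opsub_neg opsub_op)

lemma opsub_gen: assumes "W \<subseteq> endo G" "A \<subseteq> carrier G" shows "opsub G W (gen G W A)"
proof (rule opsubI)
  show "gen G W A \<subseteq> carrier G" using gen_min[OF opsub_top[OF assms(1)] assms(2)] .
qed (unfold gen_def, auto intro: opsub_zero opsub_add opsub_neg opsub_op)

lemma set_addI: "a \<in> A \<Longrightarrow> b \<in> B \<Longrightarrow> a \<oplus> b \<in> A <+>\<^bsub>G\<^esub> B"
  unfolding set_add_def' by blast

lemma set_addE: assumes "c \<in> A <+>\<^bsub>G\<^esub> B" obtains a b where "a \<in> A" "b \<in> B" "c = a \<oplus> b"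
  using assms unfolding set_add_def' by blast

lemma opsub_sum:
  assumes WE: "W \<subseteq> endo G" and N: "opsub G W N" and M: "opsub G W M"
  shows "opsub G W (N <+>\<^bsub>G\<^esub> M)"
proof (rule opsubI)
  note cN = opsub_carrier[OF N] note cM = opsub_carrier[OF M]
  show "N <+>\<^bsub>G\<^esub> M \<subseteq> carrier G" using cN cM by (auto elim!: set_addE)
  show "\<zero> \<in> N <+>\<^bsub>G\<^esub> M" using set_addI[OF opsub_zero[OF N] opsub_zero[OF M]] by simp
  fix a b assume "a \<in> N <+>\<^bsub>G\<^esub> M" 
  then obtain n m where a: "n \<in> N" "m \<in> M" "a = n \<oplus> m" by (auto elim!: set_addE)
  show "\<ominus> a \<in> N <+>\<^bsub>G\<^esub> M"
    using a cN cM set_addI[OF opsub_neg[OF N] opsub_neg[OF M]] by (simp add: minus_add)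
  { assume "b \<in> N <+>\<^bsub>G\<^esub> M"
    then obtain n' m' where b: "n' \<in> N" "m' \<in> M" "b = n' \<oplus> m'" by (auto elim!: set_addE)
    have "a \<oplus> b = (n \<oplus> n') \<oplus> (m \<oplus> m')" using a b cN cM by (simp add: a_ac)
    then show "a \<oplus> b \<in> N <+>\<^bsub>G\<^esub> M" using set_addI[OF opsub_add[OF N] opsub_add[OF M]] a b by simp }
  { fix w assume w: "w \<in> W"
    then have "w a = w n \<oplus> w m" using endo_add[OF subsetD[OF WE w] cN[OF a(1)] cM[OF a(2)]] a(3) by simp
    then show "w a \<in> N <+>\<^bsub>G\<^esub> M" using set_addI[OF opsub_op[OF N w] opsub_op[OF M w]] a by simp }
qed

lemma set_add_incl1: "opsub G W N \<Longrightarrow> opsub G W M \<Longrightarrow> N \<subseteq> N <+>\<^bsub>G\<^esub> M"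
  using opsub_zero[of G W M] opsub_carrier[of G W N] set_addI[of _ N \<zero> M] by force

lemma set_add_incl2: "opsub G W N \<Longrightarrow> opsub G W M \<Longrightarrow> M \<subseteq> N <+>\<^bsub>G\<^esub> M"
  using opsub_zero[of G W N] opsub_carrier[of G W M] set_addI[of \<zero> N _ M] by force

lemma set_add_least: "opsub G W K \<Longrightarrow> N \<subseteq> K \<Longrightarrow> M \<subseteq> K \<Longrightarrow> N <+>\<^bsub>G\<^esub> M \<subseteq> K"
  by (auto elim!: set_addE intro: opsub_add)

text \<open>The cancellation half of the modular law: if \<open>m = n \<oplus> b\<close>, the
  summand b is a difference of elements of \<open>M\<close>, hence lies in
  \<open>M \<inter> B\<close> and so in \<open>N\<close>.\<close>

lemma modular_cancel:
  assumes N: "opsub G W N" and M: "opsub G W M" and B: "opsub G W B"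
    and "N \<subseteq> M" "M \<inter> B \<subseteq> N" "M \<subseteq> N <+>\<^bsub>G\<^esub> B"
  shows "M \<subseteq> N"
proof
  fix m assume m: "m \<in> M"
  then obtain n b where nb: "n \<in> N" "b \<in> B" "m = n \<oplus> b" using assms(6) by (auto elim!: set_addE)
  have c: "n \<in> carrier G" "b \<in> carrier G" using opsub_carrier[OF N nb(1)] opsub_carrier[OF B nb(2)] .
  have "b = m \<ominus> n" using c nb by (simp add: add_minus_cancel)
  then have "b \<in> M" using opsub_minus[OF M m] nb assms(4) by blast
  then have "b \<in> N" using nb assms(5) by blast
  then show "m \<in> N" using nb opsub_add[OF N] by blast
qed

lemma subs_Int_mem: "N \<in> subs G W A C \<Longrightarrow> opsub G W B \<Longrightarrow> A \<subseteq> B \<Longrightarrow> N \<inter> B \<in> subs G W A B"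
  unfolding subs_def using opsub_Int by blast

lemma subs_sum_mem:
  assumes "W \<subseteq> endo G" "N \<in> subs G W A C" "opsub G W B" "opsub G W C" "B \<subseteq> C"
  shows "N <+>\<^bsub>G\<^esub> B \<in> subs G W B C"
proof -
  have N: "opsub G W N" "N \<subseteq> C" using assms(2) unfolding subs_def by auto
  show ?thesis unfolding subs_def
    using opsub_sum[OF assms(1) N(1) assms(3)] set_add_incl2[OF N(1) assms(3)]
      set_add_least[OF assms(4) N(2) assms(5)] by blast
qed

lemma set_add_mono: "A \<subseteq> A' \<Longrightarrow> B \<subseteq> B' \<Longrightarrow> A <+>\<^bsub>G\<^esub> B \<subseteq> A' <+>\<^bsub>G\<^esub> B'"
  by (auto elim!: set_addE intro: set_addI)

lemma modular_cancel_subs: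
  assumes WE: "W \<subseteq> endo G" and B: "opsub G W B" and N: "N \<in> subs G W A C" and M: "M \<in> subs G W A C"
    and "N \<subseteq> M" "M \<inter> B = N \<inter> B" "M <+>\<^bsub>G\<^esub> B = N <+>\<^bsub>G\<^esub> B"
  shows "M \<subseteq> N"
proof -
  have s: "opsub G W N" "opsub G W M" using N M unfolding subs_def by auto
  show ?thesis
    by (rule modular_cancel[OF s B]) (use assms set_add_incl1[OF s(2) B] in blast)+
qed

text \<open>Among comparable terms, a term of the chain is determined by its intersection with
  \<open>B\<close> and its sum with \<open>B\<close>. The one is a submodule of B/A, the other of
  C/B, so both become stationary.\<close>

lemma ACC_subs_trans:
  assumes WE: "W \<subseteq> endo G" and B: "opsub G W B" and C: "opsub G W C" and AB: "A \<subseteq> B" "B \<subseteq> C"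
    and 1: "ACC (subs G W A B)" and 2: "ACC (subs G W B C)"
  shows "ACC (subs G W A C)"
  unfolding ACC_def
proof (intro allI impI)
  fix N assume N: "\<forall>i. N i \<in> subs G W A C \<and> N i \<subseteq> N (Suc i)"
  obtain k where k: "\<And>i. i \<ge> k \<Longrightarrow> N i \<inter> B = N k \<inter> B"
    by (rule ACC_D[OF 1, of "\<lambda>i. N i \<inter> B"]) (use N subs_Int_mem B AB in blast)+
  have "N i <+>\<^bsub>G\<^esub> B \<in> subs G W B C" for i
    by (rule subs_sum_mem[OF WE _ B C AB(2), of _ A]) (use N in blast)
  moreover have "N i <+>\<^bsub>G\<^esub> B \<subseteq> N (Suc i) <+>\<^bsub>G\<^esub> B" for i by (rule set_add_mono) (use N in auto)
  ultimately obtain l where l: "\<And>i. i \<ge> l \<Longrightarrow> N i <+>\<^bsub>G\<^esub> B = N l <+>\<^bsub>G\<^esub> B"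
    by (rule ACC_D[OF 2, of "\<lambda>i. N i <+>\<^bsub>G\<^esub> B"]) auto
  have "N i = N (max k l)" if i: "i \<ge> max k l" for i
  proof
    have mono: "N (max k l) \<subseteq> N i" using N i by (metis lift_Suc_mono_le)
    then show "N (max k l) \<subseteq> N i" .
    show "N i \<subseteq> N (max k l)"
      by (rule modular_cancel_subs[OF WE B _ _ mono, where A=A and C=C])
        (use N i k[of i] l[of i] k[of "max k l"] l[of "max k l"] in simp_all)
  qed
  then show "\<exists>k. \<forall>i\<ge>k. N i = N k" by blast
qed

lemma DCC_subs_trans:
  assumes WE: "W \<subseteq> endo G" and B: "opsub G W B" and C: "opsub G W C" and AB: "A \<subseteq> B" "B \<subseteq> C"
    and 1: "DCC (subs G W A B)" and 2: "DCC (subs G W B C)"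
  shows "DCC (subs G W A C)"
  unfolding DCC_def
proof (intro allI impI)
  fix N assume N: "\<forall>i. N i \<in> subs G W A C \<and> N (Suc i) \<subseteq> N i"
  obtain k where k: "\<And>i. i \<ge> k \<Longrightarrow> N i \<inter> B = N k \<inter> B"
    by (rule DCC_D[OF 1, of "\<lambda>i. N i \<inter> B"]) (use N subs_Int_mem B AB in blast)+
  have "N i <+>\<^bsub>G\<^esub> B \<in> subs G W B C" for i
    by (rule subs_sum_mem[OF WE _ B C AB(2), of _ A]) (use N in blast)
  moreover have "N (Suc i) <+>\<^bsub>G\<^esub> B \<subseteq> N i <+>\<^bsub>G\<^esub> B" for i by (rule set_add_mono) (use N in auto)
  ultimately obtain l where l: "\<And>i. i \<ge> l \<Longrightarrow> N i <+>\<^bsub>G\<^esub> B = N l <+>\<^bsub>G\<^esub> B"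
    by (rule DCC_D[OF 2, of "\<lambda>i. N i <+>\<^bsub>G\<^esub> B"]) auto
  have "N i = N (max k l)" if i: "i \<ge> max k l" for i
  proof
    have mono: "N i \<subseteq> N (max k l)" using N i by (metis lift_Suc_antimono_le)
    then show "N i \<subseteq> N (max k l)" .
    show "N (max k l) \<subseteq> N i"
      by (rule modular_cancel_subs[OF WE B _ _ mono, where A=A and C=C])
        (use N i k[of i] l[of i] k[of "max k l"] l[of "max k l"] in simp_all)
  qed
  then show "\<exists>k. \<forall>i\<ge>k. N i = N k" by blast
qed

text \<open>Second isomorphism theorem: intersection with \<open>Y\<close> separates nested
  submodules of (U+Y)/U.\<close>

lemma sum_quot_inj:
  assumes U: "opsub G W U" and Y: "opsub G W Y"
    and N: "N \<in> subs G W U (U <+>\<^bsub>G\<^esub> Y)" and M: "M \<in> subs G W U (U <+>\<^bsub>G\<^esub> Y)"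
    and "N \<subseteq> M" "M \<inter> Y = N \<inter> Y"
  shows "M \<subseteq> N"
proof -
  have s: "opsub G W N" "opsub G W M" "U \<subseteq> N" "M \<subseteq> U <+>\<^bsub>G\<^esub> Y" using N M unfolding subs_def by auto
  show ?thesis
    by (rule modular_cancel[OF s(1,2) Y]) (use assms s set_add_mono[of U N Y Y] in blast)+
qed

lemma noeth_sum:
  assumes WE: "W \<subseteq> endo G" and U: "opsub G W U" and Y: "opsub G W Y" and nX: "noeth G W U" and nY: "noeth G W Y"
  shows "noeth G W (U <+>\<^bsub>G\<^esub> Y)"
proof -
  have "ACC (subs G W U (U <+>\<^bsub>G\<^esub> Y))"
  proof (rule ACC_transfer[OF nY, of _ "\<lambda>N. N \<inter> Y"])
    show "N \<inter> Y \<in> subs G W {\<zero>} Y" if "N \<in> subs G W U (U <+>\<^bsub>G\<^esub> Y)" for N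
      using that opsub_Int[OF _ Y] opsub_zero unfolding subs_def by fastforce
    show "M \<subseteq> N" if "N \<in> subs G W U (U <+>\<^bsub>G\<^esub> Y)" "M \<in> subs G W U (U <+>\<^bsub>G\<^esub> Y)" "N \<subseteq> M" "M \<inter> Y = N \<inter> Y" for N M
      using sum_quot_inj[OF U Y that] .
  qed auto
  then show ?thesis
    using ACC_subs_trans[OF WE U opsub_sum[OF WE U Y] _ set_add_incl1[OF U Y] nX] opsub_zero[OF U] by simp
qed

text \<open>A/(A \<inter> B) embeds into C/B by adding \<open>B\<close>.\<close>

lemma DCC_subs_Int:
  assumes WE: "W \<subseteq> endo G" and A: "opsub G W A" and B: "opsub G W B" and C: "opsub G W C" "A \<subseteq> C" "B \<subseteq> C"
    and d: "DCC (subs G W B C)"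
  shows "DCC (subs G W (A \<inter> B) A)"
proof (rule DCC_transfer[OF d, of _ "\<lambda>N. N <+>\<^bsub>G\<^esub> B"])
  show "N <+>\<^bsub>G\<^esub> B \<in> subs G W B C" if "N \<in> subs G W (A \<inter> B) A" for N
    using subs_sum_mem[OF WE _ B C(1,3), of N "A \<inter> B"] that C(2) unfolding subs_def by auto
  show "M \<subseteq> N" if NM: "N \<in> subs G W (A \<inter> B) A" "M \<in> subs G W (A \<inter> B) A" "N \<subseteq> M" "M <+>\<^bsub>G\<^esub> B = N <+>\<^bsub>G\<^esub> B" for N M
    by (rule modular_cancel_subs[OF WE B NM(1-3)]) (use NM in \<open>auto simp: subs_def\<close>)
qed (auto intro: set_addI elim!: set_addE)

text \<open>Only additivity of \<open>h\<close> and a matching of operators are asked, and the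
  operator \<open>w\<close> matched to \<open>w'\<close> may differ from it. This admits semilinear
  maps such as \<theta>, which exchanges the action of r for that of a twist of r.\<close>

lemma image_opsub:
  assumes "abelian_group H" and N: "opsub G W N"
    and hc: "\<And>a. a \<in> N \<Longrightarrow> h a \<in> carrier H"
    and ha: "\<And>a b. a \<in> N \<Longrightarrow> b \<in> N \<Longrightarrow> h (a \<oplus> b) = h a \<oplus>\<^bsub>H\<^esub> h b"
    and hw: "\<And>w'. w' \<in> W' \<Longrightarrow> \<exists>w\<in>W. \<forall>a\<in>N. w' (h a) = h (w a)"
  shows "opsub H W' (h ` N)"
proof -
  interpret H: abelian_group H by fact
  have h0: "h \<zero> = \<zero>\<^bsub>H\<^esub>"
    using ha[OF opsub_zero[OF N] opsub_zero[OF N]] hc[OF opsub_zero[OF N]] by (metis H.add.l_cancel_one' l_zero zero_closed)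
  have hn: "h (\<ominus> a) = \<ominus>\<^bsub>H\<^esub> h a" if "a \<in> N" for a
    using ha[OF opsub_neg[OF N that] that] h0 hc[OF that] hc[OF opsub_neg[OF N that]] opsub_carrier[OF N that]
    by (metis H.minus_equality l_neg)
  show ?thesis
  proof (rule H.opsubI)
    show "\<zero>\<^bsub>H\<^esub> \<in> h ` N" using h0 opsub_zero[OF N] by (metis imageI)
    fix a b assume "a \<in> h ` N"
    then obtain a' where a': "a' \<in> N" "a = h a'" by blast
    show "\<ominus>\<^bsub>H\<^esub> a \<in> h ` N" using a' hn opsub_neg[OF N] by (metis imageI)
    { assume "b \<in> h ` N"
      then obtain b' where "b' \<in> N" "b = h b'" by blast
      then show "a \<oplus>\<^bsub>H\<^esub> b \<in> h ` N" using a' ha opsub_add[OF N] by (metis imageI) }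
    { fix w' assume "w' \<in> W'"
      then obtain w where "w \<in> W" "\<forall>a\<in>N. w' (h a) = h (w a)" using hw by blast
      then show "w' a \<in> h ` N" using a' opsub_op[OF N] by (metis imageI) }
  qed (use hc in blast)
qed

end

lemma abelian_group_restrict:
  assumes "abelian_group G" "opsub G W U"
  shows "abelian_group (G\<lparr>carrier := U\<rparr>)"
proof -
  interpret abelian_group G by fact
  note c = opsub_carrier[OF assms(2)]
  show ?thesis
  proof (rule abelian_groupI)
    show "\<exists>y\<in>carrier (G\<lparr>carrier := U\<rparr>). y \<oplus>\<^bsub>G\<lparr>carrier := U\<rparr>\<^esub> x = \<zero>\<^bsub>G\<lparr>carrier := U\<rparr>\<^esub>"
      if "x \<in> carrier (G\<lparr>carrier := U\<rparr>)" for x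
      using that opsub_neg[OF assms(2)] c l_neg by auto
  qed (use assms(2) c in \<open>auto simp: opsub_add opsub_zero a_ac\<close>)
qed

context abelian_group begin

lemma preimage_opsub:
  assumes "abelian_group H" and U: "opsub G W U" and K: "opsub H W' K"
    and hc: "\<And>a. a \<in> U \<Longrightarrow> h a \<in> carrier H"
    and ha: "\<And>a b. a \<in> U \<Longrightarrow> b \<in> U \<Longrightarrow> h (a \<oplus> b) = h a \<oplus>\<^bsub>H\<^esub> h b"
    and hw: "\<And>w. w \<in> W \<Longrightarrow> \<exists>w'\<in>W'. \<forall>a\<in>U. h (w a) = w' (h a)"
  shows "opsub G W {a \<in> U. h a \<in> K}"
proof -
  interpret H: abelian_group H by fact
  have h0: "h \<zero> = \<zero>\<^bsub>H\<^esub>"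
    using ha[OF opsub_zero[OF U] opsub_zero[OF U]] hc[OF opsub_zero[OF U]] by (metis H.add.l_cancel_one' l_zero zero_closed)
  have hn: "h (\<ominus> a) = \<ominus>\<^bsub>H\<^esub> h a" if "a \<in> U" for a
    using ha[OF opsub_neg[OF U that] that] h0 hc[OF that] hc[OF opsub_neg[OF U that]] opsub_carrier[OF U that]
    by (metis H.minus_equality l_neg)
  show ?thesis
  proof (rule opsubI)
    show "\<zero> \<in> {a \<in> U. h a \<in> K}" using h0 opsub_zero[OF U] opsub_zero[OF K] by simp
    fix a b assume a: "a \<in> {a \<in> U. h a \<in> K}"
    then show "\<ominus> a \<in> {a \<in> U. h a \<in> K}" using hn opsub_neg[OF U] H.opsub_neg[OF K] by simp
    { assume "b \<in> {a \<in> U. h a \<in> K}"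
      then show "a \<oplus> b \<in> {a \<in> U. h a \<in> K}" using a ha opsub_add[OF U] opsub_add[OF K] by simp }
    { fix w assume w: "w \<in> W"
      then obtain w' where "w' \<in> W'" "\<forall>a\<in>U. h (w a) = w' (h a)" using hw by blast
      then show "w a \<in> {a \<in> U. h a \<in> K}" using a opsub_op[OF U w] opsub_op[OF K] by simp }
  qed (use opsub_sub[OF U] in blast)
qed

text \<open>Two elements with the same image differ by an element of the kernel, and the kernel lies
  in \<open>N\<close>. Supplies the last premise of the transfer lemmas where a factor module is
  embedded by \<open>h\<close>.\<close>

lemma kernel_cancel:
  assumes "abelian_group H" and N: "opsub G W N" and N': "opsub G W' N'" and NN: "N \<subseteq> N'"
    and hc: "\<And>a. a \<in> N' \<Longrightarrow> h a \<in> carrier H"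
    and ha: "\<And>a b. a \<in> N' \<Longrightarrow> b \<in> N' \<Longrightarrow> h (a \<oplus> b) = h a \<oplus>\<^bsub>H\<^esub> h b"
    and ker: "\<And>a. a \<in> N' \<Longrightarrow> h a = \<zero>\<^bsub>H\<^esub> \<Longrightarrow> a \<in> N" and eq: "h ` N' = h ` N"
  shows "N' \<subseteq> N"
proof
  interpret H: abelian_group H by fact
  fix a assume a: "a \<in> N'"
  then have "h a \<in> h ` N'" by blast
  then obtain b where b: "b \<in> N" "h a = h b" unfolding eq by blast
  then have bN': "b \<in> N'" using NN by blast
  have d: "a \<ominus> b \<in> N'" by (rule opsub_minus[OF N' a bN'])
  have ab: "(a \<ominus> b) \<oplus> b = a" by (rule minus_add_cancel[OF opsub_carrier[OF N' a] opsub_carrier[OF N' bN']])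
  have "h (a \<ominus> b) \<oplus>\<^bsub>H\<^esub> h b = h b" using ha[OF d bN'] ab b(2) by simp
  then have "h (a \<ominus> b) = \<zero>\<^bsub>H\<^esub>" using hc[OF d] hc[OF bN'] by (metis H.add.r_cancel_one)
  then show "a \<in> N" using opsub_add[OF N ker[OF d] b(1)] ab by simp
qed

end

text \<open>A module version of Hilbert's basis theorem: if \<open>\<theta>\<close> normalises the operators \<open>W\<close>, a submodule
  of the module generated by a Noetherian \<open>U\<close> over \<open>W\<close> and \<open>\<theta>\<close> is determined by its leading
  submodules \<open>lead N j\<close> of \<open>U\<close>.\<close>

primrec filtration :: "('m, 'b) ring_scheme \<Rightarrow> ('m \<Rightarrow> 'm) \<Rightarrow> 'm set \<Rightarrow> nat \<Rightarrow> 'm set" where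
  "filtration G \<theta> U 0 = {\<zero>\<^bsub>G\<^esub>}"
| "filtration G \<theta> U (Suc j) = filtration G \<theta> U j <+>\<^bsub>G\<^esub> (\<theta> ^^ j) ` U"

context
  fixes G (structure) and W :: "('a \<Rightarrow> 'a) set" and \<theta> :: "'a \<Rightarrow> 'a" and U :: "'a set"
  assumes G: "abelian_group G" and WE: "W \<subseteq> endo G" and th: "\<theta> \<in> endo G"
    and n1: "\<And>w. w \<in> W \<Longrightarrow> \<exists>w'\<in>W. \<forall>a\<in>carrier G. \<theta> (w a) = w' (\<theta> a)"
    and n2: "\<And>w. w \<in> W \<Longrightarrow> \<exists>w'\<in>W. \<forall>a\<in>carrier G. w (\<theta> a) = \<theta> (w' a)"
    and U: "opsub G W U"
begin

interpretation abelian_group G by (rule G)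

abbreviation filt where "filt \<equiv> filtration G \<theta> U"

text \<open>Expressions in powers of \<theta> with entries from \<open>U\<close> need not be unique,
  so an element has no well-defined degree or leading coefficient. Congruence modulo
  \<open>filt j\<close>, the part of degree below j, replaces both.\<close>

definition lead :: "'a set \<Rightarrow> nat \<Rightarrow> 'a set" where
  "lead N j = {u \<in> U. (\<theta> ^^ j) u \<in> N <+>\<^bsub>G\<^esub> filt j}"

lemma thj: "\<theta> ^^ j \<in> endo G" using endo_pow[OF th] .

lemma n1_pow: assumes "w \<in> W" shows "\<exists>w'\<in>W. \<forall>a\<in>carrier G. (\<theta> ^^ j) (w a) = w' ((\<theta> ^^ j) a)"
proof (induction j)
  case 0 then show ?case using assms by auto
next
  case (Suc j)
  then obtain w' where w': "w' \<in> W" "\<forall>a\<in>carrier G. (\<theta> ^^ j) (w a) = w' ((\<theta> ^^ j) a)" by blast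
  obtain w'' where "w'' \<in> W" "\<forall>a\<in>carrier G. \<theta> (w' a) = w'' (\<theta> a)" using n1[OF w'(1)] by blast
  then show ?case using w' endo_closed[OF thj] by (intro bexI[of _ w'']) auto
qed

lemma n2_pow: assumes "w \<in> W" shows "\<exists>w'\<in>W. \<forall>a\<in>carrier G. w ((\<theta> ^^ j) a) = (\<theta> ^^ j) (w' a)"
proof (induction j)
  case 0 then show ?case using assms by auto
next
  case (Suc j)
  then obtain w' where w': "w' \<in> W" "\<forall>a\<in>carrier G. w ((\<theta> ^^ j) a) = (\<theta> ^^ j) (w' a)" by blast
  obtain w'' where "w'' \<in> W" "\<forall>a\<in>carrier G. w' (\<theta> a) = \<theta> (w'' a)" using n2[OF w'(1)] by blast
  then show ?case using w' endo_closed[OF th] by (intro bexI[of _ w'']) (auto simp: funpow_swap1)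
qed

lemma theta_pow_image: assumes N: "opsub G W N" shows "opsub G W ((\<theta> ^^ j) ` N)"
proof (rule image_opsub[OF G N])
  fix w assume "w \<in> W"
  then show "\<exists>w'\<in>W. \<forall>a\<in>N. w ((\<theta> ^^ j) a) = (\<theta> ^^ j) (w' a)"
    using n2_pow[of w j] opsub_sub[OF N] by blast
qed (use opsub_carrier[OF N] endo_closed[OF thj] endo_add[OF thj] in auto)

lemma filt_opsub: "opsub G W (filt j)"
  by (induction j) (auto intro: opsub_sum[OF WE] theta_pow_image[OF U] opsub_bot[OF WE])

lemma filt_mono: "filt j \<subseteq> filt (Suc j)"
  using set_add_incl1[OF filt_opsub theta_pow_image[OF U]] by simp

lemma filt_mono_le: "i \<le> j \<Longrightarrow> filt i \<subseteq> filt j"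
  by (rule lift_Suc_mono_le[of filt]) (rule filt_mono)

lemma theta_filt: "a \<in> filt j \<Longrightarrow> \<theta> a \<in> filt (Suc j)"
proof (induction j arbitrary: a)
  case 0
  then show ?case using opsub_zero[OF filt_opsub[of "Suc 0"]] endo_zero[OF th] by simp
next
  case (Suc j)
  then obtain f u where fu: "f \<in> filt j" "u \<in> U" "a = f \<oplus> (\<theta> ^^ j) u" by (auto elim!: set_addE)
  have "\<theta> a = \<theta> f \<oplus> (\<theta> ^^ Suc j) u"
    using fu endo_add[OF th] opsub_carrier[OF filt_opsub] endo_closed[OF thj] opsub_carrier[OF U] by simp
  moreover have "\<dots> \<in> filt (Suc j) <+>\<^bsub>G\<^esub> (\<theta> ^^ Suc j) ` U"
    by (rule set_addI) (use Suc.IH fu in auto)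
  ultimately show ?case by simp
qed

lemma filt_Union: "opsub G (insert \<theta> W) (\<Union>j. filt j)"
proof (rule opsubI)
  fix a b assume a: "a \<in> (\<Union>j. filt j)"
  then obtain i where i: "a \<in> filt i" by blast
  show "\<ominus> a \<in> (\<Union>j. filt j)" using opsub_neg[OF filt_opsub i] by blast
  { assume "b \<in> (\<Union>j. filt j)"
    then obtain j where j: "b \<in> filt j" by blast
    have "a \<oplus> b \<in> filt (max i j)"
      by (rule opsub_add[OF filt_opsub]) (use i j filt_mono_le[of i "max i j"] filt_mono_le[of j "max i j"] in auto)
    then show "a \<oplus> b \<in> (\<Union>j. filt j)" by blast }
  { fix w assume "w \<in> insert \<theta> W"
    then show "w a \<in> (\<Union>j. filt j)" using theta_filt[OF i] opsub_op[OF filt_opsub _ i] by blast }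
qed (use opsub_sub[OF filt_opsub] opsub_zero[OF filt_opsub] in blast)+

lemma gen_filt: "gen G (insert \<theta> W) U \<subseteq> (\<Union>j. filt j)"
proof (rule gen_min[OF filt_Union])
  have "U \<subseteq> filt (Suc 0)"
    using set_add_incl2[OF filt_opsub[of 0] theta_pow_image[OF U, of 0]] by simp
  then show "U \<subseteq> (\<Union>j. filt j)" by blast
qed

lemma lead_subs: assumes N: "opsub G (insert \<theta> W) N" shows "lead N j \<in> subs G W {\<zero>} U"
proof -
  have "opsub G W (lead N j)" unfolding lead_def
  proof (rule preimage_opsub[OF G U, where W'=W])
    show "opsub G W (N <+>\<^bsub>G\<^esub> filt j)"
      using opsub_sum[OF WE opsub_antimono[OF N] filt_opsub] by blast
    fix w assume "w \<in> W"
    then show "\<exists>w'\<in>W. \<forall>a\<in>U. (\<theta> ^^ j) (w a) = w' ((\<theta> ^^ j) a)"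
      using n1_pow[of w j] opsub_sub[OF U] by blast
  qed (use opsub_carrier[OF U] endo_closed[OF thj] endo_add[OF thj] in auto)
  then show ?thesis unfolding subs_def using opsub_zero by (auto simp: lead_def)
qed

lemma lead_mono: "N \<subseteq> M \<Longrightarrow> lead N j \<subseteq> lead M j"
  unfolding lead_def using set_add_mono[of N M "filt j" "filt j"] by blast

lemma lead_Suc: assumes N: "opsub G (insert \<theta> W) N" shows "lead N j \<subseteq> lead N (Suc j)"
proof
  fix u assume "u \<in> lead N j"
  then obtain n f where nf: "u \<in> U" "n \<in> N" "f \<in> filt j" "(\<theta> ^^ j) u = n \<oplus> f"
    unfolding lead_def by (auto elim!: set_addE)
  have "(\<theta> ^^ Suc j) u = \<theta> n \<oplus> \<theta> f"
    using nf endo_add[OF th] opsub_carrier[OF filt_opsub] opsub_carrier[OF N] by simp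
  moreover have "\<theta> n \<oplus> \<theta> f \<in> N <+>\<^bsub>G\<^esub> filt (Suc j)"
    by (rule set_addI) (use nf theta_filt opsub_op[OF N] in auto)
  ultimately show "u \<in> lead N (Suc j)" using nf unfolding lead_def by simp
qed

text \<open>Induction on the degree bound: the top coefficient of m is also the top coefficient of
  an element n of \<open>N\<close>, and m - n has smaller degree and still lies in
  \<open>M\<close>.\<close>

lemma lead_inj:
  assumes N: "opsub G (insert \<theta> W) N" and M: "opsub G (insert \<theta> W) M" and NM: "N \<subseteq> M"
    and l: "\<And>j. lead M j \<subseteq> lead N j"
  shows "m \<in> M \<Longrightarrow> m \<in> filt j \<Longrightarrow> m \<in> N"
proof (induction j arbitrary: m)
  case 0 then show ?case using opsub_zero[OF N] by simp
next
  case (Suc j)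
  then obtain f u where fu: "f \<in> filt j" "u \<in> U" "m = f \<oplus> (\<theta> ^^ j) u" by (auto elim!: set_addE)
  have c: "m \<in> carrier G" "f \<in> carrier G" "(\<theta> ^^ j) u \<in> carrier G"
    using fu Suc.prems(1) opsub_carrier[OF filt_opsub] endo_closed[OF thj] opsub_carrier[OF U] opsub_carrier[OF M] by auto
  have "(\<theta> ^^ j) u = m \<oplus> \<ominus> f" using c fu(3) by (simp add: a_ac r_neg2)
  moreover have "m \<oplus> \<ominus> f \<in> M <+>\<^bsub>G\<^esub> filt j"
    using set_addI[OF Suc.prems(1) opsub_neg[OF filt_opsub fu(1)]] .
  ultimately have "u \<in> lead M j" using fu(2) unfolding lead_def by simp
  then have "u \<in> lead N j" using l by blast
  then obtain n f' where nf: "n \<in> N" "f' \<in> filt j" "(\<theta> ^^ j) u = n \<oplus> f'"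
    unfolding lead_def by (auto elim!: set_addE)
  have c': "n \<in> carrier G" "f' \<in> carrier G" using nf opsub_carrier[OF N] opsub_carrier[OF filt_opsub] by auto
  have e: "m = n \<oplus> (f \<oplus> f')" using c c' fu(3) nf(3) by (simp add: a_ac)
  have "f \<oplus> f' = m \<ominus> n" unfolding e a_minus_def using c c' by (simp add: a_ac r_neg2 r_neg)
  moreover have "m \<ominus> n \<in> M" using opsub_minus[OF M Suc.prems(1)] nf(1) NM by blast
  ultimately have "f \<oplus> f' \<in> N" using Suc.IH opsub_add[OF filt_opsub fu(1) nf(2)] by simp
  then show ?case using e opsub_add[OF N nf(1)] by simp
qed

theorem noeth_gen_insert:
  assumes nU: "noeth G W U"
  shows "noeth G (insert \<theta> W) (gen G (insert \<theta> W) U)"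
  unfolding ACC_def
proof (intro allI impI)
  fix N assume "\<forall>i. N i \<in> subs G (insert \<theta> W) {\<zero>} (gen G (insert \<theta> W) U) \<and> N i \<subseteq> N (Suc i)"
  then have N: "\<And>i. opsub G (insert \<theta> W) (N i)" and NF: "\<And>i. N i \<subseteq> (\<Union>j. filt j)" and inc: "\<And>i. N i \<subseteq> N (Suc i)"
    using gen_filt unfolding subs_def by blast+
  have mono: "N i \<subseteq> N i'" if "i \<le> i'" for i i' using lift_Suc_mono_le[of N, OF inc that] .
  have lm: "lead (N i) j \<subseteq> lead (N i') j'" if "i \<le> i'" "j \<le> j'" for i i' j j'
    using lead_mono[OF mono[OF that(1)], of j] lift_Suc_mono_le[of "lead (N i')", OF lead_Suc[OF N] that(2)] by blast
  \<comment> \<open>\<open>lead (N i) j\<close> grows in both indices. The diagonal becomes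
    stationary at some k, which settles all j \<ge> k at once; only the finitely many j < k are
    stabilised separately.\<close>
  obtain k where k: "\<And>i. i \<ge> k \<Longrightarrow> lead (N i) i = lead (N k) k"
    by (rule ACC_D[OF nU, of "\<lambda>i. lead (N i) i"]) (use lead_subs[OF N] lm in auto)
  have "\<exists>l. \<forall>i\<ge>l. lead (N i) j = lead (N l) j" for j
    by (rule ACC_D[OF nU, of "\<lambda>i. lead (N i) j"]) (use lead_subs[OF N] lm in auto)
  then obtain l where l: "\<And>i j. i \<ge> l j \<Longrightarrow> lead (N i) j = lead (N (l j)) j" by metis
  define m where "m = Max (insert k (l ` {..<k}))"
  have mk: "m \<ge> k" and ml: "\<And>j. j < k \<Longrightarrow> m \<ge> l j" unfolding m_def by auto
  have "N i = N m" if i: "i \<ge> m" for i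
  proof
    show "N m \<subseteq> N i" using mono[OF i] .
    have le: "lead (N i) j \<subseteq> lead (N m) j" for j
    proof (cases "j < k")
      case True
      then show ?thesis using l[of j i] l[of j m] ml[OF True] i by simp
    next
      case False
      have "lead (N i) j \<subseteq> lead (N (max i j)) (max i j)" by (rule lm) auto
      also have "\<dots> = lead (N k) k" by (rule k) (use False in auto)
      also have "\<dots> \<subseteq> lead (N m) j" by (rule lm) (use False mk in auto)
      finally show ?thesis .
    qed
    show "N i \<subseteq> N m"
    proof
      fix a assume a: "a \<in> N i"
      then obtain j where "a \<in> filt j" using NF by blast
      then show "a \<in> N m" using lead_inj[OF N N \<open>N m \<subseteq> N i\<close> le a] by blast
    qed
  qed
  then show "\<exists>k. \<forall>i\<ge>k. N i = N k" by blast
qed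

end

section \<open>Commuting operators\<close>

text \<open>The ring of polynomials in the operators \<open>W\<close> with integer coefficients,
  realised as functions. Since \<open>alg_op\<close> adds a single operator on the left, properties
  are checked for one operator at a time, and closure under composition is a consequence.\<close>

inductive_set alg :: "('m, 'b) ring_scheme \<Rightarrow> ('m \<Rightarrow> 'm) set \<Rightarrow> ('m \<Rightarrow> 'm) set"
  for G :: "('m, 'b) ring_scheme" and W where
  alg_zero: "(\<lambda>a. \<zero>\<^bsub>G\<^esub>) \<in> alg G W"
| alg_one: "(\<lambda>a. a) \<in> alg G W"
| alg_op: "w \<in> W \<Longrightarrow> t \<in> alg G W \<Longrightarrow> (\<lambda>a. w (t a)) \<in> alg G W"
| alg_add: "t \<in> alg G W \<Longrightarrow> t' \<in> alg G W \<Longrightarrow> (\<lambda>a. t a \<oplus>\<^bsub>G\<^esub> t' a) \<in> alg G W"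
| alg_neg: "t \<in> alg G W \<Longrightarrow> (\<lambda>a. \<ominus>\<^bsub>G\<^esub> t a) \<in> alg G W"

definition commuting :: "('m, 'b) ring_scheme \<Rightarrow> ('m \<Rightarrow> 'm) set \<Rightarrow> bool" where
  "commuting G W \<longleftrightarrow> (\<forall>w\<in>W. \<forall>w'\<in>W. \<forall>a\<in>carrier G. w (w' a) = w' (w a))"

lemma alg_comp: "t \<in> alg G W \<Longrightarrow> t' \<in> alg G W \<Longrightarrow> (\<lambda>a. t (t' a)) \<in> alg G W"
  by (induction rule: alg.induct) (auto intro: alg.intros)

lemma alg_pow: "t \<in> alg G W \<Longrightarrow> t ^^ k \<in> alg G W"
proof (induction k)
  case 0 then show ?case using alg_one by (simp add: id_def)
next
  case (Suc k) then show ?case using alg_comp[of t G W "t ^^ k"] by (simp add: comp_def)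
qed

lemma alg_minus: "t \<in> alg G W \<Longrightarrow> t' \<in> alg G W \<Longrightarrow> (\<lambda>a. t a \<ominus>\<^bsub>G\<^esub> t' a) \<in> alg G W"
  unfolding a_minus_def by (intro alg_add alg_neg)

context abelian_group begin

lemma alg_endo: assumes "W \<subseteq> endo G" "t \<in> alg G W" shows "t \<in> endo G"
  using assms(2)
proof (induction rule: alg.induct)
  case (alg_op w t) then show ?case using assms(1) endo_comp by blast
next
  case (alg_add t t') then show ?case unfolding endo_def by (auto simp: a_ac)
next
  case (alg_neg t) then show ?case unfolding endo_def by (auto simp: minus_add)
qed (auto simp: endo_def)

lemma alg_closed: "W \<subseteq> endo G \<Longrightarrow> t \<in> alg G W \<Longrightarrow> a \<in> carrier G \<Longrightarrow> t a \<in> carrier G"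
  by (rule endo_closed[OF alg_endo])

lemma alg_opsub: assumes "opsub G W N" "t \<in> alg G W" "a \<in> N" shows "t a \<in> N"
  using assms(2) by (induction rule: alg.induct)
    (use assms opsub_zero opsub_neg opsub_add opsub_op in fast)+

lemma alg_comm1:
  assumes "W \<subseteq> endo G" "commuting G W" "w \<in> W" "t \<in> alg G W" "a \<in> carrier G"
  shows "t (w a) = w (t a)"
  using assms(4)
proof (induction rule: alg.induct)
  have w: "w \<in> endo G" using assms by blast
    { case alg_zero then show ?case using endo_zero[OF w] by simp }
  { case alg_one then show ?case by simp }
  { case (alg_op w' t)
    have "t a \<in> carrier G" by (rule alg_closed[OF assms(1) alg_op(2) assms(5)])
    then show ?case using alg_op assms(2,3) unfolding commuting_def by simp }
  { case (alg_add t t')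
    have "t a \<in> carrier G" "t' a \<in> carrier G"
      using alg_closed[OF assms(1) alg_add(1) assms(5)] alg_closed[OF assms(1) alg_add(2) assms(5)] .
    then show ?case using alg_add endo_add[OF w] by simp }
  { case (alg_neg t)
    have "t a \<in> carrier G"
      by (rule alg_closed[OF assms(1) alg_neg(1) assms(5)])
    then show ?case using alg_neg endo_neg[OF w] by simp }
qed

lemma alg_comm:
  assumes "W \<subseteq> endo G" "commuting G W" "t \<in> alg G W" "t' \<in> alg G W" "a \<in> carrier G"
  shows "t (t' a) = t' (t a)"
  using assms(3)
proof (induction rule: alg.induct)
  have t': "t' \<in> endo G" using alg_endo assms by blast
  { case alg_zero then show ?case using endo_zero[OF t'] by simp }
  { case alg_one then show ?case by simp }
  { case (alg_op w t)
    have "t a \<in> carrier G" by (rule alg_closed[OF assms(1) alg_op(2) assms(5)])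
    then show ?case using alg_op alg_comm1[OF assms(1,2) alg_op(1) assms(4)] by simp }
  { case (alg_add t t')
    have "t a \<in> carrier G" "t' a \<in> carrier G"
      using alg_closed[OF assms(1) alg_add(1) assms(5)] alg_closed[OF assms(1) alg_add(2) assms(5)] .
    then show ?case using alg_add endo_add[OF t'] by simp }
  { case (alg_neg t)
    have "t a \<in> carrier G"
      by (rule alg_closed[OF assms(1) alg_neg(1) assms(5)])
    then show ?case using alg_neg endo_neg[OF t'] by simp }
qed

lemma image_alg_opsub:
  assumes WE: "W \<subseteq> endo G" and cm: "commuting G W" and t: "t \<in> alg G W" and N: "opsub G W N"
  shows "opsub G W (t ` N)"
proof (rule image_opsub[OF abelian_group_axioms N])
  fix w assume w: "w \<in> W"
  show "\<exists>w'\<in>W. \<forall>a\<in>N. w (t a) = t (w' a)"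
    using alg_comm1[OF WE cm w t] opsub_sub[OF N] w by (intro bexI[of _ w]) auto
qed (use alg_closed[OF WE t] endo_add[OF alg_endo[OF WE t]] opsub_carrier[OF N] in auto)

lemma cyclic_opsub:
  assumes WE: "W \<subseteq> endo G" and b: "b \<in> carrier G"
  shows "opsub G W {u b | u. u \<in> alg G W}"
proof (rule opsubI)
  have I: "x \<in> {u b | u. u \<in> alg G W}" if "u \<in> alg G W" "x = u b" for u x using that by blast
  show "{u b | u. u \<in> alg G W} \<subseteq> carrier G" using alg_closed[OF WE _ b] by blast
  show "\<zero> \<in> {u b | u. u \<in> alg G W}" by (rule I[OF alg_zero]) simp
  fix a a' assume "a \<in> {u b | u. u \<in> alg G W}"
  then obtain u where u: "a = u b" "u \<in> alg G W" by blast
  show "\<ominus> a \<in> {u b | u. u \<in> alg G W}" by (rule I[OF alg_neg[OF u(2)]]) (simp add: u)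
  { assume "a' \<in> {u b | u. u \<in> alg G W}"
    then obtain u' where u': "a' = u' b" "u' \<in> alg G W" by blast
    show "a \<oplus> a' \<in> {u b | u. u \<in> alg G W}" by (rule I[OF alg_add[OF u(2) u'(2)]]) (simp add: u u') }
  { fix w assume w: "w \<in> W"
    show "w a \<in> {u b | u. u \<in> alg G W}" by (rule I[OF alg_op[OF w u(2)]]) (simp add: u) }
qed

lemma gen_insert_elem:
  assumes WE: "W \<subseteq> endo G" and b: "b \<in> carrier G" and C: "C \<subseteq> carrier G" and a: "a \<in> gen G W (insert b C)"
  obtains c u where "c \<in> gen G W C" "u \<in> alg G W" "a = c \<oplus> u b"
proof -
  let ?B = "{u b | u. u \<in> alg G W}"
  note s = opsub_gen[OF WE C] cyclic_opsub[OF WE b]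
  have "b \<in> ?B" using alg_one[of G W] by (intro CollectI exI[of _ "\<lambda>a. a"]) simp
  then have "insert b C \<subseteq> gen G W C <+>\<^bsub>G\<^esub> ?B"
    using set_add_incl1[OF s] set_add_incl2[OF s] gen_incl[of C G W] by blast
  then have "a \<in> gen G W C <+>\<^bsub>G\<^esub> ?B" using gen_min[OF opsub_sum[OF WE s]] a by blast
  then show thesis using that by (elim set_addE) blast
qed

text \<open>The determinant trick with the generators eliminated one at a time: \<open>w\<close> is congruent to the
  identity modulo \<open>t\<close> and moves \<open>M\<close> into the span of fewer and fewer generators.\<close>

lemma nakayama_step:
  assumes WE: "W \<subseteq> endo G" and cm: "commuting G W" and M: "opsub G W M" and t: "t \<in> alg G W" and Mt: "M \<subseteq> t ` M"
    and b: "b \<in> M" and C: "C \<subseteq> M"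
    and w: "w \<in> alg G W" and u: "u \<in> alg G W" and wu: "\<And>m. m \<in> M \<Longrightarrow> m = w m \<oplus> t (u m)"
    and wM: "\<And>m. m \<in> M \<Longrightarrow> w m \<in> gen G W (insert b C)"
  shows "\<exists>w\<in>alg G W. \<exists>u\<in>alg G W. (\<forall>m\<in>M. m = w m \<oplus> t (u m)) \<and> w ` M \<subseteq> gen G W C"
proof -
  note c = opsub_carrier[OF M]
  have CC: "C \<subseteq> carrier G" using C c by blast
  note gC = opsub_gen[OF WE CC]
  note cl = alg_closed[OF WE]
  note ad = endo_add[OF alg_endo[OF WE]]
  note co = alg_comm[OF WE cm]
  obtain m' where m': "m' \<in> M" "b = t m'" using Mt b by blast
  obtain c0 u2 where cu: "c0 \<in> gen G W C" "u2 \<in> alg G W" "w m' = c0 \<oplus> u2 b"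
    using gen_insert_elem[OF WE c[OF b] CC wM[OF m'(1)]] by blast
  have c0: "c0 \<in> carrier G" using opsub_carrier[OF gC cu(1)] .
  have wb: "w b = t c0 \<oplus> t (u2 b)"
    using co[OF w t c[OF m'(1)]] m'(2) cu(3) ad[OF t c0 cl[OF cu(2) c[OF b]]] by simp
  \<comment> \<open>Applying w to \<open>b = t m'\<close> gives
    \<open>w b = t c0 + t (u2 b)\<close>, so w - t u2 sends b into the span of \<open>C\<close>;
    composing it with w removes b from the generators needed.\<close>
  define v where "v = (\<lambda>a. w a \<ominus> t (u2 a))"
  have v: "v \<in> alg G W" unfolding v_def by (intro alg_minus w alg_comp[OF t cu(2)])
  have vb: "v b = t c0" unfolding v_def wb a_minus_def
    using cl[OF t c0] cl[OF t cl[OF cu(2) c[OF b]]] by (simp add: a_assoc r_neg)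
  have wv: "w a = v a \<oplus> t (u2 a)" if "a \<in> carrier G" for a
    unfolding v_def a_minus_def using that cl[OF w that] cl[OF t cl[OF cu(2) that]] by (simp add: a_assoc l_neg)
  have 1: "v (w m) \<in> gen G W C" if m: "m \<in> M" for m
  proof -
    obtain c1 u3 where c1: "c1 \<in> gen G W C" "u3 \<in> alg G W" "w m = c1 \<oplus> u3 b"
      using gen_insert_elem[OF WE c[OF b] CC wM[OF m]] by blast
    have "v (w m) = v c1 \<oplus> v (u3 b)"
      using ad[OF v opsub_carrier[OF gC c1(1)] cl[OF c1(2) c[OF b]]] c1(3) by simp
    also have "v (u3 b) = u3 (t c0)" using co[OF v c1(2) c[OF b]] vb by simp
    finally show ?thesis
      using opsub_add[OF gC alg_opsub[OF gC v c1(1)] alg_opsub[OF gC c1(2) alg_opsub[OF gC t cu(1)]]] by simp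
  qed
  have 2: "m = v (w m) \<oplus> t (u2 (w m) \<oplus> (u (w m) \<oplus> u m))" if m: "m \<in> M" for m
  proof -
    have wm: "w m \<in> M" using alg_opsub[OF M w m] .
    have cs: "w m \<in> carrier G" "u m \<in> carrier G" "u (w m) \<in> carrier G" "u2 (w m) \<in> carrier G" "v (w m) \<in> carrier G"
      using cl[OF w] cl[OF u] cl[OF cu(2)] cl[OF v] c[OF m] by auto
    have "m = w m \<oplus> t (u m)" using wu[OF m] .
    also have "w m = w (w m) \<oplus> t (u (w m))" using wu[OF wm] .
    also have "w (w m) = v (w m) \<oplus> t (u2 (w m))" using wv[OF cs(1)] .
    finally show ?thesis using cs cl[OF t] by (simp add: ad[OF t] a_assoc)
  qed
  show ?thesis
    by (rule bexI[OF _ alg_comp[OF v w]], rule bexI[OF _ alg_add[OF alg_comp[OF cu(2) w] alg_add[OF alg_comp[OF u w] u]]])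
      (use 1 2 in auto)
qed

text \<open>Start from w = identity with all generators and eliminate them one by one; with none
  left w vanishes on \<open>M\<close>. Thus a surjective polynomial operator on a finitely generated
  module has a polynomial right inverse.\<close>

lemma nakayama_gen:
  assumes WE: "W \<subseteq> endo G" and cm: "commuting G W" and M: "opsub G W M" and t: "t \<in> alg G W" and Mt: "M \<subseteq> t ` M"
    and "finite A" "A \<subseteq> M" and "M \<subseteq> gen G W A"
  shows "\<exists>u\<in>alg G W. \<forall>m\<in>M. m = t (u m)"
proof -
  have c: "M \<subseteq> carrier G" using opsub_sub[OF M] .
  have red: "\<exists>w\<in>alg G W. \<exists>u\<in>alg G W. (\<forall>m\<in>M. m = w m \<oplus> t (u m)) \<and> w ` M \<subseteq> gen G W {}"
    if "finite A" "A \<subseteq> M" "\<exists>w\<in>alg G W. \<exists>u\<in>alg G W. (\<forall>m\<in>M. m = w m \<oplus> t (u m)) \<and> w ` M \<subseteq> gen G W A" for A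
    using that
  proof (induction A rule: finite_induct)
    case (insert b C)
    from insert.prems(2) obtain w u where wu: "w \<in> alg G W" "u \<in> alg G W" "\<forall>m\<in>M. m = w m \<oplus> t (u m)"
      "w ` M \<subseteq> gen G W (insert b C)" by blast
    have "\<exists>w\<in>alg G W. \<exists>u\<in>alg G W. (\<forall>m\<in>M. m = w m \<oplus> t (u m)) \<and> w ` M \<subseteq> gen G W C"
      by (rule nakayama_step[OF WE cm M t Mt _ _ wu(1,2)]) (use insert.prems wu in blast)+
    then show ?case using insert by blast
  qed blast
  have start: "\<exists>w\<in>alg G W. \<exists>u\<in>alg G W. (\<forall>m\<in>M. m = w m \<oplus> t (u m)) \<and> w ` M \<subseteq> gen G W A"
  proof (rule bexI[OF _ alg_one[of G W]], rule bexI[OF _ alg_zero[of G W]], rule conjI)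
    show "\<forall>m\<in>M. m = m \<oplus> t \<zero>" using endo_zero[OF alg_endo[OF WE t]] c by auto
  qed (use assms in auto)
  obtain w u where wu: "w \<in> alg G W" "u \<in> alg G W" "\<forall>m\<in>M. m = w m \<oplus> t (u m)" "w ` M \<subseteq> gen G W {}"
    using red[OF assms(6,7) start] by blast
  have "gen G W {} \<subseteq> {\<zero>}" using gen_min[OF opsub_bot[OF WE]] by blast
  then have w0: "w m = \<zero>" if "m \<in> M" for m using wu(4) that by blast
  have "m = t (u m)" if "m \<in> M" for m
  proof -
    have "t (u m) \<in> carrier G"
      using alg_closed[OF WE t alg_closed[OF WE wu(2)]] c that by blast
    then show ?thesis using wu(3) that w0[OF that] by (metis l_zero)
  qed
  then show ?thesis using wu(2) by blast
qed

lemma noeth_fg: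
  assumes WE: "W \<subseteq> endo G" and M: "opsub G W M" and n: "noeth G W M"
  obtains A where "finite A" "A \<subseteq> M" "gen G W A = M"
proof -
  let ?C = "{gen G W A | A. finite A \<and> A \<subseteq> M}"
  have s: "opsub G W (gen G W A) \<and> gen G W A \<subseteq> M" if "A \<subseteq> M" for A
    using opsub_gen[OF WE] gen_min[OF M that] that opsub_sub[OF M] by blast
  have sC: "?C \<subseteq> subs G W {\<zero>} M"
    using s opsub_zero unfolding subs_def by blast
  have "gen G W {} \<in> ?C" by blast
  from ACC_maximal[OF n sC this] obtain N where N: "N \<in> ?C" and max: "\<forall>M\<in>?C. N \<subseteq> M \<longrightarrow> M = N"
    .
  from N obtain A where A: "finite A" "A \<subseteq> M" "N = gen G W A" by blast
  have "m \<in> N" if m: "m \<in> M" for m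
  proof -
    have "gen G W A \<subseteq> gen G W (insert m A)"
      by (rule gen_min) (use s[of "insert m A"] A m gen_incl[of "insert m A" G W] in auto)
    moreover have "gen G W (insert m A) \<in> ?C" using A m by blast
    ultimately have "gen G W (insert m A) = N" using max A(3) by simp
    then show ?thesis using gen_incl[of "insert m A" G W] by blast
  qed
  then have "gen G W A = M" using s[OF A(2)] A(3) by blast
  then show thesis using that A by blast
qed

text \<open>The operator t maps \<open>t^k M\<close> onto itself and therefore has a polynomial
  inverse u there. Since u commutes with \<open>t^k\<close>, this reads
  \<open>t^k (1 - t u) = 0\<close> on all of \<open>M\<close>.\<close>

lemma stable_image_inverse:
  assumes WE: "W \<subseteq> endo G" and cm: "commuting G W" and M: "opsub G W M" and n: "noeth G W M" and t: "t \<in> alg G W"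
    and st: "(t ^^ k) ` M \<subseteq> (t ^^ Suc k) ` M"
  shows "\<exists>u\<in>alg G W. \<forall>m\<in>M. (t ^^ k) m = (t ^^ k) (t (u m))"
proof -
  let ?V = "(t ^^ k) ` M"
  note tk = alg_pow[OF t, of k]
  have V: "opsub G W ?V" using image_alg_opsub[OF WE cm tk M] .
  have VM: "?V \<subseteq> M" using alg_opsub[OF M tk] by blast
  have nV: "noeth G W ?V" by (rule ACC_subset[OF n]) (use VM in \<open>auto simp: subs_def\<close>)
  obtain A where A: "finite A" "A \<subseteq> ?V" "gen G W A = ?V" using noeth_fg[OF WE V nV] .
  have "?V \<subseteq> t ` ?V" using st by (auto simp: image_comp comp_def)
  then obtain u where u: "u \<in> alg G W" "\<forall>m\<in>?V. m = t (u m)"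
    using nakayama_gen[OF WE cm V t _ A(1,2)] A(3) by blast
  have "(t ^^ k) m = (t ^^ k) (t (u m))" if m: "m \<in> M" for m
  proof -
    have mc: "m \<in> carrier G" using opsub_carrier[OF M m] .
    have "(t ^^ k) m = t (u ((t ^^ k) m))" using u(2) m by blast
    also have "\<dots> = (t ^^ k) (t (u m))"
      using alg_comm[OF WE cm tk alg_comp[OF t u(1)] mc] by simp
    finally show ?thesis .
  qed
  then show ?thesis using u(1) by blast
qed

end

section \<open>Noetherian and pi-regular modules over commuting operators are Artinian\<close>

context abelian_group begin

text \<open>Let M be the whole group. Otherwise the kernel and the image of t on M/N are both
  nonzero, so by maximality the factors modulo each are Artinian. The factor modulo the kernel is
  isomorphic to the image, and M/N becomes an extension of Artinian modules.\<close>

lemma maximal_nonartin_dichotomy: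
  assumes WE: "W \<subseteq> endo G" and cm: "commuting G W" and N: "opsub G W N"
    and bad: "\<not> DCC (subs G W N (carrier G))"
    and max: "\<And>M. opsub G W M \<Longrightarrow> N \<subset> M \<Longrightarrow> DCC (subs G W M (carrier G))"
    and t: "t \<in> alg G W"
  shows "(\<forall>m\<in>carrier G. t m \<in> N) \<or> (\<forall>m\<in>carrier G. t m \<in> N \<longrightarrow> m \<in> N)"
proof (rule ccontr)
  assume neg: "\<not> ?thesis"
  then obtain m1 m2 where m1: "m1 \<in> carrier G" "t m1 \<notin> N" and m2: "m2 \<in> carrier G" "t m2 \<in> N" "m2 \<notin> N" by blast
  note te = alg_endo[OF WE t]
  note top = opsub_top[OF WE]
  define pre where "pre L = {m \<in> carrier G. t m \<in> L}" for L
  have pre: "opsub G W (pre L)" if L: "opsub G W L" for L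
    unfolding pre_def
  proof (rule preimage_opsub[OF abelian_group_axioms top L])
    fix w assume w: "w \<in> W"
    show "\<exists>w'\<in>W. \<forall>a\<in>carrier G. t (w a) = w' (t a)"
      using alg_comm1[OF WE cm w t] w by (intro bexI[of _ w]) auto
  qed (use endo_closed[OF te] endo_add[OF te] in auto)
  let ?I = "N <+>\<^bsub>G\<^esub> t ` carrier G"
  have tc: "opsub G W (t ` carrier G)" using image_alg_opsub[OF WE cm t top] .
  have I: "opsub G W ?I" using opsub_sum[OF WE N tc] .
  have "N \<subset> pre N"
    using m2 alg_opsub[OF N t] opsub_carrier[OF N] unfolding pre_def by blast
  then have dK: "DCC (subs G W (pre N) (carrier G))" using max[OF pre[OF N]] by blast
  have NI: "N \<subseteq> ?I" using set_add_incl1[OF N tc] .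
  have "t m1 \<in> ?I" using set_add_incl2[OF N tc] m1 by blast
  then have "N \<subset> ?I" using NI m1 by blast
  then have dI: "DCC (subs G W ?I (carrier G))" using max[OF I] by blast
  have "DCC (subs G W N ?I)"
  proof (rule DCC_transfer[OF dK, of _ pre])
    fix L assume "L \<in> subs G W N ?I"
    then show "pre L \<in> subs G W (pre N) (carrier G)"
      using pre unfolding subs_def pre_def by auto
  next
    fix L L' assume L: "L \<in> subs G W N ?I" and L': "L' \<in> subs G W N ?I" and "L \<subseteq> L'" and eq: "pre L' = pre L"
    have s: "opsub G W L" "opsub G W L'" "N \<subseteq> L" "L' \<subseteq> ?I" using L L' unfolding subs_def by auto
    show "L' \<subseteq> L"
    proof (rule modular_cancel[OF s(1,2) tc \<open>L \<subseteq> L'\<close>])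
      show "L' \<inter> t ` carrier G \<subseteq> L" using eq unfolding pre_def by blast
      show "L' \<subseteq> L <+>\<^bsub>G\<^esub> t ` carrier G" using s set_add_mono[of N L "t ` carrier G" "t ` carrier G"] by blast
    qed
  qed (auto simp: pre_def)
  then have "DCC (subs G W N (carrier G))"
    using DCC_subs_trans[OF WE I top NI opsub_sub[OF I] _ dI] by blast
  then show False using bad by blast
qed

text \<open>Otherwise choose \<open>N\<close> maximal with \<open>M/N\<close> not Artinian. Every operator is then zero or injective
  on \<open>M/N\<close>, hence by hypothesis zero or invertible, so that cyclic submodules of \<open>M/N\<close> are simple.\<close>

theorem artin_of_pi_regular:
  assumes WE: "W \<subseteq> endo G" and cm: "commuting G W" and n: "noeth G W (carrier G)"
    and pr: "\<And>t. t \<in> alg G W \<Longrightarrow>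
      \<exists>u\<in>alg G W. \<exists>k l. \<forall>m\<in>carrier G. ((\<lambda>m. (t ^^ k) m \<ominus> (t ^^ k) (t (u m))) ^^ l) m = \<zero>"
  shows "artin G W (carrier G)"
proof (rule ccontr)
  assume nart: "\<not> artin G W (carrier G)"
  note top = opsub_top[OF WE]
  let ?C = "{N. opsub G W N \<and> \<not> DCC (subs G W N (carrier G))}"
  have "?C \<subseteq> subs G W {\<zero>} (carrier G)" using opsub_zero opsub_sub unfolding subs_def by blast
  moreover have "{\<zero>} \<in> ?C" using nart opsub_bot[OF WE] by blast
  ultimately obtain N where "N \<in> ?C" and max0: "\<forall>M\<in>?C. N \<subseteq> M \<longrightarrow> M = N"
    by (rule ACC_maximal[OF n])
  then have N: "opsub G W N" and bad: "\<not> DCC (subs G W N (carrier G))" by auto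
  have max: "DCC (subs G W M (carrier G))" if "opsub G W M" "N \<subset> M" for M using max0 that by blast
  note dich = maximal_nonartin_dichotomy[OF WE cm N bad max]
  note Nc = opsub_sub[OF N]
  have "N \<noteq> carrier G"
  proof
    assume "N = carrier G"
    then have "subs G W N (carrier G) \<subseteq> {N, N}" unfolding subs_def by blast
    then show False using DCC_subset_pair bad by blast
  qed
  then obtain e where e: "e \<in> carrier G" "e \<notin> N" using Nc by blast
  have inj_pow: "m \<in> N"
    if "\<forall>m\<in>carrier G. s m \<in> N \<longrightarrow> m \<in> N" "s \<in> endo G" "m \<in> carrier G" "(s ^^ k) m \<in> N" for s m k
    using that(3,4)
  proof (induction k arbitrary: m)
    case (Suc k)
    then have "s ((s ^^ k) m) \<in> N" by simp
    then have "(s ^^ k) m \<in> N" using that(1) endo_closed[OF endo_pow[OF that(2)] Suc.prems(1)] by blast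
    then show ?case using Suc by blast
  qed simp
  have inverse: "\<exists>u\<in>alg G W. \<forall>m\<in>carrier G. m \<ominus> t (u m) \<in> N"
    if t: "t \<in> alg G W" and inj: "\<forall>m\<in>carrier G. t m \<in> N \<longrightarrow> m \<in> N" for t
  proof -
    obtain u k l where u: "u \<in> alg G W"
      and z: "\<And>m. m \<in> carrier G \<Longrightarrow> ((\<lambda>m. (t ^^ k) m \<ominus> (t ^^ k) (t (u m))) ^^ l) m = \<zero>"
      using pr[OF t] by blast
    define s where "s = (\<lambda>m. (t ^^ k) m \<ominus> (t ^^ k) (t (u m)))"
    note tk = alg_pow[OF t, of k]
    have s: "s \<in> alg G W" unfolding s_def by (rule alg_minus[OF tk alg_comp[OF tk alg_comp[OF t u]]])
    have sz: "(s ^^ l) m = \<zero>" if "m \<in> carrier G" for m using z[OF that] unfolding s_def .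
    \<comment> \<open>s = \<open>t^k (1 - t u)\<close> is nilpotent, so it cannot be injective on
      the nonzero module M/N. By the dichotomy it is zero there, and cancelling the injective
      \<open>t^k\<close> makes u an inverse of t modulo \<open>N\<close>.\<close>
    have "\<not> (\<forall>m\<in>carrier G. s m \<in> N \<longrightarrow> m \<in> N)"
    proof
      assume "\<forall>m\<in>carrier G. s m \<in> N \<longrightarrow> m \<in> N"
      then have "e \<in> N" using inj_pow[OF _ alg_endo[OF WE s] e(1), of l] sz[OF e(1)] opsub_zero[OF N] by simp
      then show False using e by blast
    qed
    then have sN: "s m \<in> N" if "m \<in> carrier G" for m using dich[OF _ _ s] that by blast
    have "m \<ominus> t (u m) \<in> N" if m: "m \<in> carrier G" for m
    proof (rule inj_pow[OF inj alg_endo[OF WE t]])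
      have c: "t (u m) \<in> carrier G" using alg_closed[OF WE t alg_closed[OF WE u m]] .
      show "m \<ominus> t (u m) \<in> carrier G" using m c by simp
      show "(t ^^ k) (m \<ominus> t (u m)) \<in> N"
        using sN[OF m] endo_minus[OF alg_endo[OF WE tk] m c] unfolding s_def by simp
    qed
    then show ?thesis using u by blast
  qed
  let ?B = "{u e | u. u \<in> alg G W}"
  note B = cyclic_opsub[OF WE e(1)]
  let ?L = "N <+>\<^bsub>G\<^esub> ?B"
  have L: "opsub G W ?L" using opsub_sum[OF WE N B] .
  have NL: "N \<subseteq> ?L" using set_add_incl1[OF N B] .
  have "e \<in> ?B" using alg_one[of G W] by (intro CollectI exI[of _ "\<lambda>a. a"]) simp
  then have "e \<in> ?L" using set_add_incl2[OF N B] by blast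
  then have "N \<subset> ?L" using NL e by blast
  then have dL: "DCC (subs G W ?L (carrier G))" using max[OF L] by blast
  \<comment> \<open>An element of K outside \<open>N\<close> yields some u e outside
    \<open>N\<close>; then u is invertible modulo \<open>N\<close>, so e lies in K and K is
    everything. Thus L/N is simple, and as M/L is Artinian by maximality, so is M/N.\<close>
  have "subs G W N ?L \<subseteq> {N, ?L}"
  proof
    fix K assume "K \<in> subs G W N ?L"
    then have K: "opsub G W K" "N \<subseteq> K" "K \<subseteq> ?L" unfolding subs_def by auto
    show "K \<in> {N, ?L}"
    proof (cases "K = N")
      case False
      then obtain x where x: "x \<in> K" "x \<notin> N" using K by blast
      then obtain n u where nu: "n \<in> N" "u \<in> alg G W" "x = n \<oplus> u e" using K(3) by (auto elim!: set_addE)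
      have c: "n \<in> carrier G" "u e \<in> carrier G" using Nc nu(1) alg_closed[OF WE nu(2) e(1)] by auto
      have "u e = x \<ominus> n" using c nu(3) by (simp add: add_minus_cancel)
      then have ueK: "u e \<in> K" using opsub_minus[OF K(1) x(1)] nu(1) K(2) by auto
      have "u e \<notin> N" using x nu opsub_add[OF N nu(1)] by auto
      then have "\<forall>m\<in>carrier G. u m \<in> N \<longrightarrow> m \<in> N" using dich[OF _ _ nu(2)] e(1) by blast
      then obtain u' where u': "u' \<in> alg G W" "\<forall>m\<in>carrier G. m \<ominus> u (u' m) \<in> N" using inverse[OF nu(2)] by blast
      have uu: "u (u' e) = u' (u e)" using alg_comm[OF WE cm nu(2) u'(1) e(1)] .
      have "u' (u e) \<in> K" using alg_opsub[OF K(1) u'(1) ueK] .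
      moreover have "e \<ominus> u' (u e) \<in> K" using u'(2) e(1) uu K(2) by auto
      moreover have "e = (e \<ominus> u' (u e)) \<oplus> u' (u e)"
        using e(1) alg_closed[OF WE u'(1) c(2)] by (simp add: a_minus_def a_assoc l_neg)
      ultimately have "e \<in> K" using opsub_add[OF K(1)] by metis
      then have "?B \<subseteq> K" using alg_opsub[OF K(1)] by blast
      then have "?L \<subseteq> K" using set_add_least[OF K(1,2)] by blast
      then show ?thesis using K(3) by blast
    qed simp
  qed
  then have "DCC (subs G W N ?L)" by (rule DCC_subset_pair)
  then have "DCC (subs G W N (carrier G))"
    using DCC_subs_trans[OF WE L top NL opsub_sub[OF L] _ dL] by blast
  then show False using bad by blast
qed

end

section \<open>An Artin-Rees property\<close>

text \<open>Only the additive structure is used; the multiplicative fields are dummies.\<close>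

definition fungrp :: "('m, 'b) ring_scheme \<Rightarrow> ('i \<Rightarrow> 'm) ring" where
  "fungrp G = \<lparr>partial_object.carrier = {f. \<forall>i. f i \<in> carrier G}, monoid.mult = (\<lambda>f g. f), monoid.one = (\<lambda>i. \<zero>\<^bsub>G\<^esub>),
     ring.zero = (\<lambda>i. \<zero>\<^bsub>G\<^esub>), ring.add = (\<lambda>f g i. f i \<oplus>\<^bsub>G\<^esub> g i)\<rparr>"

lemma fungrp_simps [simp]:
  "carrier (fungrp G) = {f. \<forall>i. f i \<in> carrier G}"
  "\<zero>\<^bsub>fungrp G\<^esub> = (\<lambda>i. \<zero>\<^bsub>G\<^esub>)"
  "f \<oplus>\<^bsub>fungrp G\<^esub> g = (\<lambda>i. f i \<oplus>\<^bsub>G\<^esub> g i)"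
  unfolding fungrp_def by simp_all

lemma abelian_group_fungrp:
  assumes "abelian_group G" shows "abelian_group (fungrp G)"
proof -
  interpret abelian_group G by fact
  show ?thesis
  proof (rule abelian_groupI)
    fix f :: "'i \<Rightarrow> 'a" assume "f \<in> carrier (fungrp G)"
    then show "\<exists>g\<in>carrier (fungrp G). g \<oplus>\<^bsub>fungrp G\<^esub> f = \<zero>\<^bsub>fungrp G\<^esub>"
      by (intro bexI[of _ "\<lambda>i. \<ominus>\<^bsub>G\<^esub> f i"]) (auto simp: l_neg)
  qed (auto simp: a_ac)
qed

lemma fungrp_neg:
  assumes "abelian_group G" "f \<in> carrier (fungrp G)"
  shows "\<ominus>\<^bsub>fungrp G\<^esub> f = (\<lambda>i. \<ominus>\<^bsub>G\<^esub> f i)"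
proof -
  interpret abelian_group G by fact
  interpret F: abelian_group "fungrp G" by (rule abelian_group_fungrp) fact
  show ?thesis
    by (rule F.minus_equality) (use assms(2) in \<open>auto simp: l_neg\<close>)
qed

definition pointwise :: "('m \<Rightarrow> 'm) \<Rightarrow> ('i \<Rightarrow> 'm) \<Rightarrow> 'i \<Rightarrow> 'm" where
  "pointwise w f = (\<lambda>i. w (f i))"

definition shiftop :: "('m, 'b) ring_scheme \<Rightarrow> ('m \<Rightarrow> 'm) \<Rightarrow> (nat \<Rightarrow> 'm) \<Rightarrow> nat \<Rightarrow> 'm" where
  "shiftop G w f = (\<lambda>i. case i of 0 \<Rightarrow> \<zero>\<^bsub>G\<^esub> | Suc j \<Rightarrow> w (f j))"

definition single :: "('m, 'b) ring_scheme \<Rightarrow> nat \<Rightarrow> 'm \<Rightarrow> nat \<Rightarrow> 'm" where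
  "single G k e = (\<lambda>i. if i = k then e else \<zero>\<^bsub>G\<^esub>)"

lemma pointwise_endo: "w \<in> endo G \<Longrightarrow> pointwise w \<in> endo (fungrp G)"
  unfolding endo_def pointwise_def by auto

lemma (in abelian_group) shiftop_endo: "w \<in> endo G \<Longrightarrow> shiftop G w \<in> endo (fungrp G)"
  unfolding endo_def shiftop_def by (auto split: nat.split simp: fun_eq_iff)

text \<open>The Rees module is realised inside the sequences with values in \<open>G\<close>: an operator \<open>p\<close> in \<open>\<Delta>'\<close>
  acts as multiplication by \<open>p\<close> times the grading variable, which is \<open>shiftop G p\<close>. The finite set
  \<open>\<Delta>\<close> generates the possibly infinite, but \<open>\<theta>\<close>-invariant, set \<open>\<Delta>'\<close>.\<close>

locale artin_rees = abelian_group G for G :: "('m, 'b) ring_scheme" (structure) +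
  fixes W :: "('m \<Rightarrow> 'm) set" and \<Delta> \<Delta>' :: "('m \<Rightarrow> 'm) set" and \<theta> :: "'m \<Rightarrow> 'm" and M V :: "'m set"
  assumes WE: "W \<subseteq> endo G" and PE': "\<Delta>' \<subseteq> endo G" and th: "\<theta> \<in> endo G"
    and fin: "finite \<Delta>" and PP': "\<Delta> \<subseteq> \<Delta>'"
    and PW: "\<And>p w a. p \<in> \<Delta> \<Longrightarrow> w \<in> W \<Longrightarrow> a \<in> carrier G \<Longrightarrow> p (w a) = w (p a)"
    and PP: "\<And>p q a. p \<in> \<Delta> \<Longrightarrow> q \<in> \<Delta> \<Longrightarrow> a \<in> carrier G \<Longrightarrow> p (q a) = q (p a)"
    and span: "\<And>N p f. opsub (fungrp G) (pointwise ` W \<union> shiftop G ` \<Delta>) N \<Longrightarrow> p \<in> \<Delta>' \<Longrightarrow> f \<in> N \<Longrightarrow> shiftop G p f \<in> N"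
    and nW: "\<And>w. w \<in> W \<Longrightarrow> \<exists>w'\<in>W. \<forall>a\<in>carrier G. \<theta> (w a) = w' (\<theta> a)"
    and nW': "\<And>w. w \<in> W \<Longrightarrow> \<exists>w'\<in>W. \<forall>a\<in>carrier G. w (\<theta> a) = \<theta> (w' a)"
    and nP: "\<And>p. p \<in> \<Delta>' \<Longrightarrow> \<exists>p'\<in>\<Delta>'. \<forall>a\<in>carrier G. \<theta> (p a) = p' (\<theta> a)"
    and nP': "\<And>p. p \<in> \<Delta>' \<Longrightarrow> \<exists>p'\<in>\<Delta>'. \<forall>a\<in>carrier G. p (\<theta> a) = \<theta> (p' a)"
    and M: "opsub G W M" and nM: "noeth G W M" and gM: "gen G (insert \<theta> W) M = carrier G"
    and V: "opsub G (insert \<theta> W) V" and VP: "\<And>p v. p \<in> \<Delta>' \<Longrightarrow> v \<in> V \<Longrightarrow> p v = \<zero>"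
    and ess: "\<And>K. opsub G (insert \<theta> W) K \<Longrightarrow> K \<noteq> {\<zero>} \<Longrightarrow> \<exists>v\<in>V \<inter> K. v \<noteq> \<zero>"
begin

abbreviation F where "F \<equiv> fungrp G :: (nat \<Rightarrow> 'm) ring"
abbreviation LW where "LW \<equiv> (pointwise ` W :: ((nat \<Rightarrow> 'm) \<Rightarrow> nat \<Rightarrow> 'm) set)"
text \<open>\<open>Y\<close> is the Rees module, the sum of the \<open>E P^k\<close> in degree k
  when the operators come from an ideal P: its generators sit in degree zero and every operator from
  \<open>\<Delta>'\<close> raises the degree by one.\<close>

abbreviation Y where "Y \<equiv> gen F (insert (pointwise \<theta>) (LW \<union> shiftop G ` \<Delta>')) (single G 0 ` M)"

lemma FG: "abelian_group F" by (rule abelian_group_fungrp) (rule abelian_group_axioms)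

lemma OE: "LW \<union> shiftop G ` \<Delta>' \<subseteq> endo F"
  using WE PE' pointwise_endo shiftop_endo by blast

lemma OE0: "P0 \<subseteq> \<Delta>' \<Longrightarrow> LW \<union> shiftop G ` P0 \<subseteq> endo F"
  using OE by blast

lemma single_carrier: "e \<in> carrier G \<Longrightarrow> single G k e \<in> carrier F"
  by (simp add: single_def)

lemma single_add: "a \<in> carrier G \<Longrightarrow> b \<in> carrier G \<Longrightarrow> single G k (a \<oplus> b) = single G k a \<oplus>\<^bsub>F\<^esub> single G k b"
  by (auto simp: single_def fun_eq_iff)

lemma pointwise_single: "w \<in> endo G \<Longrightarrow> pointwise w (single G k a) = single G k (w a)"
  by (auto simp: single_def pointwise_def fun_eq_iff endo_zero)

lemma shiftop_single: "w \<in> endo G \<Longrightarrow> shiftop G w (single G k a) = single G (Suc k) (w a)"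
  by (auto simp: single_def shiftop_def fun_eq_iff endo_zero split: nat.split)

lemma singleM: "opsub F LW (single G 0 ` M)"
proof (rule image_opsub[OF FG M])
  fix w' assume "w' \<in> LW"
  then obtain w where w: "w \<in> W" "w' = pointwise w" by blast
  show "\<exists>w\<in>W. \<forall>a\<in>M. w' (single G 0 a) = single G 0 (w a)"
    by (rule bexI[OF _ w(1)]) (use w WE in \<open>auto simp: pointwise_single\<close>)
qed (use single_carrier single_add opsub_carrier[OF M] in blast)+

lemma noeth_singleM: "noeth F LW (single G 0 ` M)"
proof (rule ACC_transfer[OF nM, of _ "\<lambda>N. (\<lambda>f. f 0) ` N"])
  fix N assume "N \<in> subs F LW {\<zero>\<^bsub>F\<^esub>} (single G 0 ` M)"
  then have N: "opsub F LW N" "N \<subseteq> single G 0 ` M" unfolding subs_def by auto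
  have "opsub G W ((\<lambda>f. f 0) ` N)"
  proof (rule abelian_group.image_opsub[OF FG abelian_group_axioms N(1)])
    fix w assume w: "w \<in> W"
    show "\<exists>w'\<in>LW. \<forall>f\<in>N. w (f 0) = w' f 0"
      by (rule bexI[of _ "pointwise w"]) (use w in \<open>auto simp: pointwise_def\<close>)
  qed (use opsub_carrier[OF N(1)] in auto)
  moreover have "(\<lambda>f. f 0) ` N \<subseteq> M" using N(2) by (auto simp: single_def)
  ultimately show "(\<lambda>f. f 0) ` N \<in> subs G W {\<zero>} M" using opsub_zero unfolding subs_def by blast
next
  fix N N' assume N: "N \<in> subs F LW {\<zero>\<^bsub>F\<^esub>} (single G 0 ` M)" and N': "N' \<in> subs F LW {\<zero>\<^bsub>F\<^esub>} (single G 0 ` M)"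
    and eq: "(\<lambda>f. f 0) ` N' = (\<lambda>f. f 0) ` N"
  show "N' \<subseteq> N"
  proof
    fix f assume f: "f \<in> N'"
    then have "f 0 \<in> (\<lambda>f. f 0) ` N'" by blast
    then obtain g where g: "g \<in> N" "f 0 = g 0" unfolding eq by blast
    obtain a b where ab: "f = single G 0 a" "g = single G 0 b" using f g(1) N N' unfolding subs_def by blast
    then have "a = b" using g(2) by (simp add: single_def)
    then show "f \<in> N" using g(1) ab by simp
  qed
qed auto

text \<open>Adjoin the finitely many degree-raising operators one at a time. Each commutes with the
  operators already present, so the basis theorem applies as it does for an ordinary polynomial
  ring.\<close>

lemma noeth_rees0:
  assumes "finite P0" "P0 \<subseteq> \<Delta>"
  shows "noeth F (LW \<union> shiftop G ` P0) (gen F (LW \<union> shiftop G ` P0) (single G 0 ` M))"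
  using assms
proof (induction P0 rule: finite_induct)
  case empty
  have "gen F LW (single G 0 ` M) \<subseteq> single G 0 ` M" by (rule gen_min[OF singleM]) simp
  then show ?case using ACC_subset[OF noeth_singleM subs_mono[OF subset_refl]] by simp
next
  case (insert p P0)
  let ?W = "LW \<union> shiftop G ` P0"
  let ?X = "gen F ?W (single G 0 ` M)"
  have P0: "P0 \<subseteq> \<Delta>'" and p: "p \<in> \<Delta>" "p \<in> \<Delta>'" using insert.prems PP' by auto
  have cM: "single G 0 ` M \<subseteq> carrier F" using opsub_sub[OF singleM] .
  have W': "LW \<union> shiftop G ` insert p P0 = insert (shiftop G p) ?W" by blast
  have pe: "p \<in> endo G" using p PE' by blast
  have comm: "shiftop G p (w f) = w (shiftop G p f)" if w: "w \<in> ?W" and f: "f \<in> carrier F" for w f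
  proof (cases "w \<in> LW")
    case True
    then obtain w0 where w0: "w0 \<in> W" "w = pointwise w0" by blast
    then have "w0 \<zero> = \<zero>" using WE endo_zero by blast
    then show ?thesis using w0 f PW[OF p(1) w0(1)]
      by (auto simp: shiftop_def pointwise_def fun_eq_iff split: nat.split)
  next
    case False
    then obtain q where q: "q \<in> P0" "w = shiftop G q" using w by blast
    then have "q \<in> endo G" "q \<in> \<Delta>" using insert.prems PP' PE' by auto
    then show ?thesis using q f PP[OF p(1)] endo_zero[OF pe] endo_zero[of q]
      by (auto simp: shiftop_def fun_eq_iff split: nat.split)
  qed
  have "noeth F (insert (shiftop G p) ?W) (gen F (insert (shiftop G p) ?W) ?X)"
  proof (rule noeth_gen_insert[OF FG OE0[OF P0]])
    show "shiftop G p \<in> endo F" using shiftop_endo[OF pe] .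
    show "opsub F ?W ?X" by (rule abelian_group.opsub_gen[OF FG OE0[OF P0] cM])
    show "noeth F ?W ?X" using insert by blast
    show "\<exists>w'\<in>?W. \<forall>a\<in>carrier F. shiftop G p (w a) = w' (shiftop G p a)" if "w \<in> ?W" for w
      by (rule bexI[OF _ that]) (use comm[OF that] in blast)
    show "\<exists>w'\<in>?W. \<forall>a\<in>carrier F. w (shiftop G p a) = shiftop G p (w' a)" if "w \<in> ?W" for w
      by (rule bexI[OF _ that]) (use comm[OF that] in metis)
  qed
  moreover have "gen F (insert (shiftop G p) ?W) (single G 0 ` M) \<subseteq> gen F (insert (shiftop G p) ?W) ?X"
    using gen_incl[of "single G 0 ` M" F ?W] unfolding gen_def[of F "insert (shiftop G p) ?W"] by blast
  ultimately show ?case unfolding W' by (rule ACC_subset[OF _ subs_mono[OF subset_refl]])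
qed

text \<open>\<theta> is only known to normalise the larger set \<open>\<Delta>'\<close>, not the
  finite \<open>\<Delta>\<close>. Before \<theta> is adjoined, \<open>span\<close> shows that the
  module already built is stable under all of \<open>\<Delta>'\<close>, and enlarging the operator
  set preserves the ascending chain condition.\<close>

lemma noeth_rees: "noeth F (insert (pointwise \<theta>) (LW \<union> shiftop G ` \<Delta>')) Y"
proof -
  let ?Wa = "LW \<union> shiftop G ` \<Delta>" and ?W = "LW \<union> shiftop G ` \<Delta>'"
  let ?X = "gen F ?Wa (single G 0 ` M)"
  have cM: "single G 0 ` M \<subseteq> carrier F" using opsub_sub[OF singleM] .
  have X0: "opsub F ?Wa ?X" by (rule abelian_group.opsub_gen[OF FG OE0[OF PP'] cM])
  have X: "opsub F ?W ?X" using X0 span[OF X0] unfolding opsub_def by blast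
  have nX: "noeth F ?W ?X"
    by (rule ACC_subset[OF noeth_rees0[OF fin subset_refl]]) (rule subs_antimono_ops, use PP' in blast)
  have "noeth F (insert (pointwise \<theta>) ?W) (gen F (insert (pointwise \<theta>) ?W) ?X)"
  proof (rule noeth_gen_insert[OF FG OE _ _ _ X nX])
    show "pointwise \<theta> \<in> endo F" using pointwise_endo[OF th] .
    fix w assume "w \<in> ?W"
    then consider w0 where "w0 \<in> W" "w = pointwise w0" | p where "p \<in> \<Delta>'" "w = shiftop G p" by blast
    then have "(\<exists>w'\<in>?W. \<forall>a\<in>carrier F. pointwise \<theta> (w a) = w' (pointwise \<theta> a)) \<and>
      (\<exists>w'\<in>?W. \<forall>a\<in>carrier F. w (pointwise \<theta> a) = pointwise \<theta> (w' a))"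
    proof cases
      case 1
      obtain w1 where w1: "w1 \<in> W" "\<forall>a\<in>carrier G. \<theta> (w0 a) = w1 (\<theta> a)" using nW[OF 1(1)] by blast
      obtain w2 where w2: "w2 \<in> W" "\<forall>a\<in>carrier G. w0 (\<theta> a) = \<theta> (w2 a)" using nW'[OF 1(1)] by blast
      show ?thesis
        by (rule conjI, rule bexI[of _ "pointwise w1"], use w1 1 in \<open>auto simp: pointwise_def\<close>)
          (rule bexI[of _ "pointwise w2"], use w2 1 in \<open>auto simp: pointwise_def\<close>)
    next
      case 2
      obtain w1 where w1: "w1 \<in> \<Delta>'" "\<forall>a\<in>carrier G. \<theta> (p a) = w1 (\<theta> a)" using nP[OF 2(1)] by blast
      obtain w2 where w2: "w2 \<in> \<Delta>'" "\<forall>a\<in>carrier G. p (\<theta> a) = \<theta> (w2 a)" using nP'[OF 2(1)] by blast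
      show ?thesis
        by (rule conjI, rule bexI[of _ "shiftop G w1"],
            use w1 2 endo_zero[OF th] in \<open>auto simp: shiftop_def pointwise_def fun_eq_iff split: nat.split\<close>)
          (rule bexI[of _ "shiftop G w2"],
            use w2 2 endo_zero[OF th] in \<open>auto simp: shiftop_def pointwise_def fun_eq_iff split: nat.split\<close>)
    qed
    then show "\<exists>w'\<in>?W. \<forall>a\<in>carrier F. pointwise \<theta> (w a) = w' (pointwise \<theta> a)"
      "\<exists>w'\<in>?W. \<forall>a\<in>carrier F. w (pointwise \<theta> a) = pointwise \<theta> (w' a)" by auto
  qed
  moreover have "Y \<subseteq> gen F (insert (pointwise \<theta>) ?W) ?X"
    using gen_incl[of "single G 0 ` M" F ?Wa] unfolding gen_def[of F "insert (pointwise \<theta>) ?W"] by blast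
  ultimately show ?thesis by (rule ACC_subset[OF _ subs_mono[OF subset_refl]])
qed

lemma Y: "opsub F (insert (pointwise \<theta>) (LW \<union> shiftop G ` \<Delta>')) Y"
  by (rule abelian_group.opsub_gen[OF FG]) (use OE pointwise_endo[OF th] opsub_sub[OF singleM] in auto)

text \<open>The component of degree k. It contains the images of all k-fold products from
  \<open>\<Delta>'\<close> and is stable under \<open>insert \<theta> W\<close>, so that
  \<open>ess\<close> can be applied to it.\<close>

definition Z where "Z k = {e \<in> carrier G. single G k e \<in> Y}"

lemma Z: "opsub G (insert \<theta> W) (Z k)"
  unfolding Z_def
proof (rule preimage_opsub[OF FG opsub_top opsub_antimono[OF Y]])
  show "insert \<theta> W \<subseteq> endo G" using WE th by blast
  show "insert (pointwise \<theta>) LW \<subseteq> insert (pointwise \<theta>) (LW \<union> shiftop G ` \<Delta>')" by blast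
  fix w assume w: "w \<in> insert \<theta> W"
  then have "w \<in> endo G" using WE th by blast
  then show "\<exists>w'\<in>insert (pointwise \<theta>) LW. \<forall>a\<in>carrier G. single G k (w a) = w' (single G k a)"
    by (intro bexI[of _ "pointwise w"]) (use w in \<open>auto simp: pointwise_single\<close>)
qed (use single_carrier single_add in blast)+

lemma Z_0: "Z 0 = carrier G"
proof -
  have "M \<subseteq> Z 0" using opsub_carrier[OF M] gen_incl[of "single G 0 ` M"] unfolding Z_def by blast
  then have "carrier G \<subseteq> Z 0" using gen_min[OF Z, of M 0] gM by simp
  then show ?thesis unfolding Z_def by blast
qed

lemma Z_Suc: "e \<in> Z k \<Longrightarrow> p \<in> \<Delta>' \<Longrightarrow> p e \<in> Z (Suc k)"
  using opsub_op[OF Y, of "shiftop G p" "single G k e"] shiftop_single[of p k e] endo_closed[of p G e] PE'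
  unfolding Z_def by auto

text \<open>Bounding the degree does not in general give a set stable under degree-raising
  operators. With entries in \<open>V\<close> it does, because \<open>VP\<close> makes these
  operators vanish there; so the length of a Rees element yields an ascending chain of
  submodules.\<close>

definition chain where "chain k = {f \<in> Y. (\<forall>i. f i \<in> V) \<and> (\<forall>i\<ge>k. f i = \<zero>)}"

lemma chain: "opsub F (insert (pointwise \<theta>) (LW \<union> shiftop G ` \<Delta>')) (chain k)"
proof (rule abelian_group.opsubI[OF FG])
  show "chain k \<subseteq> carrier F" using opsub_sub[OF Y] unfolding chain_def by blast
  show "\<zero>\<^bsub>F\<^esub> \<in> chain k" using opsub_zero[OF Y] opsub_zero[OF V] unfolding chain_def by simp
  fix f g assume f: "f \<in> chain k"
  then have fY: "f \<in> Y" and fV: "\<And>i. f i \<in> V" and f0: "\<And>i. i \<ge> k \<Longrightarrow> f i = \<zero>" unfolding chain_def by auto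
  have fc: "f \<in> carrier F" using opsub_carrier[OF Y fY] .
  have "\<ominus>\<^bsub>F\<^esub> f \<in> Y" using abelian_group.opsub_neg[OF FG Y fY] .
  then show "\<ominus>\<^bsub>F\<^esub> f \<in> chain k" using opsub_neg[OF V fV] f0
    unfolding chain_def fungrp_neg[OF abelian_group_axioms fc] by simp
  { assume "g \<in> chain k"
    then show "f \<oplus>\<^bsub>F\<^esub> g \<in> chain k" using f opsub_add[OF Y, of f g] opsub_add[OF V] unfolding chain_def by simp }
  { fix w assume w: "w \<in> insert (pointwise \<theta>) (LW \<union> shiftop G ` \<Delta>')"
    have wY: "w f \<in> Y" using opsub_op[OF Y w fY] .
    show "w f \<in> chain k"
    proof (cases "w \<in> pointwise ` insert \<theta> W")
      case True
      then obtain w0 where w0: "w0 \<in> insert \<theta> W" "w = pointwise w0" by blast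
      then have "w0 \<in> endo G" using WE th by blast
      then show ?thesis using wY w0 opsub_op[OF V w0(1) fV] f0 endo_zero unfolding chain_def by (simp add: pointwise_def)
    next
      case False
      then obtain p where p: "p \<in> \<Delta>'" "w = shiftop G p" using w by blast
      have "w f = (\<lambda>i. \<zero>)" using p VP[OF p(1) fV] by (auto simp: shiftop_def fun_eq_iff split: nat.split)
      then show ?thesis using wY opsub_zero[OF V] unfolding chain_def by simp
    qed }
qed

theorem products_vanish:
  "\<exists>k. \<forall>ps. length ps = k \<longrightarrow> set ps \<subseteq> \<Delta>' \<longrightarrow> (\<forall>e\<in>carrier G. foldr (\<lambda>p. p) ps e = \<zero>)"
proof -
  obtain k where k: "\<And>i. i \<ge> k \<Longrightarrow> chain i = chain k"
  proof (rule ACC_D[OF noeth_rees, of chain])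
    show "chain i \<in> subs F (insert (pointwise \<theta>) (LW \<union> shiftop G ` \<Delta>')) {\<zero>\<^bsub>F\<^esub>} Y" for i
      using chain[of i] opsub_zero[OF chain[of i]] unfolding subs_def by (simp add: chain_def)
    show "chain i \<subseteq> chain (Suc i)" for i unfolding chain_def by auto
  qed blast
  \<comment> \<open>A nonzero component in degree k would meet \<open>V\<close>, and a nonzero
    element of \<open>V\<close> placed in degree k separates the chain at k from the chain at k +
    1.\<close>
  have "Z k = {\<zero>}"
  proof (rule ccontr)
    assume "Z k \<noteq> {\<zero>}"
    then obtain v where v: "v \<in> V" "v \<in> Z k" "v \<noteq> \<zero>" using ess[OF Z] by blast
    then have "single G k v \<in> chain (Suc k)"
      using opsub_zero[OF V] unfolding chain_def Z_def by (auto simp: single_def)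
    then have "single G k v \<in> chain k" using k[of "Suc k"] by simp
    then show False using v unfolding chain_def single_def by auto
  qed
  moreover have "foldr (\<lambda>p. p) ps e \<in> Z (length ps)" if "set ps \<subseteq> \<Delta>'" "e \<in> carrier G" for ps e
    using that by (induction ps) (auto simp: Z_0 Z_Suc)
  ultimately show ?thesis by (intro exI[of _ k]) fastforce
qed

end

section \<open>Modules with a semilinear operator\<close>

text \<open>Right modules over a skew polynomial ring, given by the action of the coefficients and the
  operator \<open>\<theta>\<close>; \<open>\<beta>\<close> is the inverse of \<open>\<alpha>\<close>.\<close>

locale skew_module = R: cring R + noetherian_ring R + E: abelian_group E
  for R :: "('a, 'r) ring_scheme" and E :: "('e, 's) ring_scheme" +
  fixes act :: "'e \<Rightarrow> 'a \<Rightarrow> 'e" and \<theta> :: "'e \<Rightarrow> 'e" and \<alpha> \<beta> :: "'a \<Rightarrow> 'a"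
  assumes act_closed: "e \<in> carrier E \<Longrightarrow> r \<in> carrier R \<Longrightarrow> act e r \<in> carrier E"
    and act_add: "e \<in> carrier E \<Longrightarrow> e' \<in> carrier E \<Longrightarrow> r \<in> carrier R \<Longrightarrow>
      act (e \<oplus>\<^bsub>E\<^esub> e') r = act e r \<oplus>\<^bsub>E\<^esub> act e' r"
    and act_radd: "e \<in> carrier E \<Longrightarrow> r \<in> carrier R \<Longrightarrow> s \<in> carrier R \<Longrightarrow>
      act e (r \<oplus>\<^bsub>R\<^esub> s) = act e r \<oplus>\<^bsub>E\<^esub> act e s"
    and act_mult: "e \<in> carrier E \<Longrightarrow> r \<in> carrier R \<Longrightarrow> s \<in> carrier R \<Longrightarrow>
      act e (r \<otimes>\<^bsub>R\<^esub> s) = act (act e r) s"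
    and act_one: "e \<in> carrier E \<Longrightarrow> act e \<one>\<^bsub>R\<^esub> = e"
    and theta: "\<theta> \<in> endo E"
    and alpha: "\<alpha> \<in> ring_hom R R" and beta: "\<beta> \<in> ring_hom R R"
    and ab: "r \<in> carrier R \<Longrightarrow> \<alpha> (\<beta> r) = r" and ba: "r \<in> carrier R \<Longrightarrow> \<beta> (\<alpha> r) = r"
    and act_theta: "e \<in> carrier E \<Longrightarrow> r \<in> carrier R \<Longrightarrow> act (\<theta> e) r = \<theta> (act e (\<alpha> r))"

text \<open>Reduces many claims about an ideal to its generators: the elements with the wanted
  property form the preimage of a stable subgroup under a map compatible with multiplication, hence
  an ideal.\<close>

lemma (in ring) vimage_ideal:
  fixes H :: "('h, 's) ring_scheme"
  assumes "cring R" "abelian_group H" "opsub H W N"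
    and J: "ideal J R"
    and hc: "\<And>a. a \<in> J \<Longrightarrow> h a \<in> carrier H"
    and ha: "\<And>a b. a \<in> J \<Longrightarrow> b \<in> J \<Longrightarrow> h (a \<oplus> b) = h a \<oplus>\<^bsub>H\<^esub> h b"
    and hw: "\<And>r. r \<in> carrier R \<Longrightarrow> \<exists>w\<in>W. \<forall>a\<in>J. h (a \<otimes> r) = w (h a)"
  shows "ideal {a \<in> J. h a \<in> N} R"
proof -
  interpret R: cring R by fact
  interpret H: abelian_group H by fact
  interpret J: ideal J R by fact
  have J1: "opsub R {} J" using J.a_subset by (intro opsubI) auto
  have s: "opsub R {} {a \<in> J. h a \<in> N}"
    by (rule preimage_opsub[OF assms(2) J1 assms(3)]) (use hc ha in auto)
  have m: "a \<otimes> r \<in> {a \<in> J. h a \<in> N}" if "a \<in> {a \<in> J. h a \<in> N}" "r \<in> carrier R" for a r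
    using hw[OF that(2)] that opsub_op[OF assms(3)] J.I_r_closed by fastforce
  show ?thesis
  proof (rule idealI)
    show "subgroup {a \<in> J. h a \<in> N} (add_monoid R)"
    proof (rule add.subgroupI)
      show "{a \<in> J. h a \<in> N} \<noteq> {}" using opsub_zero[OF s] by blast
    qed (use opsub_sub[OF s] opsub_neg[OF s] opsub_add[OF s] in \<open>auto simp: a_inv_def[symmetric]\<close>)
    show "a \<otimes> x \<in> {a \<in> J. h a \<in> N}" if "a \<in> {a \<in> J. h a \<in> N}" "x \<in> carrier R" for a x using m that .
    show "x \<otimes> a \<in> {a \<in> J. h a \<in> N}" if "a \<in> {a \<in> J. h a \<in> N}" "x \<in> carrier R" for a x
      using m[OF that] R.m_comm[of x a] that opsub_carrier[OF s that(1)] by simp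
  qed (rule ring_axioms)
qed

lemma (in noetherian_ring) ACC_ideals: "ACC {I. ideal I R}"
  unfolding ACC_def
proof (intro allI impI)
  fix N assume N: "\<forall>i. N i \<in> {I. ideal I R} \<and> N i \<subseteq> N (Suc i)"
  have mono: "N i \<subseteq> N j" if "i \<le> j" for i j using N that by (metis lift_Suc_mono_le)
  have "subset.chain {I. ideal I R} (range N)"
    unfolding subset_chain_def
  proof (intro conjI ballI)
    fix I J assume "I \<in> range N" "J \<in> range N"
    then obtain i j where "I = N i" "J = N j" by blast
    then show "I \<subseteq> J \<or> J \<subseteq> I" using mono[of i j] mono[of j i] nat_le_linear[of i j] by blast
  qed (use N in blast)
  then have "\<Union>(range N) \<in> range N" by (rule ideal_chain_is_trivial[rotated]) blast
  then obtain k where k: "\<Union>(range N) = N k" by blast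
  have "N i = N k" if "i \<ge> k" for i using mono[OF that] k by blast
  then show "\<exists>k. \<forall>i\<ge>k. N i = N k" by blast
qed

context skew_module begin

definition rop :: "'a \<Rightarrow> 'e \<Rightarrow> 'e" where "rop r = (\<lambda>e. act e r)"
abbreviation RW where "RW \<equiv> rop ` carrier R"

lemma rop_endo: "r \<in> carrier R \<Longrightarrow> rop r \<in> endo E"
  unfolding rop_def endo_def using act_closed act_add by blast

lemma RW_endo: "RW \<subseteq> endo E" using rop_endo by blast

lemma act_zero: "r \<in> carrier R \<Longrightarrow> act \<zero>\<^bsub>E\<^esub> r = \<zero>\<^bsub>E\<^esub>"
  using E.endo_zero[OF rop_endo] unfolding rop_def by simp

lemma act_rzero: assumes "e \<in> carrier E" shows "act e \<zero>\<^bsub>R\<^esub> = \<zero>\<^bsub>E\<^esub>"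
proof -
  have "act e \<zero>\<^bsub>R\<^esub> \<oplus>\<^bsub>E\<^esub> act e \<zero>\<^bsub>R\<^esub> = act e \<zero>\<^bsub>R\<^esub>" using act_radd[OF assms, of "\<zero>\<^bsub>R\<^esub>" "\<zero>\<^bsub>R\<^esub>"] by simp
  then show ?thesis using act_closed[OF assms, of "\<zero>\<^bsub>R\<^esub>"] by (metis E.add.l_cancel_one' R.zero_closed)
qed

lemma act_rneg: assumes "e \<in> carrier E" "r \<in> carrier R" shows "act e (\<ominus>\<^bsub>R\<^esub> r) = \<ominus>\<^bsub>E\<^esub> act e r"
proof -
  have "act e (\<ominus>\<^bsub>R\<^esub> r) \<oplus>\<^bsub>E\<^esub> act e r = \<zero>\<^bsub>E\<^esub>"
    using act_radd[OF assms(1), of "\<ominus>\<^bsub>R\<^esub> r" r] assms act_rzero by (simp add: R.l_neg)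
  then show ?thesis using assms act_closed by (metis E.minus_equality R.a_inv_closed)
qed

lemma act_rminus:
  "e \<in> carrier E \<Longrightarrow> r \<in> carrier R \<Longrightarrow> s \<in> carrier R \<Longrightarrow> act e (r \<ominus>\<^bsub>R\<^esub> s) = act e r \<ominus>\<^bsub>E\<^esub> act e s"
  unfolding a_minus_def by (simp add: act_radd act_rneg)

lemma act_comm: "e \<in> carrier E \<Longrightarrow> r \<in> carrier R \<Longrightarrow> s \<in> carrier R \<Longrightarrow> act (act e r) s = act (act e s) r"
  by (metis act_mult R.m_comm)

lemma alpha_closed: "r \<in> carrier R \<Longrightarrow> \<alpha> r \<in> carrier R" and beta_closed: "r \<in> carrier R \<Longrightarrow> \<beta> r \<in> carrier R"
  using ring_hom_closed[OF alpha] ring_hom_closed[OF beta] by auto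

lemma alpha_pow_closed: "r \<in> carrier R \<Longrightarrow> (\<alpha> ^^ k) r \<in> carrier R"
  and beta_pow_closed: "r \<in> carrier R \<Longrightarrow> (\<beta> ^^ k) r \<in> carrier R"
  by (induction k) (auto simp: alpha_closed beta_closed)

lemma ab_pow: "r \<in> carrier R \<Longrightarrow> (\<alpha> ^^ k) ((\<beta> ^^ k) r) = r"
  by (induction k arbitrary: r) (auto simp: funpow_swap1 ab beta_closed beta_pow_closed simp del: funpow.simps simp: funpow_Suc_right[of _ \<alpha>], simp add: ab beta_pow_closed)

lemma ba_pow: "r \<in> carrier R \<Longrightarrow> (\<beta> ^^ k) ((\<alpha> ^^ k) r) = r"
  by (induction k arbitrary: r) (auto simp: funpow_swap1 ba alpha_closed alpha_pow_closed simp del: funpow.simps simp: funpow_Suc_right[of _ \<beta>], simp add: ba alpha_pow_closed)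

lemma theta_act: "e \<in> carrier E \<Longrightarrow> r \<in> carrier R \<Longrightarrow> \<theta> (act e r) = act (\<theta> e) (\<beta> r)"
  by (simp add: act_theta beta_closed ab)

lemma act_theta_pow:
  "e \<in> carrier E \<Longrightarrow> r \<in> carrier R \<Longrightarrow> act ((\<theta> ^^ k) e) r = (\<theta> ^^ k) (act e ((\<alpha> ^^ k) r))"
proof (induction k arbitrary: r)
  case (Suc k)
  have "(\<theta> ^^ k) e \<in> carrier E" using endo_closed[OF endo_pow[OF theta] Suc.prems(1)] .
  then have "act ((\<theta> ^^ Suc k) e) r = \<theta> (act ((\<theta> ^^ k) e) (\<alpha> r))" using act_theta Suc.prems by simp
  also have "\<dots> = \<theta> ((\<theta> ^^ k) (act e ((\<alpha> ^^ k) (\<alpha> r))))" using Suc.IH[OF Suc.prems(1) alpha_closed[OF Suc.prems(2)]] by simp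
  finally show ?case by (simp add: funpow_swap1)
qed simp

lemma theta_norm: "w \<in> RW \<Longrightarrow> \<exists>w'\<in>RW. \<forall>a\<in>carrier E. \<theta> (w a) = w' (\<theta> a)"
  by (auto simp: rop_def theta_act beta_closed intro!: bexI[of _ "\<beta> _"])

lemma theta_norm': "w \<in> RW \<Longrightarrow> \<exists>w'\<in>RW. \<forall>a\<in>carrier E. w (\<theta> a) = \<theta> (w' a)"
  by (auto simp: rop_def act_theta alpha_closed intro!: bexI[of _ "\<alpha> _"])

text \<open>The map from r to e r takes R onto the cyclic module, and preimages of submodules are
  ideals of the Noetherian ring R.\<close>

lemma noeth_cyclic:
  assumes e: "e \<in> carrier E" shows "noeth E RW (gen E RW {e})"
proof -
  let ?C = "act e ` carrier R"
  have opR: "opsub R {} (carrier R)" by (rule R.opsubI) auto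
  have C: "opsub E RW ?C"
  proof (rule E.opsubI)
    show "\<zero>\<^bsub>E\<^esub> \<in> ?C" using act_rzero[OF e] R.zero_closed by (metis imageI)
    fix a b assume "a \<in> ?C" then obtain r where r: "r \<in> carrier R" "a = act e r" by blast
    show "\<ominus>\<^bsub>E\<^esub> a \<in> ?C" using act_rneg[OF e r(1)] r by (metis R.a_inv_closed imageI)
    { assume "b \<in> ?C" then obtain s where s: "s \<in> carrier R" "b = act e s" by blast
      then show "a \<oplus>\<^bsub>E\<^esub> b \<in> ?C" using act_radd[OF e r(1) s(1)] r by (metis R.a_closed imageI) }
    { fix w assume "w \<in> RW" then obtain s where s: "s \<in> carrier R" "w = rop s" by blast
      then show "w a \<in> ?C" using act_mult[OF e r(1) s(1)] r unfolding rop_def by (metis R.m_closed imageI) }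
  qed (use act_closed[OF e] in blast)
  have "e \<in> ?C" using act_one[OF e] by (metis R.one_closed imageI)
  then have sub: "gen E RW {e} \<subseteq> ?C" using gen_min[OF C] by blast
  show ?thesis
  proof (rule ACC_transfer[OF ACC_ideals, of _ "\<lambda>N. {r \<in> carrier R. act e r \<in> N}"])
    fix N assume "N \<in> subs E RW {\<zero>\<^bsub>E\<^esub>} (gen E RW {e})"
    then have N: "opsub E RW N" unfolding subs_def by auto
    have "ideal {r \<in> carrier R. act e r \<in> N} R"
    proof (rule R.vimage_ideal[OF R.is_cring E.abelian_group_axioms N R.oneideal])
      show "\<exists>w\<in>RW. \<forall>a\<in>carrier R. act e (a \<otimes>\<^bsub>R\<^esub> r) = w (act e a)" if "r \<in> carrier R" for r
        using that act_mult[OF e] unfolding rop_def by auto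
    qed (use act_closed[OF e] act_radd[OF e] in auto)
    then show "{r \<in> carrier R. act e r \<in> N} \<in> {I. ideal I R}" by blast
  next
    fix N N' assume "N' \<in> subs E RW {\<zero>\<^bsub>E\<^esub>} (gen E RW {e})" and eq: "{r \<in> carrier R. act e r \<in> N'} = {r \<in> carrier R. act e r \<in> N}"
    then have "N' \<subseteq> ?C" using sub unfolding subs_def by auto
    then show "N' \<subseteq> N" using eq by blast
  qed auto
qed

lemma noeth_fin_gen:
  assumes "finite A" "A \<subseteq> carrier E" shows "noeth E RW (gen E RW A)"
  using assms
proof (induction A rule: finite_induct)
  case empty
  have "gen E RW {} \<subseteq> {\<zero>\<^bsub>E\<^esub>}" by (rule gen_min[OF E.opsub_bot[OF RW_endo]]) simp
  then have s: "subs E RW {\<zero>\<^bsub>E\<^esub>} (gen E RW {}) \<subseteq> {{\<zero>\<^bsub>E\<^esub>}}" unfolding subs_def by blast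
  show ?case by (rule ACC_subset_single[OF s])
next
  case (insert a A)
  have a: "{a} \<subseteq> carrier E" "A \<subseteq> carrier E" using insert.prems by auto
  note o = E.opsub_gen[OF RW_endo a(1)] E.opsub_gen[OF RW_endo a(2)]
  have "gen E RW (insert a A) \<subseteq> gen E RW {a} <+>\<^bsub>E\<^esub> gen E RW A"
    by (rule gen_min[OF E.opsub_sum[OF RW_endo o]])
      (use E.set_add_incl1[OF o] E.set_add_incl2[OF o] gen_incl[of "{a}" E RW] gen_incl[of A E RW] in blast)
  moreover have "noeth E RW (gen E RW {a} <+>\<^bsub>E\<^esub> gen E RW A)"
    by (rule E.noeth_sum[OF RW_endo o noeth_cyclic]) (use insert a in auto)
  ultimately show ?case using ACC_subset[OF _ subs_mono[OF subset_refl]] by blast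
qed

end

section \<open>Annihilators, and the passage between R[\<theta>^n] and R[\<theta>]\<close>

context skew_module begin

definition Ann :: "'a set \<Rightarrow> 'e set" where
  "Ann I = {e \<in> carrier E. \<forall>a\<in>I. act e a = \<zero>\<^bsub>E\<^esub>}"

text \<open>Stability under \<theta> comes from that of \<open>I\<close> under \<alpha>, through
  (\<theta> e) a = \<theta> (e \<alpha>(a)); stability under R comes from commutativity.\<close>

lemma Ann_opsub:
  assumes I: "I \<subseteq> carrier R" "\<And>a. a \<in> I \<Longrightarrow> \<alpha> a \<in> I"
  shows "opsub E (insert \<theta> RW) (Ann I)"
proof (rule E.opsubI)
  show "\<zero>\<^bsub>E\<^esub> \<in> Ann I" unfolding Ann_def using act_zero I by auto
  fix e e' assume e: "e \<in> Ann I"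
  then have ec: "e \<in> carrier E" and ea: "\<And>a. a \<in> I \<Longrightarrow> act e a = \<zero>\<^bsub>E\<^esub>" unfolding Ann_def by auto
  have "act (\<ominus>\<^bsub>E\<^esub> e) a = \<zero>\<^bsub>E\<^esub>" if "a \<in> I" for a
    using E.endo_neg[OF rop_endo ec, of a] that I ea[OF that] unfolding rop_def by auto
  then show "\<ominus>\<^bsub>E\<^esub> e \<in> Ann I" unfolding Ann_def using ec by simp
  { assume "e' \<in> Ann I"
    then show "e \<oplus>\<^bsub>E\<^esub> e' \<in> Ann I" unfolding Ann_def using ec ea I act_add[OF ec] by auto }
  { fix w assume "w \<in> insert \<theta> RW"
    then consider "w = \<theta>" | r where "r \<in> carrier R" "w = rop r" by blast
    then show "w e \<in> Ann I"
    proof cases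
      case 1
      have "act (\<theta> e) a = \<zero>\<^bsub>E\<^esub>" if "a \<in> I" for a
        using act_theta[OF ec, of a] that I ea[of "\<alpha> a"] E.endo_zero[OF theta] by auto
      then show ?thesis unfolding Ann_def using 1 endo_closed[OF theta ec] by simp
    next
      case 2
      have "act (act e r) a = \<zero>\<^bsub>E\<^esub>" if "a \<in> I" for a
        using act_comm[OF ec 2(1), of a] that I ea[OF that] act_zero[OF 2(1)] by auto
      then show ?thesis unfolding Ann_def using 2 act_closed[OF ec] by (simp add: rop_def)
    qed }
qed (auto simp: Ann_def)

lemma theta_RW_endo: "insert \<theta> RW \<subseteq> endo E" using theta RW_endo by blast

lemma theta_norm_insert:
  assumes "w \<in> insert \<theta> RW" shows "\<exists>w'\<in>insert \<theta> RW. \<forall>a\<in>carrier E. \<theta> (w a) = w' (\<theta> a)"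
proof (cases "w = \<theta>")
  case True show ?thesis by (rule bexI[of _ \<theta>]) (use True in auto)
next
  case False then show ?thesis using theta_norm[of w] assms by blast
qed

lemma theta_norm_insert':
  assumes "w \<in> insert \<theta> RW" shows "\<exists>w'\<in>insert \<theta> RW. \<forall>a\<in>carrier E. w (\<theta> a) = \<theta> (w' a)"
proof (cases "w = \<theta>")
  case True show ?thesis by (rule bexI[of _ \<theta>]) (use True in auto)
next
  case False then show ?thesis using theta_norm'[of w] assms by blast
qed

lemma theta_pow_act: "e \<in> carrier E \<Longrightarrow> r \<in> carrier R \<Longrightarrow> (\<theta> ^^ k) (act e r) = act ((\<theta> ^^ k) e) ((\<beta> ^^ k) r)"
  by (simp add: act_theta_pow beta_pow_closed ab_pow)

lemma pow_ops_endo: "insert (\<theta> ^^ n) RW \<subseteq> endo E" using endo_pow[OF theta] RW_endo by blast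

lemma pow_norm:
  assumes "w \<in> insert (\<theta> ^^ n) RW"
  shows "\<exists>w'\<in>insert (\<theta> ^^ n) RW. \<forall>a\<in>carrier E. (\<theta> ^^ j) (w a) = w' ((\<theta> ^^ j) a)"
proof (cases "w = \<theta> ^^ n")
  case True then show ?thesis
    by (intro bexI[of _ "\<theta> ^^ n"]) (auto simp: funpow_add[symmetric, THEN fun_cong, unfolded comp_def] add.commute)
next
  case False
  then obtain r where r: "r \<in> carrier R" "w = rop r" using assms by blast
  then show ?thesis using theta_pow_act beta_pow_closed[OF r(1)]
    by (intro bexI[of _ "rop ((\<beta> ^^ j) r)"]) (auto simp: rop_def)
qed

lemma pow_norm':
  assumes "w \<in> insert (\<theta> ^^ n) RW"
  shows "\<exists>w'\<in>insert (\<theta> ^^ n) RW. \<forall>a\<in>carrier E. w ((\<theta> ^^ j) a) = (\<theta> ^^ j) (w' a)"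
proof (cases "w = \<theta> ^^ n")
  case True then show ?thesis
    by (intro bexI[of _ "\<theta> ^^ n"]) (auto simp: funpow_add[symmetric, THEN fun_cong, unfolded comp_def] add.commute)
next
  case False
  then obtain r where r: "r \<in> carrier R" "w = rop r" using assms by blast
  then show ?thesis using act_theta_pow alpha_pow_closed[OF r(1)]
    by (intro bexI[of _ "rop ((\<alpha> ^^ j) r)"]) (auto simp: rop_def)
qed

text \<open>Since \<theta>^n maps \<open>U\<close> to itself, the sum of the groups \<theta>^j U
  over j < n is closed under \<theta>: the one term leaving the range wraps around into
  \<open>U\<close>. A module over R[\<theta>] is thus a finite sum of twisted copies of one over
  R[\<theta>^n].\<close>

lemma filtration_facts:
  assumes U: "opsub E (insert (\<theta> ^^ n) RW) U"
  shows filtration_opsub: "opsub E (insert (\<theta> ^^ n) RW) (filtration E \<theta> U j)"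
    and filtration_image: "opsub E (insert (\<theta> ^^ n) RW) ((\<theta> ^^ j) ` U)"
    and filtration_top: "n > 0 \<Longrightarrow> opsub E (insert \<theta> RW) (filtration E \<theta> U n)"
    and filtration_incl: "n > 0 \<Longrightarrow> U \<subseteq> filtration E \<theta> U n"
proof -
  have n1: "\<exists>w'\<in>insert (\<theta> ^^ n) RW. \<forall>a\<in>carrier E. \<theta> (w a) = w' (\<theta> a)" if "w \<in> insert (\<theta> ^^ n) RW" for w
    using pow_norm[OF that, of 1] by simp
  have n2: "\<exists>w'\<in>insert (\<theta> ^^ n) RW. \<forall>a\<in>carrier E. w (\<theta> a) = \<theta> (w' a)" if "w \<in> insert (\<theta> ^^ n) RW" for w
    using pow_norm'[OF that, of 1] by simp
  note ctx = E.abelian_group_axioms pow_ops_endo theta n1 n2 U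
  show o: "opsub E (insert (\<theta> ^^ n) RW) (filtration E \<theta> U j)" for j by (rule filt_opsub[OF ctx])
  show im: "opsub E (insert (\<theta> ^^ n) RW) ((\<theta> ^^ j) ` U)" for j by (rule theta_pow_image[OF ctx U])
  have mono: "i \<le> j \<Longrightarrow> filtration E \<theta> U i \<subseteq> filtration E \<theta> U j" for i j by (rule filt_mono_le[OF ctx])
  have shift: "a \<in> filtration E \<theta> U j \<Longrightarrow> \<theta> a \<in> filtration E \<theta> U (Suc j)" for a j by (rule theta_filt[OF ctx])
  assume n: "n > 0"
  have "U \<subseteq> filtration E \<theta> U (Suc 0)"
    using E.set_add_incl2[OF o[of 0] im[of 0]] by simp
  also have "\<dots> \<subseteq> filtration E \<theta> U n" by (rule mono) (use n in simp)
  finally show inc: "U \<subseteq> filtration E \<theta> U n" .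
  have "(\<theta> ^^ n) ` U \<subseteq> filtration E \<theta> U n" using opsub_op[OF U, of "\<theta> ^^ n"] inc by blast
  then have "filtration E \<theta> U (Suc n) \<subseteq> filtration E \<theta> U n" using E.set_add_least[OF o subset_refl] by simp
  then have "\<theta> a \<in> filtration E \<theta> U n" if "a \<in> filtration E \<theta> U n" for a using shift[OF that] by blast
  then show "opsub E (insert \<theta> RW) (filtration E \<theta> U n)" using o[of n] unfolding opsub_def by auto
qed

lemma noeth_theta_gen:
  assumes "finite A" "A \<subseteq> carrier E"
  shows "noeth E (insert \<theta> RW) (gen E (insert \<theta> RW) A)"
proof -
  have "noeth E (insert \<theta> RW) (gen E (insert \<theta> RW) (gen E RW A))"
    by (rule noeth_gen_insert[OF E.abelian_group_axioms RW_endo theta theta_norm theta_norm'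
        E.opsub_gen[OF RW_endo assms(2)] noeth_fin_gen[OF assms]])
  moreover have "gen E (insert \<theta> RW) A \<subseteq> gen E (insert \<theta> RW) (gen E RW A)"
    using gen_incl[of A E RW] unfolding gen_def[of E "insert \<theta> RW"] by blast
  ultimately show ?thesis by (rule ACC_subset[OF _ subs_mono[OF subset_refl]])
qed

end

text \<open>Formulated to cover three situations: an essential extension of V with \<theta>
  bijective on V, the kernel of \<theta> with the identity in the place of \<theta> and n = 1, and V
  as an extension of itself. \<open>V_theta\<close> rules out a \<theta> that kills V; that case is
  reduced to the second situation.\<close>

locale essential_simple = skew_module R E act \<theta> \<alpha> \<beta>
  for R :: "('a, 'r) ring_scheme" and E :: "('e, 's) ring_scheme" and act \<theta> \<alpha> \<beta> +
  fixes P :: "'a set" and n :: nat and A V :: "'e set"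
  assumes P: "ideal P R" and P_alpha: "r \<in> P \<Longrightarrow> \<alpha> r \<in> P" and P_beta: "r \<in> P \<Longrightarrow> \<beta> r \<in> P"
    and n_pos: "n > 0" and alpha_n: "r \<in> carrier R \<Longrightarrow> (\<alpha> ^^ n) r \<ominus>\<^bsub>R\<^esub> r \<in> P"
    and A: "finite A" "A \<subseteq> carrier E" "gen E (insert \<theta> RW) A = carrier E"
    and V: "opsub E (insert \<theta> RW) V" and V_nonzero: "V \<noteq> {\<zero>\<^bsub>E\<^esub>}"
    and V_simple: "opsub E (insert \<theta> RW) K \<Longrightarrow> K \<subseteq> V \<Longrightarrow> K = {\<zero>\<^bsub>E\<^esub>} \<or> K = V"
    and V_theta: "V \<subseteq> \<theta> ` V"
    and VP: "v \<in> V \<Longrightarrow> p \<in> P \<Longrightarrow> act v p = \<zero>\<^bsub>E\<^esub>"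
    and ess: "opsub E (insert \<theta> RW) K \<Longrightarrow> K \<noteq> {\<zero>\<^bsub>E\<^esub>} \<Longrightarrow> \<exists>v\<in>V \<inter> K. v \<noteq> \<zero>\<^bsub>E\<^esub>"
begin

lemma P_sub: "P \<subseteq> carrier R" using ideal.axioms(1)[OF P] additive_subgroup.a_subset by blast

lemma noeth_E: "noeth E (insert \<theta> RW) (carrier E)"
  using noeth_theta_gen[OF A(1,2)] A(3) by simp

text \<open>A finite generating set \<open>B\<close> of P serves as the small set of operators and P
  as the large one; it is P whose stability under \<alpha> and its inverse is assumed.\<close>

lemma artin_rees_P:
  "\<exists>k. \<forall>ps. length ps = k \<longrightarrow> set ps \<subseteq> rop ` P \<longrightarrow> (\<forall>e\<in>carrier E. foldr (\<lambda>p. p) ps e = \<zero>\<^bsub>E\<^esub>)"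
proof -
  obtain B where B: "B \<subseteq> carrier R" "finite B" "P = Idl\<^bsub>R\<^esub> B" using finetely_gen[OF P] by blast
  have BP: "B \<subseteq> P" using R.genideal_self[OF B(1)] B(3) by simp
  interpret AR: artin_rees E RW "rop ` B" "rop ` P" \<theta> "gen E RW A" V
  proof (unfold_locales)
    show "RW \<subseteq> endo E" by (rule RW_endo)
    show "rop ` P \<subseteq> endo E" using rop_endo P_sub by blast
    show "\<theta> \<in> endo E" by (rule theta)
    show "finite (rop ` B)" "rop ` B \<subseteq> rop ` P" using B BP by auto
    show "p (w a) = w (p a)" if "p \<in> rop ` B" "w \<in> RW" "a \<in> carrier E" for p w a
      using that act_comm B(1) unfolding rop_def by auto
    show "p (q a) = q (p a)" if "p \<in> rop ` B" "q \<in> rop ` B" "a \<in> carrier E" for p q a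
      using that act_comm B(1) unfolding rop_def by auto
    \<comment> \<open>The r whose degree-raising operator sends f into N form an ideal, and it
      contains the generators \<open>B\<close>.\<close>
    show "shiftop E p f \<in> N" if N: "opsub (fungrp E) (pointwise ` RW \<union> shiftop E ` rop ` B) N" and p: "p \<in> rop ` P" and f: "f \<in> N" for N p f
    proof -
      have fc: "\<And>i. f i \<in> carrier E" using opsub_carrier[OF N f] by simp
      have "ideal {r \<in> carrier R. shiftop E (rop r) f \<in> N} R"
      proof (rule R.vimage_ideal[OF R.is_cring abelian_group_fungrp[OF E.abelian_group_axioms] N R.oneideal])
        show "shiftop E (rop r) f \<in> carrier (fungrp E)" if "r \<in> carrier R" for r
          using fc act_closed that by (auto simp: shiftop_def rop_def split: nat.split)
        show "shiftop E (rop (r \<oplus>\<^bsub>R\<^esub> s)) f = shiftop E (rop r) f \<oplus>\<^bsub>fungrp E\<^esub> shiftop E (rop s) f"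
          if "r \<in> carrier R" "s \<in> carrier R" for r s
          using fc act_radd that by (auto simp: shiftop_def rop_def fun_eq_iff split: nat.split)
        show "\<exists>w\<in>pointwise ` RW \<union> shiftop E ` rop ` B. \<forall>a\<in>carrier R. shiftop E (rop (a \<otimes>\<^bsub>R\<^esub> r)) f = w (shiftop E (rop a) f)"
          if "r \<in> carrier R" for r
          by (rule bexI[of _ "pointwise (rop r)"])
            (use that fc act_mult act_zero in \<open>auto simp: shiftop_def pointwise_def rop_def fun_eq_iff split: nat.split\<close>)
      qed
      moreover have "B \<subseteq> {r \<in> carrier R. shiftop E (rop r) f \<in> N}"
        using B(1) opsub_op[OF N _ f] by blast
      ultimately have "P \<subseteq> {r \<in> carrier R. shiftop E (rop r) f \<in> N}"
        using R.genideal_minimal B(3) by blast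
      then show ?thesis using p by blast
    qed
    show "\<exists>w'\<in>RW. \<forall>a\<in>carrier E. \<theta> (w a) = w' (\<theta> a)" if "w \<in> RW" for w using theta_norm[OF that] .
    show "\<exists>w'\<in>RW. \<forall>a\<in>carrier E. w (\<theta> a) = \<theta> (w' a)" if "w \<in> RW" for w using theta_norm'[OF that] .
    show "\<exists>w'\<in>rop ` P. \<forall>a\<in>carrier E. \<theta> (w a) = w' (\<theta> a)" if "w \<in> rop ` P" for w
    proof -
      obtain r where r: "r \<in> P" "w = rop r" using \<open>w \<in> rop ` P\<close> by blast
      then show ?thesis using P_sub P_beta theta_act
        by (intro bexI[of _ "rop (\<beta> r)"]) (auto simp: rop_def)
    qed
    show "\<exists>w'\<in>rop ` P. \<forall>a\<in>carrier E. w (\<theta> a) = \<theta> (w' a)" if "w \<in> rop ` P" for w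
    proof -
      obtain r where r: "r \<in> P" "w = rop r" using \<open>w \<in> rop ` P\<close> by blast
      then show ?thesis using P_sub P_alpha act_theta
        by (intro bexI[of _ "rop (\<alpha> r)"]) (auto simp: rop_def)
    qed
    show "opsub E RW (gen E RW A)" by (rule E.opsub_gen[OF RW_endo A(2)])
    show "noeth E RW (gen E RW A)" by (rule noeth_fin_gen[OF A(1,2)])
    show "gen E (insert \<theta> RW) (gen E RW A) = carrier E"
    proof
      show "gen E (insert \<theta> RW) (gen E RW A) \<subseteq> carrier E"
        by (rule gen_min[OF E.opsub_top[OF theta_RW_endo] opsub_sub[OF E.opsub_gen[OF RW_endo A(2)]]])
      have "gen E (insert \<theta> RW) A \<subseteq> gen E (insert \<theta> RW) (gen E RW A)"
        using gen_incl[of A E RW] unfolding gen_def[of E "insert \<theta> RW"] by blast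
      then show "carrier E \<subseteq> gen E (insert \<theta> RW) (gen E RW A)" using A(3) by simp
    qed
    show "opsub E (insert \<theta> RW) V" by (rule V)
    show "p v = \<zero>\<^bsub>E\<^esub>" if "p \<in> rop ` P" "v \<in> V" for p v using that VP unfolding rop_def by auto
    show "\<exists>v\<in>V \<inter> K. v \<noteq> \<zero>\<^bsub>E\<^esub>" if "opsub E (insert \<theta> RW) K" "K \<noteq> {\<zero>\<^bsub>E\<^esub>}" for K using ess[OF that] .
  qed
  show ?thesis by (rule AR.products_vanish)
qed

text \<open>The powers of P as ideals. Starting at R makes the annihilator of the zeroth power the
  zero module, the bottom of the filtration.\<close>

primrec Pp :: "nat \<Rightarrow> 'a set" where
  "Pp 0 = carrier R"
| "Pp (Suc i) = Idl\<^bsub>R\<^esub> {a \<otimes>\<^bsub>R\<^esub> p | a p. a \<in> Pp i \<and> p \<in> P}"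

lemma Pp_ideal: "ideal (Pp i) R"
  and Pp_sub: "Pp i \<subseteq> carrier R"
proof -
  have "ideal (Pp i) R \<and> Pp i \<subseteq> carrier R"
  proof (induction i)
    case 0 show ?case using R.oneideal by simp
  next
    case (Suc i)
    then have "{a \<otimes>\<^bsub>R\<^esub> p | a p. a \<in> Pp i \<and> p \<in> P} \<subseteq> carrier R" using P_sub by blast
    then have "ideal (Pp (Suc i)) R" using R.genideal_ideal by simp
    then show ?case using ideal.axioms(1) additive_subgroup.a_subset by blast
  qed
  then show "ideal (Pp i) R" "Pp i \<subseteq> carrier R" by auto
qed

lemma Pp_prod: assumes "a \<in> Pp i" "p \<in> P" shows "a \<otimes>\<^bsub>R\<^esub> p \<in> Pp (Suc i)"
proof -
  have "{a \<otimes>\<^bsub>R\<^esub> p | a p. a \<in> Pp i \<and> p \<in> P} \<subseteq> carrier R" using Pp_sub P_sub by blast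
  then have "{a \<otimes>\<^bsub>R\<^esub> p | a p. a \<in> Pp i \<and> p \<in> P} \<subseteq> Pp (Suc i)" using R.genideal_self by simp
  then show ?thesis using assms by blast
qed

lemma Pp_least: "ideal I R \<Longrightarrow> (\<And>a p. a \<in> Pp i \<Longrightarrow> p \<in> P \<Longrightarrow> a \<otimes>\<^bsub>R\<^esub> p \<in> I) \<Longrightarrow> Pp (Suc i) \<subseteq> I"
  by (simp, rule R.genideal_minimal) auto

lemma Pp_hom:
  assumes g: "\<gamma> \<in> ring_hom R R" and gP: "\<And>r. r \<in> P \<Longrightarrow> \<gamma> r \<in> P"
  shows "a \<in> Pp i \<Longrightarrow> \<gamma> a \<in> Pp i"
proof (induction i arbitrary: a)
  case 0 then show ?case using ring_hom_closed[OF g] by simp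
next
  case (Suc i)
  interpret I: ideal "Pp (Suc i)" R by (rule Pp_ideal)
  have o: "opsub R ((\<lambda>s b. b \<otimes>\<^bsub>R\<^esub> s) ` carrier R) (Pp (Suc i))"
    by (rule R.opsubI) (use Pp_sub in \<open>auto intro: I.I_r_closed simp del: Pp.simps\<close>)
  have "ideal {a \<in> carrier R. \<gamma> a \<in> Pp (Suc i)} R"
  proof (rule R.vimage_ideal[OF R.is_cring R.abelian_group_axioms o R.oneideal])
    show "\<exists>w\<in>(\<lambda>s b. b \<otimes>\<^bsub>R\<^esub> s) ` carrier R. \<forall>a\<in>carrier R. \<gamma> (a \<otimes>\<^bsub>R\<^esub> r) = w (\<gamma> a)" if "r \<in> carrier R" for r
      using that ring_hom_mult[OF g _ that] ring_hom_closed[OF g that] by (intro bexI[of _ "\<lambda>b. b \<otimes>\<^bsub>R\<^esub> \<gamma> r"]) auto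
  qed (use ring_hom_closed[OF g] ring_hom_add[OF g] in auto)
  then have "Pp (Suc i) \<subseteq> {a \<in> carrier R. \<gamma> a \<in> Pp (Suc i)}"
  proof (rule Pp_least)
    fix a p assume ap: "a \<in> Pp i" "p \<in> P"
    then have "\<gamma> (a \<otimes>\<^bsub>R\<^esub> p) = \<gamma> a \<otimes>\<^bsub>R\<^esub> \<gamma> p" using ring_hom_mult[OF g] Pp_sub P_sub by blast
    then show "a \<otimes>\<^bsub>R\<^esub> p \<in> {a \<in> carrier R. \<gamma> a \<in> Pp (Suc i)}"
      using Pp_prod[OF Suc.IH[OF ap(1)] gP[OF ap(2)]] ap Pp_sub P_sub by auto
  qed
  then show ?case using Suc.prems by blast
qed

lemma Pp_alpha: "a \<in> Pp i \<Longrightarrow> \<alpha> a \<in> Pp i" by (rule Pp_hom[OF alpha P_alpha])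

lemma Pp_beta: "a \<in> Pp i \<Longrightarrow> \<beta> a \<in> Pp i" by (rule Pp_hom[OF beta P_beta])

text \<open>Generalised so that i factors come from the ideal \<open>Pp i\<close> and the other k -
  i from explicit operators \<open>ps\<close> acting afterwards. Each induction step trades one
  factor of the ideal for an operator; the wanted case is i = k with \<open>ps\<close>
  empty.\<close>

lemma Pp_killed:
  assumes k: "\<forall>ps. length ps = k \<longrightarrow> set ps \<subseteq> rop ` P \<longrightarrow> (\<forall>e\<in>carrier E. foldr (\<lambda>p. p) ps e = \<zero>\<^bsub>E\<^esub>)"
  shows "a \<in> Pp i \<Longrightarrow> length ps + i = k \<Longrightarrow> set ps \<subseteq> rop ` P \<Longrightarrow> e \<in> carrier E \<Longrightarrow> foldr (\<lambda>p. p) ps (act e a) = \<zero>\<^bsub>E\<^esub>"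
proof (induction i arbitrary: a ps e)
  case 0 then show ?case using k act_closed by simp
next
  case (Suc i)
  have fe: "foldr (\<lambda>p. p) ps \<in> endo E" using Suc.prems(3)
  proof (induction ps)
    case (Cons p ps)
    then have "p \<in> endo E" using rop_endo P_sub by auto
    then show ?case using Cons endo_comp[of p E "foldr (\<lambda>p. p) ps"] by (simp add: comp_def)
  qed (simp add: endo_id id_def)
  have "ideal {r \<in> carrier R. foldr (\<lambda>p. p) ps (act e r) \<in> {\<zero>\<^bsub>E\<^esub>}} R"
  proof (rule R.vimage_ideal[OF R.is_cring E.abelian_group_axioms E.opsub_bot[OF RW_endo] R.oneideal])
    show "\<exists>w\<in>RW. \<forall>a\<in>carrier R. foldr (\<lambda>p. p) ps (act e (a \<otimes>\<^bsub>R\<^esub> r)) = w (foldr (\<lambda>p. p) ps (act e a))"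
      if r: "r \<in> carrier R" for r
    proof (rule bexI[of _ "rop r"])
      have c: "foldr (\<lambda>p. p) ps (act b r) = act (foldr (\<lambda>p. p) ps b) r \<and> foldr (\<lambda>p. p) ps b \<in> carrier E" if "b \<in> carrier E" for b
        using Suc.prems(3)
      proof (induction ps)
        case (Cons p ps)
        then obtain q where q: "q \<in> P" "p = rop q" by auto
        then have "q \<in> carrier R" using P_sub by blast
        then show ?case using Cons q act_comm[OF _ r] act_closed r unfolding rop_def by auto
      qed (use that in simp)
      show "\<forall>a\<in>carrier R. foldr (\<lambda>p. p) ps (act e (a \<otimes>\<^bsub>R\<^esub> r)) = rop r (foldr (\<lambda>p. p) ps (act e a))"
        using c act_mult[OF Suc.prems(4) _ r] act_closed[OF Suc.prems(4)] unfolding rop_def by simp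
    qed (use r in blast)
  qed (use endo_closed[OF fe] endo_add[OF fe] act_closed[OF Suc.prems(4)] act_radd[OF Suc.prems(4)] in auto)
  then have "Pp (Suc i) \<subseteq> {r \<in> carrier R. foldr (\<lambda>p. p) ps (act e r) \<in> {\<zero>\<^bsub>E\<^esub>}}"
  proof (rule Pp_least)
    fix a p assume ap: "a \<in> Pp i" "p \<in> P"
    then have c: "a \<in> carrier R" "p \<in> carrier R" using Pp_sub P_sub by auto
    \<comment> \<open>\<open>foldr\<close> applies the last entry first, so the new factor p is
      appended at the end of the list.\<close>
    have "foldr (\<lambda>p. p) (ps @ [rop p]) (act e a) = \<zero>\<^bsub>E\<^esub>"
      using Suc.IH[OF ap(1), of "ps @ [rop p]" e] Suc.prems ap(2) by simp
    then show "a \<otimes>\<^bsub>R\<^esub> p \<in> {r \<in> carrier R. foldr (\<lambda>p. p) ps (act e r) \<in> {\<zero>\<^bsub>E\<^esub>}}"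
      using c act_mult[OF Suc.prems(4) c] by (simp add: rop_def)
  qed
  then show ?case using Suc.prems(1) by blast
qed

lemma Ann_Pp_exhaust: "\<exists>k. Ann (Pp k) = carrier E"
proof -
  obtain k where k: "\<forall>ps. length ps = k \<longrightarrow> set ps \<subseteq> rop ` P \<longrightarrow> (\<forall>e\<in>carrier E. foldr (\<lambda>p. p) ps e = \<zero>\<^bsub>E\<^esub>)"
    using artin_rees_P by blast
  have "act e a = \<zero>\<^bsub>E\<^esub>" if "a \<in> Pp k" "e \<in> carrier E" for e a
    using Pp_killed[OF k that(1), of "[]" e] that by simp
  then show ?thesis unfolding Ann_def by blast
qed

end

lemma (in abelian_group) noeth_image:
  assumes U: "opsub G W U" and n: "noeth G W U" and h: "h \<in> endo G"
    and hw: "\<And>w. w \<in> W \<Longrightarrow> \<exists>w'\<in>W. \<forall>a\<in>carrier G. h (w a) = w' (h a)"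
  shows "noeth G W (h ` U)"
proof (rule ACC_transfer[OF n, of _ "\<lambda>N. {u \<in> U. h u \<in> N}"])
  fix N assume "N \<in> subs G W {\<zero>} (h ` U)"
  then have N: "opsub G W N" unfolding subs_def by auto
  have "opsub G W {u \<in> U. h u \<in> N}"
  proof (rule preimage_opsub[OF abelian_group_axioms U N])
    fix w assume "w \<in> W"
    then obtain w' where "w' \<in> W" "\<forall>a\<in>carrier G. h (w a) = w' (h a)" using hw by blast
    then show "\<exists>w'\<in>W. \<forall>a\<in>U. h (w a) = w' (h a)" using opsub_sub[OF U] by (intro bexI[of _ w']) auto
  qed (use endo_closed[OF h] endo_add[OF h] opsub_carrier[OF U] in auto)
  then show "{u \<in> U. h u \<in> N} \<in> subs G W {\<zero>} U" unfolding subs_def using opsub_zero by auto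
next
  fix N N' assume "N' \<in> subs G W {\<zero>} (h ` U)" and eq: "{u \<in> U. h u \<in> N'} = {u \<in> U. h u \<in> N}"
  then have "N' \<subseteq> h ` U" unfolding subs_def by auto
  then show "N' \<subseteq> N" using eq by blast
qed auto

section \<open>The bottom layer: the annihilator of P over R[x]\<close>

context essential_simple begin

definition xop :: "'e \<Rightarrow> 'e" where "xop = \<theta> ^^ n"
abbreviation TW where "TW \<equiv> insert xop RW"
definition D1 :: "'e set" where "D1 = Ann P"
text \<open>R and x commute on \<open>D1\<close> but not necessarily on \<open>E\<close>. Since
  \<open>commuting\<close> and \<open>alg\<close> refer to the carrier of their group, through the
  range of a and through the negative, the group is replaced by its restriction.\<close>

abbreviation G1 where "G1 \<equiv> E\<lparr>carrier := D1\<rparr>"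

lemma D1: "opsub E (insert \<theta> RW) D1"
  unfolding D1_def using Ann_opsub[OF P_sub P_alpha] .

lemma D1_carrier: "e \<in> D1 \<Longrightarrow> e \<in> carrier E" using opsub_carrier[OF D1] .

lemma V_D1: "V \<subseteq> D1" unfolding D1_def Ann_def using VP opsub_carrier[OF V] by blast

lemma xop_endo: "xop \<in> endo E" unfolding xop_def using endo_pow[OF theta] .

lemma TW_endo: "TW \<subseteq> endo E" using xop_endo RW_endo by blast

lemma theta_pow_mem: "opsub E (insert \<theta> RW) N \<Longrightarrow> a \<in> N \<Longrightarrow> (\<theta> ^^ k) a \<in> N"
  by (induction k) (auto intro: opsub_op)

lemma opsub_TW: assumes "opsub E (insert \<theta> RW) N" shows "opsub E TW N"
  using assms theta_pow_mem[OF assms, of _ n] unfolding opsub_def xop_def by auto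

lemma xop_norm: "w \<in> RW \<Longrightarrow> \<exists>w'\<in>RW. \<forall>a\<in>carrier E. xop (w a) = w' (xop a)"
  unfolding xop_def rop_def by (auto simp: theta_pow_act beta_pow_closed intro!: bexI[of _ "(\<beta> ^^ n) _"])

lemma xop_norm': "w \<in> RW \<Longrightarrow> \<exists>w'\<in>RW. \<forall>a\<in>carrier E. w (xop a) = xop (w' a)"
  unfolding xop_def rop_def by (auto simp: act_theta_pow alpha_pow_closed intro!: bexI[of _ "(\<alpha> ^^ n) _"])

lemma theta_xop: "\<theta> (xop a) = xop (\<theta> a)" unfolding xop_def by (simp add: funpow_swap1)

lemma theta_pow_TW: "w \<in> TW \<Longrightarrow> \<exists>w'\<in>TW. \<forall>a\<in>carrier E. (\<theta> ^^ j) (w a) = w' ((\<theta> ^^ j) a)"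
  unfolding xop_def by (rule pow_norm)

lemma theta_pow_TW': "w \<in> TW \<Longrightarrow> \<exists>w'\<in>TW. \<forall>a\<in>carrier E. w ((\<theta> ^^ j) a) = (\<theta> ^^ j) (w' a)"
  unfolding xop_def by (rule pow_norm')

lemma D1_alpha_n: assumes e: "e \<in> D1" and r: "r \<in> carrier R" shows "act e ((\<alpha> ^^ n) r) = act e r"
proof -
  have ec: "e \<in> carrier E" using D1_carrier[OF e] .
  have "act e ((\<alpha> ^^ n) r \<ominus>\<^bsub>R\<^esub> r) = \<zero>\<^bsub>E\<^esub>" using e alpha_n[OF r] unfolding D1_def Ann_def by blast
  then show ?thesis using act_rminus[OF ec alpha_pow_closed[OF r] r] act_closed[OF ec] r alpha_pow_closed[OF r]
    by (rule_tac E.eq_of_minus_zero) simp_all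
qed

lemma D1_beta_n: "e \<in> D1 \<Longrightarrow> r \<in> carrier R \<Longrightarrow> act e ((\<beta> ^^ n) r) = act e r"
  using D1_alpha_n[of e "(\<beta> ^^ n) r"] by (simp add: beta_pow_closed ab_pow)

lemma xop_act: "e \<in> D1 \<Longrightarrow> r \<in> carrier R \<Longrightarrow> act (xop e) r = xop (act e r)"
  unfolding xop_def using act_theta_pow[OF D1_carrier] D1_alpha_n by simp

lemma G1: "abelian_group G1" by (rule abelian_group_restrict[OF E.abelian_group_axioms D1])

lemma TW_endo1: "TW \<subseteq> endo G1"
proof
  fix w assume w: "w \<in> TW"
  show "w \<in> endo G1"
    by (rule endo_restrict[OF subsetD[OF TW_endo w] opsub_antimono[OF opsub_TW[OF D1]]]) (use w in simp)
qed

lemma theta_endo1: "\<theta> \<in> endo G1"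
  by (rule endo_restrict[OF theta]) (rule opsub_antimono[OF D1], blast)

lemma commuting1: "commuting G1 TW"
proof -
  have "w (w' a) = w' (w a)" if "w \<in> TW" "w' \<in> TW" "a \<in> D1" for w w' a
    using that act_comm[OF D1_carrier] xop_act unfolding rop_def by auto
  then show ?thesis unfolding commuting_def by simp
qed

text \<open>\<open>D1\<close> is finitely generated over R[\<theta>], being inside a Noetherian
  module. The R[x]-module \<open>M2\<close> spanned by these generators is Noetherian by the basis
  theorem, and \<open>D1\<close> is contained in the finite sum of the semilinear images \<theta>^j
  M2 with j < n.\<close>

lemma noeth_D1: "noeth E TW D1"
proof -
  have "noeth E (insert \<theta> RW) D1"
    by (rule ACC_subset[OF noeth_E]) (rule subs_mono, use opsub_sub[OF D1] in auto)
  from E.noeth_fg[OF theta_RW_endo D1 this] obtain B where B: "finite B" "B \<subseteq> D1" "gen E (insert \<theta> RW) B = D1" .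
  have Bc: "B \<subseteq> carrier E" using B(2) opsub_sub[OF D1] by blast
  define M1 where "M1 = gen E RW B"
  define M2 where "M2 = gen E TW M1"
  have M1: "opsub E RW M1" unfolding M1_def by (rule E.opsub_gen[OF RW_endo Bc])
  have M2: "opsub E TW M2" unfolding M2_def by (rule E.opsub_gen[OF TW_endo opsub_sub[OF M1]])
  have nM1: "noeth E RW M1" unfolding M1_def by (rule noeth_fin_gen[OF B(1) Bc])
  have nM2: "noeth E TW M2" unfolding M2_def
    by (rule noeth_gen_insert[OF E.abelian_group_axioms RW_endo xop_endo xop_norm xop_norm' M1 nM1])
  note M2' = M2[unfolded xop_def]
  have f_opsub: "opsub E TW (filtration E \<theta> M2 j)" and f_image: "opsub E TW ((\<theta> ^^ j) ` M2)" for j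
    unfolding xop_def by (rule filtration_opsub[OF M2'], rule filtration_image[OF M2'])
  have nf: "noeth E TW (filtration E \<theta> M2 j)" for j
  proof (induction j)
    case 0
    show ?case by (rule ACC_subset[OF nM2]) (use opsub_zero[OF M2] in \<open>auto simp: subs_def\<close>)
  next
    case (Suc j)
    have "noeth E TW ((\<theta> ^^ j) ` M2)"
      by (rule E.noeth_image[OF M2 nM2 endo_pow[OF theta] theta_pow_TW])
    then show ?case
      using E.noeth_sum[OF TW_endo f_opsub f_image Suc] by simp
  qed
  have "opsub E (insert \<theta> RW) (filtration E \<theta> M2 n)" by (rule filtration_top[OF M2' n_pos])
  moreover have "B \<subseteq> filtration E \<theta> M2 n"
    using gen_incl[of B E RW] gen_incl[of M1 E TW] filtration_incl[OF M2' n_pos] unfolding M1_def M2_def by blast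
  ultimately have "D1 \<subseteq> filtration E \<theta> M2 n" using gen_min B(3) by blast
  then show ?thesis by (rule ACC_subset[OF nf subs_mono[OF subset_refl]])
qed

lemma V_theta_pow: "V \<subseteq> (\<theta> ^^ j) ` V"
proof (induction j)
  case (Suc j)
  show ?case
  proof
    fix v assume "v \<in> V"
    then obtain v1 where v1: "v1 \<in> V" "v = \<theta> v1" using V_theta by blast
    then obtain v2 where "v2 \<in> V" "v1 = (\<theta> ^^ j) v2" using Suc by blast
    then show "v \<in> (\<theta> ^^ Suc j) ` V" using v1 by auto
  qed
qed simp

text \<open>As in Clifford's theorem: the conjugates under \<open>\<theta>\<close> of a maximal submodule over \<open>R[\<theta>\<^sup>n]\<close>
  intersect in a submodule over \<open>R[\<theta>]\<close>, hence in zero.\<close>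

lemma artin_V: "artin E TW V"
proof -
  note VT = opsub_TW[OF V]
  have nV: "noeth E TW V" by (rule ACC_subset[OF noeth_D1]) (rule subs_mono, use V_D1 in auto)
  let ?C = "{N. opsub E TW N \<and> N \<subset> V}"
  have "?C \<subseteq> subs E TW {\<zero>\<^bsub>E\<^esub>} V" using opsub_zero unfolding subs_def by blast
  moreover have "{\<zero>\<^bsub>E\<^esub>} \<in> ?C" using E.opsub_bot[OF TW_endo] opsub_zero[OF V] V_nonzero by blast
  ultimately obtain V0 where "V0 \<in> ?C" and max: "\<forall>M\<in>?C. V0 \<subseteq> M \<longrightarrow> M = V0"
    by (rule ACC_maximal[OF nV])
  then have V0: "opsub E TW V0" "V0 \<subset> V" by auto
  have d0: "DCC (subs E TW V0 V)"
    by (rule DCC_subset_pair[of _ V0 V]) (use max in \<open>auto simp: subs_def\<close>)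
  have Vj: "opsub E TW ((\<theta> ^^ j) ` V0)" for j
  proof (rule E.image_opsub[OF E.abelian_group_axioms V0(1)])
    fix w assume "w \<in> TW"
    then obtain w' where "w' \<in> TW" "\<forall>a\<in>carrier E. w ((\<theta> ^^ j) a) = (\<theta> ^^ j) (w' a)" using theta_pow_TW' by blast
    then show "\<exists>w'\<in>TW. \<forall>a\<in>V0. w ((\<theta> ^^ j) a) = (\<theta> ^^ j) (w' a)" using opsub_sub[OF V0(1)] by (intro bexI[of _ w']) auto
  qed (use endo_closed[OF endo_pow[OF theta]] endo_add[OF endo_pow[OF theta]] opsub_carrier[OF V0(1)] in auto)
  have VjV: "(\<theta> ^^ j) ` V0 \<subseteq> V" for j using V0(2) theta_pow_mem[OF V] by blast
  \<comment> \<open>Because \<theta>^j maps V onto V, preimages under it separate nested submodules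
    between \<theta>^j V0 and V and land between V0 and V, where the factor is simple.\<close>
  have dj: "DCC (subs E TW ((\<theta> ^^ j) ` V0) V)" for j
  proof (rule DCC_transfer[OF d0, of _ "\<lambda>N. {v \<in> V. (\<theta> ^^ j) v \<in> N}"])
    fix N assume "N \<in> subs E TW ((\<theta> ^^ j) ` V0) V"
    then have N: "opsub E TW N" "(\<theta> ^^ j) ` V0 \<subseteq> N" unfolding subs_def by auto
    have "opsub E TW {v \<in> V. (\<theta> ^^ j) v \<in> N}"
    proof (rule E.preimage_opsub[OF E.abelian_group_axioms VT N(1)])
      fix w assume "w \<in> TW"
      then obtain w' where "w' \<in> TW" "\<forall>a\<in>carrier E. (\<theta> ^^ j) (w a) = w' ((\<theta> ^^ j) a)" using theta_pow_TW by blast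
      then show "\<exists>w'\<in>TW. \<forall>a\<in>V. (\<theta> ^^ j) (w a) = w' ((\<theta> ^^ j) a)" using opsub_sub[OF V] by (intro bexI[of _ w']) auto
    qed (use endo_closed[OF endo_pow[OF theta]] endo_add[OF endo_pow[OF theta]] opsub_carrier[OF V] in auto)
    then show "{v \<in> V. (\<theta> ^^ j) v \<in> N} \<in> subs E TW V0 V" using N(2) V0(2) unfolding subs_def by blast
  next
    fix N N' assume "N' \<in> subs E TW ((\<theta> ^^ j) ` V0) V" and eq: "{v \<in> V. (\<theta> ^^ j) v \<in> N'} = {v \<in> V. (\<theta> ^^ j) v \<in> N}"
    then have "N' \<subseteq> (\<theta> ^^ j) ` V" using V_theta_pow[of j] unfolding subs_def by blast
    then show "N' \<subseteq> N" using eq by blast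
  qed auto
  define I where "I j = {v \<in> V. \<forall>i<j. v \<in> (\<theta> ^^ i) ` V0}" for j
  have ISuc: "I (Suc j) = I j \<inter> (\<theta> ^^ j) ` V0" for j unfolding I_def by (auto simp: less_Suc_eq)
  have Io: "opsub E TW (I j)" for j
  proof (induction j)
    case 0 then show ?case using VT by (simp add: I_def)
  next
    case (Suc j) then show ?case unfolding ISuc by (rule E.opsub_Int[OF _ Vj])
  qed
  have IV: "I j \<subseteq> V" for j unfolding I_def by blast
  have dI: "DCC (subs E TW (I j) V)" for j
  proof (induction j)
    case 0
    show ?case by (rule DCC_subset_pair[of _ V V]) (auto simp: subs_def I_def)
  next
    case (Suc j)
    have "DCC (subs E TW (I j \<inter> (\<theta> ^^ j) ` V0) (I j))"
      by (rule E.DCC_subs_Int[OF TW_endo Io Vj VT IV VjV dj])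
    from E.DCC_subs_trans[OF TW_endo Io VT _ IV this Suc] show ?case unfolding ISuc by blast
  qed
  have "opsub E (insert \<theta> RW) (I n)"
  proof -
    \<comment> \<open>\<theta> shifts the conjugates cyclically; at the wrap-around, applying
      \<theta> to \<theta>^(n-1) V0 gives x V0, which lies in V0.\<close>
    have "\<theta> v \<in> I n" if v: "v \<in> I n" for v
    proof -
      have vV: "v \<in> V" and vi: "\<And>i. i < n \<Longrightarrow> v \<in> (\<theta> ^^ i) ` V0" using v unfolding I_def by auto
      have "\<theta> v \<in> (\<theta> ^^ i) ` V0" if i: "i < n" for i
      proof (cases i)
        case 0
        obtain u where u: "u \<in> V0" "v = (\<theta> ^^ (n - 1)) u" using vi[of "n - 1"] n_pos by auto
        have "\<theta> v = (\<theta> ^^ Suc (n - 1)) u" using u by simp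
        then have "\<theta> v = xop u" unfolding xop_def using n_pos by (simp del: funpow.simps)
        then show ?thesis using opsub_op[OF V0(1), of xop u] u 0 by simp
      next
        case (Suc i')
        then obtain u where "u \<in> V0" "v = (\<theta> ^^ i') u" using vi[of i'] i by auto
        then show ?thesis using Suc by auto
      qed
      then show ?thesis using opsub_op[OF V _ vV] unfolding I_def by auto
    qed
    then show ?thesis using Io[of n] unfolding opsub_def by auto
  qed
  moreover have "I n \<subseteq> V0" unfolding I_def using n_pos by auto
  ultimately have "I n = {\<zero>\<^bsub>E\<^esub>}" using V_simple[of "I n"] IV[of n] V0(2) by blast
  then show ?thesis using dI[of n] by simp
qed

text \<open>\<open>\<tau> i\<close> plays the role of the conjugate
  \<open>\<theta>^i t \<theta>^(-i)\<close>. As \<theta> need not be invertible on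
  \<open>D1\<close>, it is built by applying \<beta>^i to the coefficients of t; the period n arises
  because \<beta>^n does not change the action on \<open>D1\<close>.\<close>

lemma alg_conjugates:
  assumes "t \<in> alg G1 TW"
  shows "\<exists>\<tau> :: nat \<Rightarrow> 'e \<Rightarrow> 'e. \<tau> 0 = t \<and> (\<forall>i. \<tau> i \<in> alg G1 TW) \<and>
    (\<forall>i. \<forall>a\<in>D1. \<theta> (\<tau> i a) = \<tau> (Suc i) (\<theta> a)) \<and> (\<forall>i. \<forall>a\<in>D1. \<tau> (i + n) a = \<tau> i a)"
  using assms
proof (induction rule: alg.induct)
  have D: "\<tau> a \<in> D1" if "\<tau> \<in> alg G1 TW" "a \<in> D1" for \<tau> a
    using abelian_group.alg_closed[OF G1 TW_endo1 that(1)] that(2) by simp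
  { case alg_zero
    show ?case
      by (rule exI[of _ "\<lambda>i a. \<zero>\<^bsub>G1\<^esub>"]) (use alg.alg_zero[of G1 TW] E.endo_zero[OF theta] in auto) }
  { case alg_one
    show ?case by (rule exI[of _ "\<lambda>i a. a"]) (use alg.alg_one[of G1 TW] in auto) }
  { case (alg_op w t)
    then obtain \<tau> where \<tau>: "\<tau> 0 = t" "\<And>i. \<tau> i \<in> alg G1 TW" "\<And>i a. a \<in> D1 \<Longrightarrow> \<theta> (\<tau> i a) = \<tau> (Suc i) (\<theta> a)"
      "\<And>i a. a \<in> D1 \<Longrightarrow> \<tau> (i + n) a = \<tau> i a" by blast
    show ?case
    proof (cases "w = xop")
      case True
      show ?thesis
        by (rule exI[of _ "\<lambda>i a. xop (\<tau> i a)"])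
          (use True \<tau> theta_xop alg.alg_op[OF _ \<tau>(2), of xop] in auto)
    next
      case False
      then obtain r where r: "r \<in> carrier R" "w = rop r" using alg_op by blast
      have op: "(\<lambda>a. act (\<tau> i a) ((\<beta> ^^ i) r)) \<in> alg G1 TW" for i
        using alg.alg_op[OF _ \<tau>(2), of "rop ((\<beta> ^^ i) r)" i] beta_pow_closed[OF r(1)] by (simp add: rop_def)
      have cj: "\<theta> (act (\<tau> i a) ((\<beta> ^^ i) r)) = act (\<tau> (Suc i) (\<theta> a)) ((\<beta> ^^ Suc i) r)" if "a \<in> D1" for i a
        using theta_act[OF D1_carrier[OF D[OF \<tau>(2) that]] beta_pow_closed[OF r(1)]] \<tau>(3)[OF that] by simp
      have per: "act (\<tau> (i + n) a) ((\<beta> ^^ (i + n)) r) = act (\<tau> i a) ((\<beta> ^^ i) r)" if "a \<in> D1" for i a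
      proof -
        have "(\<beta> ^^ (i + n)) r = (\<beta> ^^ n) ((\<beta> ^^ i) r)" by (simp add: add.commute[of i n] funpow_add)
        then show ?thesis
          using D1_beta_n[OF D[OF \<tau>(2) that] beta_pow_closed[OF r(1)]] \<tau>(4)[OF that] by simp
      qed
      show ?thesis
        by (rule exI[of _ "\<lambda>i a. act (\<tau> i a) ((\<beta> ^^ i) r)"])
          (intro conjI allI ballI op cj per, simp add: \<tau>(1) r(2) rop_def)
    qed }
  { case (alg_add t t')
    from alg_add obtain \<tau> where \<tau>: "\<tau> 0 = t" "\<And>i. \<tau> i \<in> alg G1 TW" "\<And>i a. a \<in> D1 \<Longrightarrow> \<theta> (\<tau> i a) = \<tau> (Suc i) (\<theta> a)"
      "\<And>i a. a \<in> D1 \<Longrightarrow> \<tau> (i + n) a = \<tau> i a" by blast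
    from alg_add obtain \<tau>' where \<tau>': "\<tau>' 0 = t'" "\<And>i. \<tau>' i \<in> alg G1 TW" "\<And>i a. a \<in> D1 \<Longrightarrow> \<theta> (\<tau>' i a) = \<tau>' (Suc i) (\<theta> a)"
      "\<And>i a. a \<in> D1 \<Longrightarrow> \<tau>' (i + n) a = \<tau>' i a" by blast
    have "\<theta> (\<tau> i a \<oplus>\<^bsub>E\<^esub> \<tau>' i a) = \<tau> (Suc i) (\<theta> a) \<oplus>\<^bsub>E\<^esub> \<tau>' (Suc i) (\<theta> a)" if "a \<in> D1" for i a
      using endo_add[OF theta D1_carrier[OF D[OF \<tau>(2) that]] D1_carrier[OF D[OF \<tau>'(2) that]]] \<tau>(3)[OF that] \<tau>'(3)[OF that] by simp
    then show ?case
      by (intro exI[of _ "\<lambda>i a. \<tau> i a \<oplus>\<^bsub>G1\<^esub> \<tau>' i a"])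
        (use \<tau> \<tau>' alg.alg_add[OF \<tau>(2) \<tau>'(2)] in auto) }
  { case (alg_neg t)
    then obtain \<tau> where \<tau>: "\<tau> 0 = t" "\<And>i. \<tau> i \<in> alg G1 TW" "\<And>i a. a \<in> D1 \<Longrightarrow> \<theta> (\<tau> i a) = \<tau> (Suc i) (\<theta> a)"
      "\<And>i a. a \<in> D1 \<Longrightarrow> \<tau> (i + n) a = \<tau> i a" by blast
    have "\<theta> (\<ominus>\<^bsub>G1\<^esub> \<tau> i a) = \<ominus>\<^bsub>G1\<^esub> \<tau> (Suc i) (\<theta> a)" if "a \<in> D1" for i a
      using abelian_group.endo_neg[OF G1 theta_endo1, of "\<tau> i a"] D[OF \<tau>(2) that] \<tau>(3)[OF that] by simp
    then show ?case
      by (intro exI[of _ "\<lambda>i a. \<ominus>\<^bsub>G1\<^esub> \<tau> i a"])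
        (use \<tau> alg.alg_neg[OF \<tau>(2)] in auto) }
qed

text \<open>The conjugates of s are finitely many by periodicity, are cyclically permuted by
  \<theta>, and all vanish on V because \<theta> maps V onto V. Artin-Rees kills all their products
  of some length l, in particular \<open>s^l\<close>. The operator s alone would not do, as \<theta>
  need not normalise it.\<close>

lemma nilpotent_of_zero_on_V:
  assumes s: "s \<in> alg G1 TW" and sV: "\<And>v. v \<in> V \<Longrightarrow> s v = \<zero>\<^bsub>E\<^esub>"
  shows "\<exists>l. \<forall>a\<in>D1. (s ^^ l) a = \<zero>\<^bsub>E\<^esub>"
proof -
  interpret G1: abelian_group G1 by (rule G1)
  obtain \<tau> where \<tau>: "\<tau> 0 = s" "\<And>i. \<tau> i \<in> alg G1 TW" "\<And>i a. a \<in> D1 \<Longrightarrow> \<theta> (\<tau> i a) = \<tau> (Suc i) (\<theta> a)"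
    "\<And>i a. a \<in> D1 \<Longrightarrow> \<tau> (i + n) a = \<tau> i a" using alg_conjugates[OF s] by blast
  have \<tau>V: "\<tau> i v = \<zero>\<^bsub>E\<^esub>" if "v \<in> V" for i v
    using that
  proof (induction i arbitrary: v)
    case 0 then show ?case using \<tau>(1) sV by simp
  next
    case (Suc i)
    then obtain u where u: "u \<in> V" "v = \<theta> u" using V_theta by blast
    then show ?case using \<tau>(3)[of u i] Suc.IH[OF u(1)] V_D1 E.endo_zero[OF theta] by auto
  qed
  have theta_D1: "\<theta> a \<in> D1" if "a \<in> D1" for a using opsub_op[OF D1 _ that] by blast
  have wrap: "\<theta> (\<tau> i a) = (if Suc i < n then \<tau> (Suc i) (\<theta> a) else \<tau> 0 (\<theta> a))" if "i < n" "a \<in> D1" for i a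
  proof (cases "Suc i < n")
    case False
    then have "Suc i = 0 + n" using that by simp
    then show ?thesis using \<tau>(3)[OF that(2), of i] \<tau>(4)[OF theta_D1[OF that(2)], of 0] False by simp
  qed (use \<tau>(3)[OF that(2)] in simp)
  interpret AR: artin_rees G1 TW "\<tau> ` {..<n}" "\<tau> ` {..<n}" \<theta> D1 V
  proof (unfold_locales)
    show "TW \<subseteq> endo G1" by (rule TW_endo1)
    show "\<tau> ` {..<n} \<subseteq> endo G1" using G1.alg_endo[OF TW_endo1 \<tau>(2)] by blast
    show "\<theta> \<in> endo G1" by (rule theta_endo1)
    show "p (w a) = w (p a)" if "p \<in> \<tau> ` {..<n}" "w \<in> TW" "a \<in> carrier G1" for p w a
      using that G1.alg_comm1[OF TW_endo1 commuting1 that(2) \<tau>(2)] by blast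
    show "p (q a) = q (p a)" if "p \<in> \<tau> ` {..<n}" "q \<in> \<tau> ` {..<n}" "a \<in> carrier G1" for p q a
      using that G1.alg_comm[OF TW_endo1 commuting1 \<tau>(2) \<tau>(2) that(3)] by blast
    show "shiftop G1 p f \<in> N" if N: "opsub (fungrp G1) (pointwise ` TW \<union> shiftop G1 ` \<tau> ` {..<n}) N"
      and "p \<in> \<tau> ` {..<n}" "f \<in> N" for N p f
      by (rule opsub_op[OF N]) (use that in auto)
    show "\<exists>w'\<in>TW. \<forall>a\<in>carrier G1. \<theta> (w a) = w' (\<theta> a)" if w: "w \<in> TW" for w
    proof -
      obtain w' where "w' \<in> TW" "\<forall>a\<in>carrier E. \<theta> (w a) = w' (\<theta> a)" using theta_pow_TW[OF w, of 1] by auto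
      then show ?thesis using D1_carrier by (intro bexI[of _ w']) auto
    qed
    show "\<exists>w'\<in>TW. \<forall>a\<in>carrier G1. w (\<theta> a) = \<theta> (w' a)" if w: "w \<in> TW" for w
    proof -
      obtain w' where "w' \<in> TW" "\<forall>a\<in>carrier E. w (\<theta> a) = \<theta> (w' a)" using theta_pow_TW'[OF w, of 1] by auto
      then show ?thesis using D1_carrier by (intro bexI[of _ w']) auto
    qed
    show "\<exists>p'\<in>\<tau> ` {..<n}. \<forall>a\<in>carrier G1. \<theta> (p a) = p' (\<theta> a)" if p: "p \<in> \<tau> ` {..<n}" for p
    proof -
      obtain i where i: "i < n" "p = \<tau> i" using p by blast
      show ?thesis
        by (rule bexI[of _ "\<tau> (if Suc i < n then Suc i else 0)"]) (use wrap[OF i(1)] i n_pos in auto)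
    qed
    show "\<exists>p'\<in>\<tau> ` {..<n}. \<forall>a\<in>carrier G1. p (\<theta> a) = \<theta> (p' a)" if p: "p \<in> \<tau> ` {..<n}" for p
    proof -
      obtain i where i: "i < n" "p = \<tau> i" using p by blast
      show ?thesis
      proof (cases i)
        case 0
        then show ?thesis using wrap[of "n - 1"] i n_pos by (intro bexI[of _ "\<tau> (n - 1)"]) auto
      next
        case (Suc j)
        then show ?thesis using wrap[of j] i by (intro bexI[of _ "\<tau> j"]) auto
      qed
    qed
    show "opsub G1 TW D1" using G1.opsub_top[OF TW_endo1] by simp
    show "noeth G1 TW D1" using noeth_D1 subs_restrict[OF opsub_sub[OF D1], of D1 TW] by simp
    have tt: "insert \<theta> TW \<subseteq> endo G1" using TW_endo1 theta_endo1 by blast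
    show "gen G1 (insert \<theta> TW) D1 = carrier G1"
      using gen_min[OF G1.opsub_top[OF tt], of D1] gen_incl[of D1 G1 "insert \<theta> TW"] by auto
    show "opsub G1 (insert \<theta> TW) V"
      using V V_D1 opsub_TW[OF V] opsub_restrict[OF opsub_sub[OF D1], of "insert \<theta> TW" V] unfolding opsub_def by auto
    show "p v = \<zero>\<^bsub>G1\<^esub>" if "p \<in> \<tau> ` {..<n}" "v \<in> V" for p v using \<tau>V that by auto
    show "\<exists>v\<in>V \<inter> K. v \<noteq> \<zero>\<^bsub>G1\<^esub>" if K: "opsub G1 (insert \<theta> TW) K" "K \<noteq> {\<zero>\<^bsub>G1\<^esub>}" for K
    proof -
      have "opsub E (insert \<theta> TW) K" using K(1) opsub_restrict[OF opsub_sub[OF D1]] by blast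
      then have "opsub E (insert \<theta> RW) K" by (rule opsub_antimono) blast
      then show ?thesis using ess[of K] K(2) by simp
    qed
  qed auto
  obtain l where l: "\<forall>ps. length ps = l \<longrightarrow> set ps \<subseteq> \<tau> ` {..<n} \<longrightarrow> (\<forall>e\<in>carrier G1. foldr (\<lambda>p. p) ps e = \<zero>\<^bsub>G1\<^esub>)"
    using AR.products_vanish by blast
  have r: "foldr (\<lambda>p. p) (replicate k s) a = (s ^^ k) a" for k a by (induction k) auto
  have "set (replicate l s) \<subseteq> \<tau> ` {..<n}" using \<tau>(1) n_pos by (auto simp: set_replicate_conv_if)
  then have "\<forall>e\<in>carrier G1. foldr (\<lambda>p. p) (replicate l s) e = \<zero>\<^bsub>G1\<^esub>"
    using l[rule_format, of "replicate l s"] by (simp only: length_replicate) blast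
  then show ?thesis by (intro exI[of _ l]) (simp only: r, simp)
qed

text \<open>V is Artinian over R[x], so the images \<open>t^k V\<close> become stationary and t has
  a polynomial inverse u on the last of them. Then \<open>t^k (1 - t u)\<close> vanishes on V and is
  nilpotent on \<open>D1\<close>, which is pi-regularity.\<close>

theorem artin_D1: "artin E TW D1"
proof -
  interpret G1: abelian_group G1 by (rule G1)
  have VG: "opsub G1 TW V" using opsub_TW[OF V] V_D1 opsub_restrict[OF opsub_sub[OF D1]] by blast
  have sr: "subs G1 TW A B = subs E TW A B" if "B \<subseteq> D1" for A B using subs_restrict[OF opsub_sub[OF D1] that] .
  have nV: "noeth G1 TW V" using ACC_subset[OF noeth_D1 subs_mono[OF subset_refl V_D1]] sr[OF V_D1] by simp
  have aV: "artin G1 TW V" using artin_V sr[OF V_D1] by simp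
  have "artin G1 TW (carrier G1)"
  proof (rule G1.artin_of_pi_regular[OF TW_endo1 commuting1])
    show "noeth G1 TW (carrier G1)" using noeth_D1 sr[of D1] by simp
    fix t assume t: "t \<in> alg G1 TW"
    have tk: "opsub G1 TW ((t ^^ k) ` V)" for k
      by (rule G1.image_alg_opsub[OF TW_endo1 commuting1 alg_pow[OF t] VG])
    obtain k where k: "\<And>i. i \<ge> k \<Longrightarrow> (t ^^ i) ` V = (t ^^ k) ` V"
    proof (rule DCC_D[OF aV, of "\<lambda>i. (t ^^ i) ` V"])
      show "(t ^^ i) ` V \<in> subs G1 TW {\<zero>\<^bsub>G1\<^esub>} V" for i
        using tk[of i] opsub_zero[OF tk[of i]] G1.alg_opsub[OF VG alg_pow[OF t]] unfolding subs_def by blast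
      show "(t ^^ Suc i) ` V \<subseteq> (t ^^ i) ` V" for i
        using G1.alg_opsub[OF VG t] by (auto simp: funpow_swap1)
    qed blast
    have "(t ^^ k) ` V \<subseteq> (t ^^ Suc k) ` V" using k[of "Suc k"] by simp
    from G1.stable_image_inverse[OF TW_endo1 commuting1 VG nV t this]
    obtain u where u: "u \<in> alg G1 TW" "\<forall>m\<in>V. (t ^^ k) m = (t ^^ k) (t (u m))" by blast
    define s where "s = (\<lambda>m. (t ^^ k) m \<ominus>\<^bsub>G1\<^esub> (t ^^ k) (t (u m)))"
    have s: "s \<in> alg G1 TW" unfolding s_def
      by (rule alg_minus[OF alg_pow[OF t] alg_comp[OF alg_pow[OF t] alg_comp[OF t u(1)]]])
    have "s v = \<zero>\<^bsub>E\<^esub>" if v: "v \<in> V" for v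
    proof -
      have "(t ^^ k) v \<in> carrier G1" using G1.alg_closed[OF TW_endo1 alg_pow[OF t]] v V_D1 by auto
      then have "(t ^^ k) v \<ominus>\<^bsub>G1\<^esub> (t ^^ k) v = \<zero>\<^bsub>G1\<^esub>" unfolding a_minus_def by (rule G1.r_neg)
      moreover have "(t ^^ k) (t (u v)) = (t ^^ k) v" using u(2) v by auto
      ultimately show ?thesis unfolding s_def by simp
    qed
    then obtain l where "\<forall>a\<in>D1. (s ^^ l) a = \<zero>\<^bsub>E\<^esub>" using nilpotent_of_zero_on_V[OF s] by blast
    then have "\<forall>m\<in>carrier G1. ((\<lambda>m. (t ^^ k) m \<ominus>\<^bsub>G1\<^esub> (t ^^ k) (t (u m))) ^^ l) m = \<zero>\<^bsub>G1\<^esub>"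
      unfolding s_def by simp
    then show "\<exists>u\<in>alg G1 TW. \<exists>k l. \<forall>m\<in>carrier G1. ((\<lambda>m. (t ^^ k) m \<ominus>\<^bsub>G1\<^esub> (t ^^ k) (t (u m))) ^^ l) m = \<zero>\<^bsub>G1\<^esub>"
      using u(1) by blast
  qed
  then show ?thesis using sr[of D1] by simp
qed

end

section \<open>The layers of the annihilator filtration\<close>

lemma alg_mono: assumes "W \<subseteq> W'" "t \<in> alg G W" shows "t \<in> alg G W'"
  using assms(2) by (induction rule: alg.induct) (use assms(1) in \<open>auto intro: alg.intros\<close>)

lemma ring_hom_funpow: assumes "f \<in> ring_hom R R" shows "f ^^ k \<in> ring_hom R R"
proof (induction k)
  case 0 show ?case by (simp add: ring_hom_def)
next
  case (Suc k) then show ?case using ring_hom_trans[OF Suc assms] by (simp only: funpow.simps)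
qed

text \<open>\<open>HC\<close> consists of the \<open>R\<close>-linear maps from the ideal \<open>L\<close> to \<open>D1\<close>, extended by zero. The operator
  \<open>\<theta>\<^sup>n\<close> of the module acts on it as \<open>cop xop (\<alpha> ^^ n)\<close>, which differs from the pointwise action
  \<open>cop xop id\<close> by composition with \<open>\<alpha>\<^sup>n\<close>. The descending chain condition is known for the pointwise
  action and has to be transferred to the twisted one.\<close>

locale hom_layer = essential_simple R E act \<theta> \<alpha> \<beta> P n A V
  for R :: "('a, 'r) ring_scheme" and E :: "('e, 's) ring_scheme" and act \<theta> \<alpha> \<beta> P n A V +
  fixes L :: "'a set"
  assumes L: "ideal L R" and L_alpha: "a \<in> L \<Longrightarrow> \<alpha> a \<in> L" and L_beta: "a \<in> L \<Longrightarrow> \<beta> a \<in> L"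
begin

sublocale L: ideal L R by (rule L)

definition HC :: "('a \<Rightarrow> 'e) set" where
  "HC = {\<Phi>. (\<forall>p\<in>L. \<Phi> p \<in> D1) \<and> (\<forall>p. p \<notin> L \<longrightarrow> \<Phi> p = \<zero>\<^bsub>E\<^esub>) \<and>
     (\<forall>p\<in>L. \<forall>q\<in>L. \<Phi> (p \<oplus>\<^bsub>R\<^esub> q) = \<Phi> p \<oplus>\<^bsub>E\<^esub> \<Phi> q) \<and>
     (\<forall>p\<in>L. \<forall>r\<in>carrier R. \<Phi> (p \<otimes>\<^bsub>R\<^esub> r) = act (\<Phi> p) r)}"

definition HG :: "('a \<Rightarrow> 'e) ring" where "HG = (fungrp E)\<lparr>carrier := HC\<rparr>"

lemma HG_simps [simp]: "carrier HG = HC" "\<zero>\<^bsub>HG\<^esub> = (\<lambda>p. \<zero>\<^bsub>E\<^esub>)" "\<Phi> \<oplus>\<^bsub>HG\<^esub> \<Psi> = (\<lambda>p. \<Phi> p \<oplus>\<^bsub>E\<^esub> \<Psi> p)"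
  unfolding HG_def by simp_all

lemma HC_D: assumes "\<Phi> \<in> HC"
  shows HC_D1: "p \<in> L \<Longrightarrow> \<Phi> p \<in> D1" and HC_out: "p \<notin> L \<Longrightarrow> \<Phi> p = \<zero>\<^bsub>E\<^esub>"
    and HC_add: "p \<in> L \<Longrightarrow> q \<in> L \<Longrightarrow> \<Phi> (p \<oplus>\<^bsub>R\<^esub> q) = \<Phi> p \<oplus>\<^bsub>E\<^esub> \<Phi> q"
    and HC_mult: "p \<in> L \<Longrightarrow> r \<in> carrier R \<Longrightarrow> \<Phi> (p \<otimes>\<^bsub>R\<^esub> r) = act (\<Phi> p) r"
  using assms unfolding HC_def by auto

lemma HC_I:
  assumes "\<And>p. p \<in> L \<Longrightarrow> \<Phi> p \<in> D1" "\<And>p. p \<notin> L \<Longrightarrow> \<Phi> p = \<zero>\<^bsub>E\<^esub>"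
    "\<And>p q. p \<in> L \<Longrightarrow> q \<in> L \<Longrightarrow> \<Phi> (p \<oplus>\<^bsub>R\<^esub> q) = \<Phi> p \<oplus>\<^bsub>E\<^esub> \<Phi> q"
    "\<And>p r. p \<in> L \<Longrightarrow> r \<in> carrier R \<Longrightarrow> \<Phi> (p \<otimes>\<^bsub>R\<^esub> r) = act (\<Phi> p) r"
  shows "\<Phi> \<in> HC"
  unfolding HC_def by (intro CollectI conjI ballI allI impI assms)

lemma D1_zero: "\<zero>\<^bsub>E\<^esub> \<in> D1" using opsub_zero[OF D1] .

lemma HC_carrier: "\<Phi> \<in> HC \<Longrightarrow> \<Phi> p \<in> carrier E"
  by (cases "p \<in> L") (auto simp: HC_out intro: D1_carrier HC_D1)

lemma L_carrier: "p \<in> L \<Longrightarrow> p \<in> carrier R" using L.a_subset by blast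

lemma HC_opsub: "opsub (fungrp E) {} HC"
proof (rule abelian_group.opsubI[OF abelian_group_fungrp[OF E.abelian_group_axioms]])
  show "HC \<subseteq> carrier (fungrp E)" using HC_carrier by auto
  show "\<zero>\<^bsub>fungrp E\<^esub> \<in> HC" by (rule HC_I) (auto simp: D1_zero act_zero)
  fix \<Phi> \<Psi> assume \<Phi>: "\<Phi> \<in> HC"
  have "(\<lambda>p. \<ominus>\<^bsub>E\<^esub> \<Phi> p) \<in> HC"
  proof (rule HC_I)
    show "\<ominus>\<^bsub>E\<^esub> \<Phi> (p \<otimes>\<^bsub>R\<^esub> r) = act (\<ominus>\<^bsub>E\<^esub> \<Phi> p) r" if "p \<in> L" "r \<in> carrier R" for p r
      using HC_mult[OF \<Phi> that] E.endo_neg[OF rop_endo[OF that(2)] HC_carrier[OF \<Phi>]] unfolding rop_def by simp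
  qed (use HC_D1[OF \<Phi>] HC_out[OF \<Phi>] HC_add[OF \<Phi>] E.opsub_neg[OF D1] HC_carrier[OF \<Phi>] in \<open>auto simp: E.minus_add\<close>)
  moreover have "\<Phi> \<in> carrier (fungrp E)" using HC_carrier[OF \<Phi>] by simp
  from fungrp_neg[OF E.abelian_group_axioms this]
  have "\<ominus>\<^bsub>fungrp E\<^esub> \<Phi> = (\<lambda>p. \<ominus>\<^bsub>E\<^esub> \<Phi> p)" .
  ultimately show "\<ominus>\<^bsub>fungrp E\<^esub> \<Phi> \<in> HC" by simp
  assume \<Psi>: "\<Psi> \<in> HC"
  show "\<Phi> \<oplus>\<^bsub>fungrp E\<^esub> \<Psi> \<in> HC"
  proof (rule HC_I)
    fix p q assume "p \<in> L" "q \<in> L"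
    then show "(\<Phi> \<oplus>\<^bsub>fungrp E\<^esub> \<Psi>) (p \<oplus>\<^bsub>R\<^esub> q) = (\<Phi> \<oplus>\<^bsub>fungrp E\<^esub> \<Psi>) p \<oplus>\<^bsub>E\<^esub> (\<Phi> \<oplus>\<^bsub>fungrp E\<^esub> \<Psi>) q"
      using HC_add[OF \<Phi>] HC_add[OF \<Psi>] HC_carrier[OF \<Phi>] HC_carrier[OF \<Psi>] by (simp add: E.a_ac)
  qed (use HC_D1[OF \<Phi>] HC_out[OF \<Phi>] HC_mult[OF \<Phi>] HC_D1[OF \<Psi>] HC_out[OF \<Psi>] HC_mult[OF \<Psi>]
      opsub_add[OF D1] HC_carrier[OF \<Phi>] HC_carrier[OF \<Psi>] act_add in auto)
qed simp

sublocale HG: abelian_group HG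
  unfolding HG_def by (rule abelian_group_restrict[OF abelian_group_fungrp[OF E.abelian_group_axioms] HC_opsub])

lemma HG_neg: assumes "\<Phi> \<in> HC" shows "\<ominus>\<^bsub>HG\<^esub> \<Phi> = (\<lambda>p. \<ominus>\<^bsub>E\<^esub> \<Phi> p)"
proof (rule HG.minus_equality)
  have c: "\<Phi> \<in> carrier (fungrp E)" using HC_carrier[OF assms] by simp
  show "(\<lambda>p. \<ominus>\<^bsub>E\<^esub> \<Phi> p) \<in> carrier HG"
    using abelian_group.opsub_neg[OF abelian_group_fungrp[OF E.abelian_group_axioms] HC_opsub assms]
      fungrp_neg[OF E.abelian_group_axioms c] by simp
  show "(\<lambda>p. \<ominus>\<^bsub>E\<^esub> \<Phi> p) \<oplus>\<^bsub>HG\<^esub> \<Phi> = \<zero>\<^bsub>HG\<^esub>" using HC_carrier[OF assms] by (simp add: E.l_neg)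
qed (use assms in simp)

definition cop :: "('e \<Rightarrow> 'e) \<Rightarrow> ('a \<Rightarrow> 'a) \<Rightarrow> ('a \<Rightarrow> 'e) \<Rightarrow> 'a \<Rightarrow> 'e" where
  "cop a \<gamma> \<Phi> = (\<lambda>p. if p \<in> L then a (\<Phi> (\<gamma> p)) else \<zero>\<^bsub>E\<^esub>)"

abbreviation AA where "AA \<equiv> insert id TW"
abbreviation GG where "GG \<equiv> {id, \<alpha> ^^ n, \<beta> ^^ n}"
text \<open>A commuting set containing both the twisted operators \<open>TH\<close> and the
  pointwise ones: one factor acts on values, the other on arguments. Hence the image of a polynomial
  in \<open>TH\<close> is a submodule for the pointwise action as well. \<open>id\<close> is among
  the value operators so that pure composition with \<gamma> is included.\<close>

definition OB where "OB = {cop a \<gamma> | a \<gamma>. a \<in> AA \<and> \<gamma> \<in> GG}"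
abbreviation RH where "RH \<equiv> (\<lambda>a. cop a id) ` RW"
abbreviation TH where "TH \<equiv> insert (cop xop (\<alpha> ^^ n)) RH"

lemma AA_D1: "a \<in> AA \<Longrightarrow> d \<in> D1 \<Longrightarrow> a d \<in> D1"
  using opsub_op[OF opsub_TW[OF D1]] by auto

lemma AA_endo: "a \<in> AA \<Longrightarrow> a \<in> endo E" using TW_endo endo_id[of E] by (auto simp: id_def)

lemma AA_comm: "a \<in> AA \<Longrightarrow> b \<in> AA \<Longrightarrow> d \<in> D1 \<Longrightarrow> a (b d) = b (a d)"
  using commuting1 unfolding commuting_def by auto

lemma GG_L: "\<gamma> \<in> GG \<Longrightarrow> p \<in> L \<Longrightarrow> \<gamma> p \<in> L"
proof -
  have "(\<alpha> ^^ k) p \<in> L \<and> (\<beta> ^^ k) p \<in> L" if "p \<in> L" for k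
    by (induction k) (use that L_alpha L_beta in auto)
  then show "\<gamma> \<in> GG \<Longrightarrow> p \<in> L \<Longrightarrow> \<gamma> p \<in> L" by auto
qed

lemma GG_comm: "\<gamma> \<in> GG \<Longrightarrow> \<delta> \<in> GG \<Longrightarrow> p \<in> L \<Longrightarrow> \<gamma> (\<delta> p) = \<delta> (\<gamma> p)"
  using ab_pow[OF L_carrier, of p n] ba_pow[OF L_carrier, of p n] by auto

lemma GG_hom: "\<gamma> \<in> GG \<Longrightarrow> \<gamma> \<in> ring_hom R R"
  using ring_hom_funpow[OF alpha, of 0] ring_hom_funpow[OF alpha, of n] ring_hom_funpow[OF beta, of n] by auto

lemma GG_act: "\<gamma> \<in> GG \<Longrightarrow> d \<in> D1 \<Longrightarrow> r \<in> carrier R \<Longrightarrow> act d (\<gamma> r) = act d r"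
  using D1_alpha_n D1_beta_n by auto

lemma cop_HC: assumes a: "a \<in> AA" and g: "\<gamma> \<in> GG" and \<Phi>: "\<Phi> \<in> HC" shows "cop a \<gamma> \<Phi> \<in> HC"
proof (rule HC_I)
  fix p assume p: "p \<in> L"
  note gp = GG_L[OF g p]
  show "cop a \<gamma> \<Phi> p \<in> D1" unfolding cop_def using p AA_D1[OF a HC_D1[OF \<Phi> gp]] by simp
  { fix q assume q: "q \<in> L"
    have "\<gamma> (p \<oplus>\<^bsub>R\<^esub> q) = \<gamma> p \<oplus>\<^bsub>R\<^esub> \<gamma> q" using ring_hom_add[OF GG_hom[OF g] L_carrier[OF p] L_carrier[OF q]] .
    then show "cop a \<gamma> \<Phi> (p \<oplus>\<^bsub>R\<^esub> q) = cop a \<gamma> \<Phi> p \<oplus>\<^bsub>E\<^esub> cop a \<gamma> \<Phi> q" unfolding cop_def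
      using p q HC_add[OF \<Phi> gp GG_L[OF g q]] endo_add[OF AA_endo[OF a] HC_carrier[OF \<Phi>] HC_carrier[OF \<Phi>]] by simp }
  { fix r assume r: "r \<in> carrier R"
    have "\<gamma> (p \<otimes>\<^bsub>R\<^esub> r) = \<gamma> p \<otimes>\<^bsub>R\<^esub> \<gamma> r" using ring_hom_mult[OF GG_hom[OF g] L_carrier[OF p] r] .
    then have "\<Phi> (\<gamma> (p \<otimes>\<^bsub>R\<^esub> r)) = act (\<Phi> (\<gamma> p)) r"
      using HC_mult[OF \<Phi> gp ring_hom_closed[OF GG_hom[OF g] r]] GG_act[OF g HC_D1[OF \<Phi> gp] r] by simp
    moreover have "a (act (\<Phi> (\<gamma> p)) r) = act (a (\<Phi> (\<gamma> p))) r"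
      using AA_comm[OF a _ HC_D1[OF \<Phi> gp], of "rop r"] r unfolding rop_def by auto
    ultimately show "cop a \<gamma> \<Phi> (p \<otimes>\<^bsub>R\<^esub> r) = act (cop a \<gamma> \<Phi> p) r" unfolding cop_def
      using p L.I_r_closed[OF p r] by simp }
qed (simp add: cop_def)

lemma cop_endo: assumes a: "a \<in> AA" and g: "\<gamma> \<in> GG" shows "cop a \<gamma> \<in> endo HG"
  unfolding endo_def
proof (intro CollectI conjI ballI)
  fix \<Phi> \<Psi> assume "\<Phi> \<in> carrier HG" then have \<Phi>: "\<Phi> \<in> HC" by simp
  show "cop a \<gamma> \<Phi> \<in> carrier HG" using cop_HC[OF a g \<Phi>] by simp
  assume "\<Psi> \<in> carrier HG" then have \<Psi>: "\<Psi> \<in> HC" by simp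
  show "cop a \<gamma> (\<Phi> \<oplus>\<^bsub>HG\<^esub> \<Psi>) = cop a \<gamma> \<Phi> \<oplus>\<^bsub>HG\<^esub> cop a \<gamma> \<Psi>"
    using endo_add[OF AA_endo[OF a] HC_carrier[OF \<Phi>] HC_carrier[OF \<Psi>]] by (auto simp: cop_def fun_eq_iff)
qed

lemma OB_endo: "OB \<subseteq> endo HG" unfolding OB_def using cop_endo by blast

lemma OB_comm: "commuting HG OB"
proof -
  have "cop a \<gamma> (cop b \<delta> \<Phi>) = cop b \<delta> (cop a \<gamma> \<Phi>)" if "a \<in> AA" "\<gamma> \<in> GG" "b \<in> AA" "\<delta> \<in> GG" "\<Phi> \<in> HC" for a \<gamma> b \<delta> \<Phi>
  proof
    fix p show "cop a \<gamma> (cop b \<delta> \<Phi>) p = cop b \<delta> (cop a \<gamma> \<Phi>) p"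
    proof (cases "p \<in> L")
      case True
      have "a (b (\<Phi> (\<delta> (\<gamma> p)))) = b (a (\<Phi> (\<gamma> (\<delta> p))))"
        using AA_comm[OF that(1,3) HC_D1[OF that(5) GG_L[OF that(4) GG_L[OF that(2) True]]]] GG_comm[OF that(2,4) True] by simp
      then show ?thesis using True GG_L[OF that(2) True] GG_L[OF that(4) True] by (simp add: cop_def)
    qed (simp add: cop_def)
  qed
  then show ?thesis unfolding commuting_def OB_def by force
qed

lemma cop_in_OB: "a \<in> AA \<Longrightarrow> \<gamma> \<in> GG \<Longrightarrow> cop a \<gamma> \<in> OB" unfolding OB_def by blast

lemma TH_OB: "TH \<subseteq> OB" using cop_in_OB by auto
lemma T0_OB: "(\<lambda>a. cop a id) ` TW \<subseteq> OB" using cop_in_OB by auto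
lemma TH_endo: "TH \<subseteq> endo HG" using TH_OB OB_endo by blast
lemma T0_endo: "Wc \<subseteq> TW \<Longrightarrow> (\<lambda>a. cop a id) ` Wc \<subseteq> endo HG" using T0_OB OB_endo by blast
lemma TH_comm: "commuting HG TH" using OB_comm TH_OB unfolding commuting_def by (meson subsetD)

text \<open>Killing the generators of \<open>L\<close> one after another filters the maps with
  values in \<open>C\<close>, and evaluation at the next generator embeds each factor into
  \<open>C\<close>. In effect \<open>Hz C {}\<close> sits inside finitely many copies of
  \<open>C\<close>.\<close>

definition Hz :: "'e set \<Rightarrow> 'a set \<Rightarrow> ('a \<Rightarrow> 'e) set" where
  "Hz C B = {\<Phi> \<in> HC. (\<forall>p\<in>L. \<Phi> p \<in> C) \<and> (\<forall>b\<in>B. \<Phi> b = \<zero>\<^bsub>E\<^esub>)}"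

lemma Hz_opsub:
  assumes Wc: "Wc \<subseteq> TW" and C: "opsub E Wc C" and B: "B \<subseteq> L"
  shows "opsub HG ((\<lambda>a. cop a id) ` Wc) (Hz C B)"
proof (rule HG.opsubI)
  show "Hz C B \<subseteq> carrier HG" unfolding Hz_def by auto
  show "\<zero>\<^bsub>HG\<^esub> \<in> Hz C B" using HG.zero_closed opsub_zero[OF C] unfolding Hz_def by simp
  fix \<Phi> \<Psi> assume \<Phi>: "\<Phi> \<in> Hz C B"
  then have \<Phi>H: "\<Phi> \<in> HC" unfolding Hz_def by simp
  show "\<ominus>\<^bsub>HG\<^esub> \<Phi> \<in> Hz C B" using \<Phi> HG.a_inv_closed[of \<Phi>] E.opsub_neg[OF C] HG_neg[OF \<Phi>H] unfolding Hz_def by auto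
  { assume "\<Psi> \<in> Hz C B"
    then show "\<Phi> \<oplus>\<^bsub>HG\<^esub> \<Psi> \<in> Hz C B" using \<Phi> HG.a_closed[of \<Phi> \<Psi>] opsub_add[OF C] unfolding Hz_def by auto }
  { fix w assume "w \<in> (\<lambda>a. cop a id) ` Wc"
    then obtain a where a: "a \<in> Wc" "w = cop a id" by blast
    then have "w \<Phi> \<in> HC" using cop_HC[OF _ _ \<Phi>H, of a id] Wc by auto
    moreover have "a \<zero>\<^bsub>E\<^esub> = \<zero>\<^bsub>E\<^esub>" using E.endo_zero[of a] a(1) Wc TW_endo by blast
    ultimately show "w \<Phi> \<in> Hz C B" using \<Phi> a opsub_op[OF C a(1)] B unfolding Hz_def cop_def by auto }
qed

lemma Hz_step:
  assumes Wc: "Wc \<subseteq> TW" and C: "opsub E Wc C" and B: "B \<subseteq> L" and b: "b \<in> L"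
  shows "N \<in> subs HG ((\<lambda>a. cop a id) ` Wc) (Hz C (insert b B)) (Hz C B) \<Longrightarrow> (\<lambda>\<Phi>. \<Phi> b) ` N \<in> subs E Wc {\<zero>\<^bsub>E\<^esub>} C"
    and "N \<in> subs HG ((\<lambda>a. cop a id) ` Wc) (Hz C (insert b B)) (Hz C B) \<Longrightarrow>
      N' \<in> subs HG ((\<lambda>a. cop a id) ` Wc) (Hz C (insert b B)) (Hz C B) \<Longrightarrow> N \<subseteq> N' \<Longrightarrow>
      (\<lambda>\<Phi>. \<Phi> b) ` N' = (\<lambda>\<Phi>. \<Phi> b) ` N \<Longrightarrow> N' \<subseteq> N"
proof -
  assume "N \<in> subs HG ((\<lambda>a. cop a id) ` Wc) (Hz C (insert b B)) (Hz C B)"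
  then have N: "opsub HG ((\<lambda>a. cop a id) ` Wc) N" "Hz C (insert b B) \<subseteq> N" "N \<subseteq> Hz C B" unfolding subs_def by auto
  have NH: "N \<subseteq> HC" using N(3) unfolding Hz_def by blast
  have "opsub E Wc ((\<lambda>\<Phi>. \<Phi> b) ` N)"
  proof (rule HG.image_opsub[OF E.abelian_group_axioms N(1)])
    fix w assume "w \<in> Wc"
    then show "\<exists>w'\<in>(\<lambda>a. cop a id) ` Wc. \<forall>\<Phi>\<in>N. w (\<Phi> b) = w' \<Phi> b"
      using b by (intro bexI[of _ "cop w id"]) (auto simp: cop_def)
  qed (use NH HC_carrier in auto)
  moreover have "(\<lambda>\<Phi>. \<Phi> b) ` N \<subseteq> C" using N(3) b unfolding Hz_def by auto
  ultimately show "(\<lambda>\<Phi>. \<Phi> b) ` N \<in> subs E Wc {\<zero>\<^bsub>E\<^esub>} C" unfolding subs_def using opsub_zero by blast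
next
  assume "N \<in> subs HG ((\<lambda>a. cop a id) ` Wc) (Hz C (insert b B)) (Hz C B)"
    and "N' \<in> subs HG ((\<lambda>a. cop a id) ` Wc) (Hz C (insert b B)) (Hz C B)" and NN: "N \<subseteq> N'"
    and eq: "(\<lambda>\<Phi>. \<Phi> b) ` N' = (\<lambda>\<Phi>. \<Phi> b) ` N"
  then have N: "opsub HG ((\<lambda>a. cop a id) ` Wc) N" "Hz C (insert b B) \<subseteq> N"
    and N': "opsub HG ((\<lambda>a. cop a id) ` Wc) N'" "N' \<subseteq> Hz C B" unfolding subs_def by auto
  have N'H: "N' \<subseteq> HC" using N'(2) unfolding Hz_def by blast
  show "N' \<subseteq> N"
  proof (rule HG.kernel_cancel[OF E.abelian_group_axioms N(1) N'(1) NN _ _ _ eq])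
    show "\<Phi> \<in> N" if "\<Phi> \<in> N'" "\<Phi> b = \<zero>\<^bsub>E\<^esub>" for \<Phi> using that N(2) N'(2) unfolding Hz_def by blast
  qed (use N'H HC_carrier in auto)
qed

lemma Hz_mono: "B \<subseteq> B' \<Longrightarrow> Hz C B' \<subseteq> Hz C B" unfolding Hz_def by blast

lemma ACC_Hz:
  assumes Wc: "Wc \<subseteq> TW" and C: "opsub E Wc C" and n: "noeth E Wc C" and "finite B" "B \<subseteq> L"
  shows "ACC (subs HG ((\<lambda>a. cop a id) ` Wc) (Hz C B) (Hz C {}))"
  using assms(4,5)
proof (induction B rule: finite_induct)
  case empty
  show ?case by (rule ACC_subset_single[of _ "Hz C {}"]) (auto simp: subs_def)
next
  case (insert b B)
  then have B: "B \<subseteq> L" "b \<in> L" by auto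
  have "ACC (subs HG ((\<lambda>a. cop a id) ` Wc) (Hz C (insert b B)) (Hz C B))"
    by (rule ACC_transfer[OF n, of _ "\<lambda>N. (\<lambda>\<Phi>. \<Phi> b) ` N"])
      (erule Hz_step(1)[OF Wc C B], erule image_mono, erule (3) Hz_step(2)[OF Wc C B])
  from HG.ACC_subs_trans[OF T0_endo[OF Wc] Hz_opsub[OF Wc C B(1)] Hz_opsub[OF Wc C] _ _ this insert.IH[OF B(1)]]
  show ?case using Hz_mono by blast
qed

lemma DCC_Hz:
  assumes Wc: "Wc \<subseteq> TW" and C: "opsub E Wc C" and n: "artin E Wc C" and "finite B" "B \<subseteq> L"
  shows "DCC (subs HG ((\<lambda>a. cop a id) ` Wc) (Hz C B) (Hz C {}))"
  using assms(4,5)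
proof (induction B rule: finite_induct)
  case empty
  show ?case by (rule DCC_subset_pair[of _ "Hz C {}" "Hz C {}"]) (auto simp: subs_def)
next
  case (insert b B)
  then have B: "B \<subseteq> L" "b \<in> L" by auto
  have "DCC (subs HG ((\<lambda>a. cop a id) ` Wc) (Hz C (insert b B)) (Hz C B))"
    by (rule DCC_transfer[OF n, of _ "\<lambda>N. (\<lambda>\<Phi>. \<Phi> b) ` N"])
      (erule Hz_step(1)[OF Wc C B], erule image_mono, erule (3) Hz_step(2)[OF Wc C B])
  from HG.DCC_subs_trans[OF T0_endo[OF Wc] Hz_opsub[OF Wc C B(1)] Hz_opsub[OF Wc C] _ _ this insert.IH[OF B(1)]]
  show ?case using Hz_mono by blast
qed

lemma L_least:
  assumes \<Phi>: "\<Phi> \<in> HC" and N: "opsub E RW N" and B: "B \<subseteq> L" "L = Idl\<^bsub>R\<^esub> B" and b: "\<And>b. b \<in> B \<Longrightarrow> \<Phi> b \<in> N"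
    and p: "p \<in> L"
  shows "\<Phi> p \<in> N"
proof -
  have "ideal {a \<in> L. \<Phi> a \<in> N} R"
  proof (rule R.vimage_ideal[OF R.is_cring E.abelian_group_axioms N L])
    show "\<exists>w\<in>RW. \<forall>a\<in>L. \<Phi> (a \<otimes>\<^bsub>R\<^esub> r) = w (\<Phi> a)" if "r \<in> carrier R" for r
      using that HC_mult[OF \<Phi> _ that] by (intro bexI[of _ "rop r"]) (auto simp: rop_def)
  qed (use HC_carrier[OF \<Phi>] HC_add[OF \<Phi>] in auto)
  moreover have "B \<subseteq> {a \<in> L. \<Phi> a \<in> N}" using B b by blast
  ultimately have "L \<subseteq> {a \<in> L. \<Phi> a \<in> N}" using R.genideal_minimal B(2) by blast
  then show ?thesis using p by blast
qed

lemma Hz_zero: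
  assumes B: "B \<subseteq> L" "L = Idl\<^bsub>R\<^esub> B" shows "Hz C B \<subseteq> {\<zero>\<^bsub>HG\<^esub>}"
proof
  fix \<Phi> assume "\<Phi> \<in> Hz C B"
  then have \<Phi>: "\<Phi> \<in> HC" "\<And>b. b \<in> B \<Longrightarrow> \<Phi> b \<in> {\<zero>\<^bsub>E\<^esub>}" unfolding Hz_def by auto
  have "\<Phi> p = \<zero>\<^bsub>E\<^esub>" for p
    using L_least[OF \<Phi>(1) E.opsub_bot[OF RW_endo] B \<Phi>(2), of p] HC_out[OF \<Phi>(1), of p] by (cases "p \<in> L") auto
  then show "\<Phi> \<in> {\<zero>\<^bsub>HG\<^esub>}" by auto
qed

lemma L_gens: obtains B where "finite B" "B \<subseteq> L" "L = Idl\<^bsub>R\<^esub> B"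
proof -
  obtain B where "B \<subseteq> carrier R" "finite B" "L = Idl\<^bsub>R\<^esub> B" using finetely_gen[OF L] by blast
  then show thesis using that R.genideal_self by metis
qed

lemma noeth_Hz:
  assumes Wc: "Wc \<subseteq> TW" and C: "opsub E Wc C" and n: "noeth E Wc C"
  shows "noeth HG ((\<lambda>a. cop a id) ` Wc) (Hz C {})"
proof -
  obtain B where B: "finite B" "B \<subseteq> L" "L = Idl\<^bsub>R\<^esub> B" by (rule L_gens)
  show ?thesis
    by (rule ACC_subset[OF ACC_Hz[OF Wc C n B(1,2)]]) (rule subs_mono, use Hz_zero[OF B(2,3)] in auto)
qed

lemma artin_Hz:
  assumes Wc: "Wc \<subseteq> TW" and C: "opsub E Wc C" and n: "artin E Wc C"
  shows "artin HG ((\<lambda>a. cop a id) ` Wc) (Hz C {})"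
proof -
  obtain B where B: "finite B" "B \<subseteq> L" "L = Idl\<^bsub>R\<^esub> B" by (rule L_gens)
  show ?thesis
    by (rule DCC_subset[OF DCC_Hz[OF Wc C n B(1,2)]]) (rule subs_mono, use Hz_zero[OF B(2,3)] in auto)
qed

lemma Hz_D1: "Hz D1 {} = HC" unfolding Hz_def using HC_D1 by blast

end

context hom_layer begin

lemma cop_split:
  assumes "\<gamma> \<in> GG" shows "cop a \<gamma> \<Phi> = cop a id (cop id \<gamma> \<Phi>)"
  using GG_L[OF assms] by (auto simp: cop_def fun_eq_iff)

lemma HC_opsub_OB: "opsub HG OB HC" using HG.opsub_top[OF OB_endo] by simp

text \<open>The maps with values in a finitely generated \<open>R\<close>-submodule \<open>M\<close> of \<open>D1\<close> form a Noetherian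
  \<open>R\<close>-module which is stable under composition with \<open>\<alpha>\<^sup>n\<close> and its inverse; this replaces an
  integrality argument for \<open>\<alpha>\<^sup>n\<close>.\<close>

lemma noeth_TH: "noeth HG TH HC"
proof -
  have "noeth HG ((\<lambda>a. cop a id) ` TW) (Hz D1 {})"
    by (rule noeth_Hz[OF subset_refl opsub_TW[OF D1] noeth_D1])
  then have "noeth HG OB HC" unfolding Hz_D1 by (rule ACC_subset[OF _ subs_antimono_ops[OF T0_OB]])
  from HG.noeth_fg[OF OB_endo HC_opsub_OB this]
  obtain A' where A': "finite A'" "A' \<subseteq> HC" "gen HG OB A' = HC" .
  obtain B where B: "finite B" "B \<subseteq> L" "L = Idl\<^bsub>R\<^esub> B" by (rule L_gens)
  \<comment> \<open>The finitely many values of the generating maps \<open>A'\<close> at the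
    generators \<open>B\<close> of \<open>L\<close>. By linearity all values of the maps in
    \<open>A'\<close> lie in the R-module spanned by them.\<close>
  define S where "S = (\<lambda>(\<Phi>, b). \<Phi> b) ` (A' \<times> B)"
  have finS: "finite S" unfolding S_def using A'(1) B(1) by blast
  have SD: "S \<subseteq> D1" unfolding S_def using A'(2) B(2) HC_D1 by auto
  have Sc: "S \<subseteq> carrier E" using SD opsub_sub[OF D1] by blast
  define M where "M = gen E RW S"
  have M: "opsub E RW M" unfolding M_def by (rule E.opsub_gen[OF RW_endo Sc])
  have nM: "noeth E RW M" unfolding M_def by (rule noeth_fin_gen[OF finS Sc])
  have RT: "RW \<subseteq> TW" by blast
  have HM: "opsub HG RH (Hz M {})" by (rule Hz_opsub[OF RT M]) simp
  have nHM: "noeth HG RH (Hz M {})" by (rule noeth_Hz[OF RT M nM])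
  have A'M: "A' \<subseteq> Hz M {}"
  proof
    fix \<Phi> assume \<Phi>: "\<Phi> \<in> A'"
    have "\<Phi> b \<in> M" if "b \<in> B" for b
    proof -
      have "\<Phi> b \<in> S" unfolding S_def using \<Phi> that by force
      then show ?thesis unfolding M_def by (rule gen_incl1)
    qed
    then show "\<Phi> \<in> Hz M {}" unfolding Hz_def using \<Phi> A'(2) L_least[OF _ M B(2,3), of \<Phi>] by blast
  qed
  define K where "K = gen HG TH (Hz M {})"
  have RHe: "RH \<subseteq> endo HG" using TH_endo by blast
  have xxe: "cop xop (\<alpha> ^^ n) \<in> endo HG" using TH_endo by blast
  have comm: "cop xop (\<alpha> ^^ n) (w \<Phi>) = w (cop xop (\<alpha> ^^ n) \<Phi>)" if "w \<in> RH" "\<Phi> \<in> carrier HG" for w \<Phi>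
    using TH_comm that unfolding commuting_def by blast
  have nK: "noeth HG TH K" unfolding K_def
  proof (rule noeth_gen_insert[OF HG.abelian_group_axioms RHe xxe _ _ HM nHM])
    fix w assume w: "w \<in> RH"
    show "\<exists>w'\<in>RH. \<forall>a\<in>carrier HG. cop xop (\<alpha> ^^ n) (w a) = w' (cop xop (\<alpha> ^^ n) a)"
      by (rule bexI[OF _ w]) (use comm[OF w] in blast)
    show "\<exists>w'\<in>RH. \<forall>a\<in>carrier HG. w (cop xop (\<alpha> ^^ n) a) = cop xop (\<alpha> ^^ n) (w' a)"
      by (rule bexI[OF _ w]) (use comm[OF w] in simp)
  qed
  have HMc: "Hz M {} \<subseteq> carrier HG" using opsub_sub[OF HM] .
  have K: "opsub HG TH K" unfolding K_def by (rule HG.opsub_gen[OF TH_endo HMc])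
  have KH: "K \<subseteq> HC" using opsub_sub[OF K] by simp
  \<comment> \<open>Composition with \<gamma> changes arguments only, so it keeps the values in
    \<open>M\<close>; as it also commutes with \<open>TH\<close>, it preserves the module generated
    by \<open>Hz M {}\<close>.\<close>
  have Kg: "cop id \<gamma> \<Phi> \<in> K" if g: "\<gamma> \<in> GG" and \<Phi>: "\<Phi> \<in> K" for \<gamma> \<Phi>
  proof -
    have ge: "cop id \<gamma> \<in> endo HG" using cop_endo g by blast
    have go: "cop id \<gamma> \<in> OB" using cop_in_OB g by blast
    have "opsub HG TH {\<Phi> \<in> K. cop id \<gamma> \<Phi> \<in> K}"
    proof (rule HG.preimage_opsub[OF HG.abelian_group_axioms K K])
      fix w assume w: "w \<in> TH"
      have "cop id \<gamma> (w a) = w (cop id \<gamma> a)" if "a \<in> K" for a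
        using OB_comm go subsetD[OF TH_OB w] that KH unfolding commuting_def by auto
      then show "\<exists>w'\<in>TH. \<forall>a\<in>K. cop id \<gamma> (w a) = w' (cop id \<gamma> a)" using w by blast
    next
      show "cop id \<gamma> a \<in> carrier HG" if "a \<in> K" for a using endo_closed[OF ge] that KH by auto
      show "cop id \<gamma> (a \<oplus>\<^bsub>HG\<^esub> b) = cop id \<gamma> a \<oplus>\<^bsub>HG\<^esub> cop id \<gamma> b" if "a \<in> K" "b \<in> K" for a b
        using endo_add[OF ge, of a b] that KH by auto
    qed
    moreover have "Hz M {} \<subseteq> {\<Phi> \<in> K. cop id \<gamma> \<Phi> \<in> K}"
    proof
      fix \<Psi> assume \<Psi>: "\<Psi> \<in> Hz M {}"
      have inK: "\<Xi> \<in> K" if "\<Xi> \<in> Hz M {}" for \<Xi> using gen_incl1[OF that, of HG TH] unfolding K_def .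
      have "cop id \<gamma> \<Psi> \<in> HC" using cop_HC[OF _ g, of id \<Psi>] \<Psi> unfolding Hz_def by auto
      moreover have "cop id \<gamma> \<Psi> p \<in> M" if "p \<in> L" for p
        using \<Psi> that GG_L[OF g that] unfolding Hz_def cop_def by simp
      ultimately have "cop id \<gamma> \<Psi> \<in> Hz M {}" unfolding Hz_def by simp
      then show "\<Psi> \<in> {\<Phi> \<in> K. cop id \<gamma> \<Phi> \<in> K}" using inK \<Psi> by blast
    qed
    ultimately have "K \<subseteq> {\<Phi> \<in> K. cop id \<gamma> \<Phi> \<in> K}" unfolding K_def by (rule gen_min)
    then show ?thesis using \<Phi> by blast
  qed
  have Ka: "cop a id \<Phi> \<in> K" if a: "a \<in> AA" and \<Phi>: "\<Phi> \<in> K" for a \<Phi>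
  proof -
    consider "a = id" | "a = xop" | "a \<in> RW" using a by blast
    then show ?thesis
    proof cases
      case 1 then show ?thesis using Kg[OF _ \<Phi>, of id] by simp
    next
      case 2
      \<comment> \<open>Undoing the twist: the pointwise x is the twisted x applied after
        composition with \<beta>^n. This makes \<open>K\<close> stable under all of
        \<open>OB\<close>, so that it contains everything generated by \<open>A'\<close>.\<close>
      have "cop xop id \<Phi> = cop xop (\<alpha> ^^ n) (cop id (\<beta> ^^ n) \<Phi>)"
      proof
        fix p show "cop xop id \<Phi> p = cop xop (\<alpha> ^^ n) (cop id (\<beta> ^^ n) \<Phi>) p"
          using GG_L[of "\<alpha> ^^ n" p] ba_pow[OF L_carrier, of p n] by (auto simp: cop_def)
      qed
      moreover have "cop id (\<beta> ^^ n) \<Phi> \<in> K" using Kg[OF _ \<Phi>] by blast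
      ultimately show ?thesis using opsub_op[OF K, of "cop xop (\<alpha> ^^ n)"] 2 by simp
    next
      case 3 then show ?thesis using opsub_op[OF K _ \<Phi>, of "cop a id"] by blast
    qed
  qed
  have "w \<Phi> \<in> K" if "w \<in> OB" "\<Phi> \<in> K" for w \<Phi>
  proof -
    obtain a \<gamma> where w: "w = cop a \<gamma>" "a \<in> AA" "\<gamma> \<in> GG" using \<open>w \<in> OB\<close> unfolding OB_def by blast
    have "cop a \<gamma> \<Phi> \<in> K" by (subst cop_split[OF w(3)]) (rule Ka[OF w(2) Kg[OF w(3) that(2)]])
    then show ?thesis using w(1) by simp
  qed
  then have "opsub HG OB K" using K unfolding opsub_def by blast
  moreover have "A' \<subseteq> K" using A'M gen_incl[of "Hz M {}" HG TH] unfolding K_def by blast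
  ultimately have "HC \<subseteq> K" using gen_min A'(3) by blast
  then show ?thesis by (rule ACC_subset[OF nK subs_mono[OF subset_refl]])
qed

text \<open>For t polynomial in the twisted operators the chain \<open>t^k HC\<close> consists of
  submodules for the pointwise action, whose descending chain condition is inherited from
  \<open>D1\<close>. So it stabilises, and the Noetherian property of the twisted action supplies an
  inverse of t on the stable image. The nilpotency exponent is 1, because the argument runs on
  \<open>HC\<close> itself and not on a smaller module.\<close>

theorem artin_TH: "artin HG TH HC"
proof -
  have art0: "artin HG ((\<lambda>a. cop a id) ` TW) HC"
    using artin_Hz[OF subset_refl opsub_TW[OF D1] artin_D1] unfolding Hz_D1 .
  have HCT: "opsub HG TH HC" by (rule opsub_antimono[OF HC_opsub_OB TH_OB])
  have "artin HG TH (carrier HG)"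
  proof (rule HG.artin_of_pi_regular[OF TH_endo TH_comm])
    show "noeth HG TH (carrier HG)" using noeth_TH by simp
    fix t assume t: "t \<in> alg HG TH"
    note tO = alg_mono[OF TH_OB t]
    have tk: "opsub HG ((\<lambda>a. cop a id) ` TW) ((t ^^ k) ` HC)" for k
      by (rule opsub_antimono[OF HG.image_alg_opsub[OF OB_endo OB_comm alg_pow[OF tO] HC_opsub_OB] T0_OB])
    obtain k where k: "\<And>i. i \<ge> k \<Longrightarrow> (t ^^ i) ` HC = (t ^^ k) ` HC"
    proof (rule DCC_D[OF art0, of "\<lambda>i. (t ^^ i) ` HC"])
      show "(t ^^ i) ` HC \<in> subs HG ((\<lambda>a. cop a id) ` TW) {\<zero>\<^bsub>HG\<^esub>} HC" for i
        using tk[of i] opsub_zero[OF tk[of i]] HG.alg_opsub[OF HCT alg_pow[OF t]] unfolding subs_def by blast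
      show "(t ^^ Suc i) ` HC \<subseteq> (t ^^ i) ` HC" for i
        using HG.alg_opsub[OF HCT t] by (auto simp: funpow_swap1)
    qed blast
    have "(t ^^ k) ` HC \<subseteq> (t ^^ Suc k) ` HC" using k[of "Suc k"] by simp
    from HG.stable_image_inverse[OF TH_endo TH_comm HCT noeth_TH t this]
    obtain u where u: "u \<in> alg HG TH" "\<forall>m\<in>HC. (t ^^ k) m = (t ^^ k) (t (u m))" by blast
    have "(t ^^ k) m \<ominus>\<^bsub>HG\<^esub> (t ^^ k) (t (u m)) = \<zero>\<^bsub>HG\<^esub>" if m: "m \<in> HC" for m
    proof -
      have "(t ^^ k) m \<in> carrier HG" using HG.alg_closed[OF TH_endo alg_pow[OF t]] m by simp
      then have "(t ^^ k) m \<ominus>\<^bsub>HG\<^esub> (t ^^ k) m = \<zero>\<^bsub>HG\<^esub>" unfolding a_minus_def by (rule HG.r_neg)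
      then show ?thesis using bspec[OF u(2) m] by simp
    qed
    then have "\<forall>m\<in>carrier HG. ((\<lambda>m. (t ^^ k) m \<ominus>\<^bsub>HG\<^esub> (t ^^ k) (t (u m))) ^^ 1) m = \<zero>\<^bsub>HG\<^esub>" by simp
    then show "\<exists>u\<in>alg HG TH. \<exists>k l. \<forall>m\<in>carrier HG. ((\<lambda>m. (t ^^ k) m \<ominus>\<^bsub>HG\<^esub> (t ^^ k) (t (u m))) ^^ l) m = \<zero>\<^bsub>HG\<^esub>"
      using u(1) by blast
  qed
  then show ?thesis by simp
qed

text \<open>Send e to the linear map that takes p to e p; the kernel is \<open>Ann L\<close> within
  \<open>D\<close>. The identity (\<theta>^n e) p = \<theta>^n (e \<alpha>^n(p)) shows that
  \<theta>^n corresponds to the twisted operator and is the origin of the twist.\<close>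

lemma DCC_layer:
  assumes D: "\<And>e p. e \<in> D \<Longrightarrow> p \<in> L \<Longrightarrow> act e p \<in> D1" and DE: "D \<subseteq> carrier E"
  shows "DCC (subs E (insert \<theta> RW) (Ann L) D)"
proof -
  define \<psi> where "\<psi> e = (\<lambda>p. if p \<in> L then act e p else \<zero>\<^bsub>E\<^esub>)" for e
  have \<psi>H: "\<psi> e \<in> HC" if e: "e \<in> D" for e
  proof (rule HC_I)
    show "\<psi> e p \<in> D1" if "p \<in> L" for p using D[OF e that] that by (simp add: \<psi>_def)
    have ec: "e \<in> carrier E" using e DE by blast
    show "\<psi> e (p \<oplus>\<^bsub>R\<^esub> q) = \<psi> e p \<oplus>\<^bsub>E\<^esub> \<psi> e q" if "p \<in> L" "q \<in> L" for p q
      using that act_radd[OF ec] L_carrier by (simp add: \<psi>_def)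
    show "\<psi> e (p \<otimes>\<^bsub>R\<^esub> r) = act (\<psi> e p) r" if "p \<in> L" "r \<in> carrier R" for p r
      using that act_mult[OF ec] L_carrier L.I_r_closed by (simp add: \<psi>_def)
  qed (simp add: \<psi>_def)
  show ?thesis
  proof (rule DCC_transfer[OF artin_TH, of _ "\<lambda>N. \<psi> ` N"])
    fix N assume "N \<in> subs E (insert \<theta> RW) (Ann L) D"
    then have N: "opsub E (insert \<theta> RW) N" "N \<subseteq> D" unfolding subs_def by auto
    note Nc = opsub_carrier[OF N(1)]
    have "opsub HG TH (\<psi> ` N)"
    proof (rule E.image_opsub[OF HG.abelian_group_axioms opsub_TW[OF N(1)]])
      show "\<psi> a \<in> carrier HG" if "a \<in> N" for a using \<psi>H that N(2) by auto
      show "\<psi> (a \<oplus>\<^bsub>E\<^esub> b) = \<psi> a \<oplus>\<^bsub>HG\<^esub> \<psi> b" if "a \<in> N" "b \<in> N" for a b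
        using act_add[OF Nc[OF that(1)] Nc[OF that(2)]] L_carrier by (auto simp: \<psi>_def fun_eq_iff)
      fix w' assume "w' \<in> TH"
      then consider "w' = cop xop (\<alpha> ^^ n)" | r where "r \<in> carrier R" "w' = cop (rop r) id" by blast
      then show "\<exists>w\<in>TW. \<forall>a\<in>N. w' (\<psi> a) = \<psi> (w a)"
      proof cases
        case 1
        have "w' (\<psi> a) = \<psi> (xop a)" if a: "a \<in> N" for a
          using act_theta_pow[OF Nc[OF a] L_carrier, of _ n] GG_L[of "\<alpha> ^^ n"]
          by (auto simp: \<psi>_def fun_eq_iff 1 cop_def xop_def)
        then show ?thesis by blast
      next
        case 2
        have "w' (\<psi> a) = \<psi> (rop r a)" if a: "a \<in> N" for a
          using act_comm[OF Nc[OF a] L_carrier 2(1)] by (auto simp: \<psi>_def fun_eq_iff 2(2) cop_def rop_def)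
        then show ?thesis using 2(1) by blast
      qed
    qed
    moreover have "\<psi> ` N \<subseteq> HC" using \<psi>H N(2) by blast
    ultimately show "\<psi> ` N \<in> subs HG TH {\<zero>\<^bsub>HG\<^esub>} HC" unfolding subs_def using opsub_zero by blast
  next
    fix N N' assume "N \<in> subs E (insert \<theta> RW) (Ann L) D" "N' \<in> subs E (insert \<theta> RW) (Ann L) D" and NN: "N \<subseteq> N'"
      and eq: "\<psi> ` N' = \<psi> ` N"
    then have N: "opsub E (insert \<theta> RW) N" "Ann L \<subseteq> N" and N': "opsub E (insert \<theta> RW) N'" and ND: "N' \<subseteq> D" unfolding subs_def by auto
    note Nc' = opsub_carrier[OF N']
    show "N' \<subseteq> N"
    proof (rule E.kernel_cancel[OF HG.abelian_group_axioms N(1) N' NN _ _ _ eq])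
      show "\<psi> a \<in> carrier HG" if "a \<in> N'" for a using \<psi>H ND that by auto
      show "\<psi> (a \<oplus>\<^bsub>E\<^esub> b) = \<psi> a \<oplus>\<^bsub>HG\<^esub> \<psi> b" if "a \<in> N'" "b \<in> N'" for a b
        using act_add[OF Nc'[OF that(1)] Nc'[OF that(2)]] L_carrier by (auto simp: \<psi>_def fun_eq_iff)
      show "a \<in> N" if a: "a \<in> N'" "\<psi> a = \<zero>\<^bsub>HG\<^esub>" for a
      proof -
        have "act a p = \<zero>\<^bsub>E\<^esub>" if "p \<in> L" for p using fun_cong[OF a(2), of p] that by (simp add: \<psi>_def)
        then show ?thesis using N(2) Nc'[OF a(1)] unfolding Ann_def by blast
      qed
    qed
  qed auto
qed

end

section \<open>Assembling the layers of the extension\<close>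

context essential_simple begin

theorem artin_E: "artin E (insert \<theta> RW) (carrier E)"
proof -
  have o: "opsub E (insert \<theta> RW) (Ann (Pp i))" for i by (rule Ann_opsub[OF Pp_sub Pp_alpha])
  have inc: "Ann (Pp i) \<subseteq> Ann (Pp (Suc i))" for i
  proof -
    have "Pp (Suc i) \<subseteq> Pp i"
    proof (rule Pp_least[OF Pp_ideal])
      fix a p assume "a \<in> Pp i" "p \<in> P"
      then show "a \<otimes>\<^bsub>R\<^esub> p \<in> Pp i" using ideal.I_r_closed[OF Pp_ideal] P_sub by blast
    qed
    then show ?thesis unfolding Ann_def by blast
  qed
  have layer: "DCC (subs E (insert \<theta> RW) (Ann (Pp i)) (Ann (Pp (Suc i))))" for i
  proof -
    interpret H: hom_layer R E act \<theta> \<alpha> \<beta> P n A V "Pp i"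
      by (rule hom_layer.intro[OF essential_simple_axioms], rule hom_layer_axioms.intro)
        (rule Pp_ideal, erule Pp_alpha, erule Pp_beta)
    show ?thesis
    proof (rule H.DCC_layer)
      fix e p assume ep: "e \<in> Ann (Pp (Suc i))" "p \<in> Pp i"
      then have c: "e \<in> carrier E" "p \<in> carrier R" using Pp_sub unfolding Ann_def by auto
      have "act (act e p) q = \<zero>\<^bsub>E\<^esub>" if q: "q \<in> P" for q
        using act_mult[OF c, of q] Pp_prod[OF ep(2) q] ep(1) q P_sub unfolding Ann_def by auto
      then show "act e p \<in> D1" unfolding D1_def Ann_def using act_closed[OF c] by simp
    qed (auto simp: Ann_def)
  qed
  have "artin E (insert \<theta> RW) (Ann (Pp i))" for i
  proof (induction i)
    case 0
    have "Ann (Pp 0) \<subseteq> {\<zero>\<^bsub>E\<^esub>}" unfolding Ann_def using act_one R.one_closed by (auto, metis)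
    then have "subs E (insert \<theta> RW) {\<zero>\<^bsub>E\<^esub>} (Ann (Pp 0)) \<subseteq> {{\<zero>\<^bsub>E\<^esub>}, {\<zero>\<^bsub>E\<^esub>}}" unfolding subs_def by blast
    then show ?case by (rule DCC_subset_pair)
  next
    case (Suc i)
    show ?case
      using E.DCC_subs_trans[OF theta_RW_endo o o _ inc Suc layer] opsub_zero[OF o] by blast
  qed
  then show ?thesis using Ann_Pp_exhaust by metis
qed

end

section \<open>Skew polynomial rings\<close>

text \<open>\<open>ringS\<close> is supplied by the module V: \<open>right_module\<close> includes
  that S is a ring.\<close>

locale skew_poly = R: cring R + noetherian_ring R
  for R :: "('a, 'b) ring_scheme" (structure) +
  fixes \<alpha> :: "'a \<Rightarrow> 'a"
  assumes iso: "\<alpha> \<in> ring_iso R R" and ringS: "ring (skew_poly_ring R \<alpha>)"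
begin

abbreviation S where "S \<equiv> skew_poly_ring R \<alpha>"
abbreviation c where "c \<equiv> skew_const R"
definition th :: "nat \<Rightarrow> 'a" where "th = (\<lambda>n. if n = 1 then \<one> else \<zero>)"
definition \<beta> where "\<beta> = inv_into (carrier R) \<alpha>"

sublocale S: ring S by (rule ringS)

lemma S_carrier: "f \<in> carrier S \<longleftrightarrow> (\<forall>n. f n \<in> carrier R) \<and> finite {n. f n \<noteq> \<zero>}"
  and S_mult: "f \<otimes>\<^bsub>S\<^esub> g = (\<lambda>n. finsum R (\<lambda>i. f i \<otimes> (\<alpha> ^^ i) (g (n - i))) {..n})"
  and S_add: "f \<oplus>\<^bsub>S\<^esub> g = (\<lambda>n. f n \<oplus> g n)"
  and S_zero: "\<zero>\<^bsub>S\<^esub> = (\<lambda>n. \<zero>)" and S_one: "\<one>\<^bsub>S\<^esub> = c \<one>"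
  unfolding skew_poly_ring_def skew_const_def by simp_all

lemma S_coeff: "f \<in> carrier S \<Longrightarrow> f n \<in> carrier R" by (simp add: S_carrier)

lemma c_closed: "r \<in> carrier R \<Longrightarrow> c r \<in> carrier S"
  unfolding S_carrier skew_const_def by (auto intro: finite_subset[of _ "{0}"])

lemma th_closed: "th \<in> carrier S"
  unfolding S_carrier th_def by (auto intro: finite_subset[of _ "{1}"])

lemma alpha_hom: "\<alpha> \<in> ring_hom R R" and alpha_bij: "bij_betw \<alpha> (carrier R) (carrier R)"
  using iso unfolding ring_iso_def by auto

lemma beta_hom: "\<beta> \<in> ring_hom R R"
  using ring_iso_set_sym[OF R.ring_axioms iso] unfolding \<beta>_def ring_iso_def by blast

lemma alpha_beta: "r \<in> carrier R \<Longrightarrow> \<alpha> (\<beta> r) = r" and beta_alpha: "r \<in> carrier R \<Longrightarrow> \<beta> (\<alpha> r) = r"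
  using alpha_bij unfolding \<beta>_def bij_betw_def by (auto simp: f_inv_into_f)

lemma alpha_pow_hom: "\<alpha> ^^ k \<in> ring_hom R R" by (rule ring_hom_funpow[OF alpha_hom])

lemma alpha_pow_c: "r \<in> carrier R \<Longrightarrow> (\<alpha> ^^ k) r \<in> carrier R" by (rule ring_hom_closed[OF alpha_pow_hom])

lemma alpha_pow_zero: "(\<alpha> ^^ k) \<zero> = \<zero>"
  using ring_hom_zero[OF alpha_pow_hom R.ring_axioms R.ring_axioms] .

lemma finsum_single:
  assumes "finite A" "i \<in> A" "\<And>j. j \<in> A \<Longrightarrow> j \<noteq> i \<Longrightarrow> f j = \<zero>" "f i \<in> carrier R"
  shows "finsum R f A = f i"
proof -
  have "finsum R f A = finsum R (\<lambda>j. if i = j then f j else \<zero>) A"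
    by (rule R.finsum_cong') (use assms in auto)
  also have "\<dots> = f i" by (rule R.finsum_singleton[OF assms(2,1)]) (use assms in \<open>auto, metis R.zero_closed\<close>)
  finally show ?thesis .
qed

lemma mult_th: assumes f: "f \<in> carrier S" shows "f \<otimes>\<^bsub>S\<^esub> th = (\<lambda>n. case n of 0 \<Rightarrow> \<zero> | Suc m \<Rightarrow> f m)"
proof
  fix n
  show "(f \<otimes>\<^bsub>S\<^esub> th) n = (case n of 0 \<Rightarrow> \<zero> | Suc m \<Rightarrow> f m)"
  proof (cases n)
    case 0
    then show ?thesis using S_coeff[OF f] by (simp add: S_mult th_def alpha_pow_zero)
  next
    case (Suc m)
    have "finsum R (\<lambda>i. f i \<otimes> (\<alpha> ^^ i) (th (n - i))) {..n} = f m \<otimes> (\<alpha> ^^ m) (th (n - m))"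
      by (rule finsum_single)
        (use Suc S_coeff[OF f] ring_hom_one[OF alpha_pow_hom] in \<open>auto simp: th_def alpha_pow_zero\<close>)
    then show ?thesis using Suc S_coeff[OF f] ring_hom_one[OF alpha_pow_hom] by (simp add: S_mult th_def)
  qed
qed

lemma mult_c: assumes f: "f \<in> carrier S" and r: "r \<in> carrier R" shows "f \<otimes>\<^bsub>S\<^esub> c r = (\<lambda>n. f n \<otimes> (\<alpha> ^^ n) r)"
proof
  fix n
  have "finsum R (\<lambda>i. f i \<otimes> (\<alpha> ^^ i) (c r (n - i))) {..n} = f n \<otimes> (\<alpha> ^^ n) (c r (n - n))"
    by (rule finsum_single) (use S_coeff[OF f] alpha_pow_c[OF r] in \<open>auto simp: skew_const_def alpha_pow_zero\<close>)
  then show "(f \<otimes>\<^bsub>S\<^esub> c r) n = f n \<otimes> (\<alpha> ^^ n) r" by (simp add: S_mult skew_const_def)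
qed

lemma c_mult: assumes f: "f \<in> carrier S" and r: "r \<in> carrier R" shows "c r \<otimes>\<^bsub>S\<^esub> f = (\<lambda>n. r \<otimes> f n)"
proof
  fix n
  have "finsum R (\<lambda>i. c r i \<otimes> (\<alpha> ^^ i) (f (n - i))) {..n} = c r 0 \<otimes> (\<alpha> ^^ 0) (f (n - 0))"
    by (rule finsum_single) (use S_coeff[OF f] r alpha_pow_c[OF S_coeff[OF f]] in \<open>auto simp: skew_const_def\<close>)
  then show "(c r \<otimes>\<^bsub>S\<^esub> f) n = r \<otimes> f n" by (simp add: S_mult skew_const_def)
qed

lemma th_c: assumes r: "r \<in> carrier R" shows "th \<otimes>\<^bsub>S\<^esub> c r = c (\<alpha> r) \<otimes>\<^bsub>S\<^esub> th"
proof -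
  have a: "\<alpha> r \<in> carrier R" using ring_hom_closed[OF alpha_hom r] .
  show ?thesis unfolding mult_c[OF th_closed r] c_mult[OF th_closed a]
    using r a alpha_pow_c[OF r] by (auto simp: th_def fun_eq_iff)
qed

lemma c_add: "r \<in> carrier R \<Longrightarrow> s \<in> carrier R \<Longrightarrow> c (r \<oplus> s) = c r \<oplus>\<^bsub>S\<^esub> c s"
  unfolding S_add skew_const_def by (auto simp: fun_eq_iff)

lemma c_prod: "r \<in> carrier R \<Longrightarrow> s \<in> carrier R \<Longrightarrow> c (r \<otimes> s) = c r \<otimes>\<^bsub>S\<^esub> c s"
  unfolding c_mult[OF c_closed] by (auto simp: fun_eq_iff skew_const_def)

lemma c_zero: "c \<zero> = \<zero>\<^bsub>S\<^esub>" unfolding S_zero skew_const_def by auto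

text \<open>Horner's scheme. Coefficients stand on the left, so right multiplication by
  \<open>th\<close> is a pure shift without a twist, and every skew polynomial is reached from
  constants by additions and right multiplications by \<open>th\<close>.\<close>

lemma decompose: assumes f: "f \<in> carrier S"
  shows "(\<lambda>n. f (Suc n)) \<in> carrier S" "f = c (f 0) \<oplus>\<^bsub>S\<^esub> (\<lambda>n. f (Suc n)) \<otimes>\<^bsub>S\<^esub> th"
proof -
  have "{n. f (Suc n) \<noteq> \<zero>} = Suc -` {n. f n \<noteq> \<zero>}" by auto
  then have "finite {n. f (Suc n) \<noteq> \<zero>}" using f finite_vimageI[of "{n. f n \<noteq> \<zero>}" Suc] unfolding S_carrier by simp
  then show g: "(\<lambda>n. f (Suc n)) \<in> carrier S" using S_coeff[OF f] unfolding S_carrier by simp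
  show "f = c (f 0) \<oplus>\<^bsub>S\<^esub> (\<lambda>n. f (Suc n)) \<otimes>\<^bsub>S\<^esub> th"
    unfolding mult_th[OF g] S_add using S_coeff[OF f] by (auto simp: fun_eq_iff skew_const_def split: nat.split)
qed

lemma S_induct:
  assumes f: "f \<in> carrier S" and const: "\<And>r. r \<in> carrier R \<Longrightarrow> c r \<in> T"
    and add: "\<And>s t. s \<in> carrier S \<Longrightarrow> t \<in> carrier S \<Longrightarrow> s \<in> T \<Longrightarrow> t \<in> T \<Longrightarrow> s \<oplus>\<^bsub>S\<^esub> t \<in> T"
    and th: "\<And>s. s \<in> carrier S \<Longrightarrow> s \<in> T \<Longrightarrow> s \<otimes>\<^bsub>S\<^esub> th \<in> T"
  shows "f \<in> T"
proof -
  have "f \<in> T" if "f \<in> carrier S" "\<And>i. i \<ge> k \<Longrightarrow> f i = \<zero>" for k f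
    using that
  proof (induction k arbitrary: f)
    case 0
    then have "f = c \<zero>" by (auto simp: fun_eq_iff skew_const_def)
    then show ?case using const[of \<zero>] by simp
  next
    case (Suc k)
    note d = decompose[OF Suc.prems(1)]
    have g: "(\<lambda>n. f (Suc n)) \<in> T" using Suc.IH[OF d(1)] Suc.prems(2) by simp
    have f0: "f 0 \<in> carrier R" using S_coeff[OF Suc.prems(1)] .
    show ?case
      by (subst d(2)) (rule add[OF c_closed[OF f0] S.m_closed[OF d(1) th_closed] const[OF f0] th[OF d(1) g]])
  qed
  moreover obtain k where "\<And>i. i \<ge> k \<Longrightarrow> f i = \<zero>"
  proof -
    have "finite {n. f n \<noteq> \<zero>}" using f unfolding S_carrier by blast
    then obtain k where "{n. f n \<noteq> \<zero>} \<subseteq> {..<k}" using finite_nat_iff_bounded by blast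
    then show thesis using that[of k] by (meson lessThan_iff linorder_not_less mem_Collect_eq subsetD)
  qed
  ultimately show ?thesis using f by blast
qed

end

section \<open>Modules over the skew polynomial ring as groups with operators\<close>

locale skew_poly_module = skew_poly R \<alpha>
  for R :: "('a, 'b) ring_scheme" (structure) and \<alpha> +
  fixes E :: "(nat \<Rightarrow> 'a, 'e, 'f) rmod_scheme"
  assumes rmod: "right_module (skew_poly_ring R \<alpha>) E"
begin

abbreviation act where "act \<equiv> \<lambda>e r. ract E e (c r)"
abbreviation \<theta> where "\<theta> \<equiv> \<lambda>e. ract E e th"

lemma E: "abelian_group E"
  and ract_closed: "e \<in> carrier E \<Longrightarrow> s \<in> carrier S \<Longrightarrow> ract E e s \<in> carrier E"
  and ract_add: "e \<in> carrier E \<Longrightarrow> e' \<in> carrier E \<Longrightarrow> s \<in> carrier S \<Longrightarrow>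
    ract E (e \<oplus>\<^bsub>E\<^esub> e') s = ract E e s \<oplus>\<^bsub>E\<^esub> ract E e' s"
  and ract_radd: "e \<in> carrier E \<Longrightarrow> s \<in> carrier S \<Longrightarrow> t \<in> carrier S \<Longrightarrow>
    ract E e (s \<oplus>\<^bsub>S\<^esub> t) = ract E e s \<oplus>\<^bsub>E\<^esub> ract E e t"
  and ract_mult: "e \<in> carrier E \<Longrightarrow> s \<in> carrier S \<Longrightarrow> t \<in> carrier S \<Longrightarrow>
    ract E e (s \<otimes>\<^bsub>S\<^esub> t) = ract E (ract E e s) t"
  and ract_one: "e \<in> carrier E \<Longrightarrow> ract E e \<one>\<^bsub>S\<^esub> = e"
  using rmod unfolding right_module_def by blast+

sublocale M: skew_module R E act \<theta> \<alpha> \<beta>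
proof (rule skew_module.intro[OF R.is_cring noetherian_ring_axioms E], rule skew_module_axioms.intro)
  show "\<theta> \<in> endo E" unfolding endo_def using ract_closed[OF _ th_closed] ract_add[OF _ _ th_closed] by blast
  show "act (e \<oplus>\<^bsub>E\<^esub> e') r = act e r \<oplus>\<^bsub>E\<^esub> act e' r" if "e \<in> carrier E" "e' \<in> carrier E" "r \<in> carrier R" for e e' r
    using ract_add[OF that(1,2) c_closed[OF that(3)]] .
  show "act e r \<in> carrier E" if "e \<in> carrier E" "r \<in> carrier R" for e r
    using ract_closed[OF that(1) c_closed[OF that(2)]] .
  show "act e (r \<oplus> s) = act e r \<oplus>\<^bsub>E\<^esub> act e s" if "e \<in> carrier E" "r \<in> carrier R" "s \<in> carrier R" for e r s
    using ract_radd[OF that(1) c_closed[OF that(2)] c_closed[OF that(3)]] c_add[OF that(2,3)] by simp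
  show "act e (r \<otimes> s) = act (act e r) s" if "e \<in> carrier E" "r \<in> carrier R" "s \<in> carrier R" for e r s
    using ract_mult[OF that(1) c_closed[OF that(2)] c_closed[OF that(3)]] c_prod[OF that(2,3)] by simp
  show "act e \<one> = e" if "e \<in> carrier E" for e using ract_one[OF that] by (simp add: S_one)
  show "act (\<theta> e) r = \<theta> (act e (\<alpha> r))" if e: "e \<in> carrier E" and r: "r \<in> carrier R" for e r
    using ract_mult[OF e th_closed c_closed[OF r]] th_c[OF r]
      ract_mult[OF e c_closed[OF ring_hom_closed[OF alpha_hom r]] th_closed] by simp
qed (use alpha_hom beta_hom alpha_beta beta_alpha in auto)

lemma additive_subgroup_iff: "additive_subgroup N E \<longleftrightarrow> opsub E {} N"
proof
  assume "additive_subgroup N E"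
  then interpret N: additive_subgroup N E .
  show "opsub E {} N"
    by (rule M.E.opsubI)
      (use N.a_subset N.zero_closed N.a_closed subgroup.m_inv_closed[OF N.a_subgroup] in \<open>auto simp: a_inv_def\<close>)
next
  assume N: "opsub E {} N"
  show "additive_subgroup N E"
  proof (rule additive_subgroup.intro, rule M.E.add.subgroupI)
    show "N \<noteq> {}" using opsub_zero[OF N] by blast
  qed (use opsub_sub[OF N] opsub_add[OF N] M.E.opsub_neg[OF N] in \<open>auto simp: a_inv_def\<close>)
qed

text \<open>By Horner's scheme it is enough to test stability on the constants and on
  \<open>th\<close>.\<close>

lemma rsubmodule_iff: "rsubmodule S N E \<longleftrightarrow> opsub E (insert \<theta> M.RW) N"
proof
  assume "rsubmodule S N E"
  then have N: "opsub E {} N" and s: "\<And>e s. e \<in> N \<Longrightarrow> s \<in> carrier S \<Longrightarrow> ract E e s \<in> N"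
    unfolding rsubmodule_def additive_subgroup_iff by auto
  show "opsub E (insert \<theta> M.RW) N"
    using N s th_closed c_closed unfolding opsub_def M.rop_def by auto
next
  assume N: "opsub E (insert \<theta> M.RW) N"
  have "ract E e s \<in> N" if e: "e \<in> N" and s: "s \<in> carrier S" for e s
  proof -
    note ec = opsub_carrier[OF N e]
    have "s \<in> {s \<in> carrier S. ract E e s \<in> N}"
    proof (rule S_induct[OF s])
      show "c r \<in> {s \<in> carrier S. ract E e s \<in> N}" if r: "r \<in> carrier R" for r
        using opsub_op[OF N _ e, of "M.rop r"] r c_closed[OF r] by (simp add: M.rop_def)
      show "s \<oplus>\<^bsub>S\<^esub> t \<in> {s \<in> carrier S. ract E e s \<in> N}"
        if "s \<in> carrier S" "t \<in> carrier S" "s \<in> {s \<in> carrier S. ract E e s \<in> N}" "t \<in> {s \<in> carrier S. ract E e s \<in> N}" for s t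
        using that ract_radd[OF ec that(1,2)] opsub_add[OF N] S.a_closed by simp
      show "s \<otimes>\<^bsub>S\<^esub> th \<in> {s \<in> carrier S. ract E e s \<in> N}" if "s \<in> carrier S" "s \<in> {s \<in> carrier S. ract E e s \<in> N}" for s
        using that ract_mult[OF ec that(1) th_closed] opsub_op[OF N, of \<theta>] S.m_closed[OF that(1) th_closed] by simp
    qed
    then show ?thesis by blast
  qed
  moreover have "opsub E {} N" by (rule opsub_antimono[OF N]) simp
  ultimately show "rsubmodule S N E" unfolding rsubmodule_def additive_subgroup_iff using opsub_sub[OF N] by blast
qed

lemma rspan_gen: "rspan S E A = gen E (insert \<theta> M.RW) A"
  unfolding rspan_def gen_def rsubmodule_iff ..

lemma artinian_of_artin:
  assumes "artin E (insert \<theta> M.RW) (carrier E)" shows "artinian_rmodule S E"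
  unfolding artinian_rmodule_def
proof (intro allI impI)
  fix N assume N: "(\<forall>n. rsubmodule S (N n) E) \<and> (\<forall>n. N (Suc n) \<subseteq> N n)"
  then have o: "opsub E (insert \<theta> M.RW) (N n)" for n using rsubmodule_iff by blast
  obtain k where "\<And>i. i \<ge> k \<Longrightarrow> N i = N k"
  proof (rule DCC_D[OF assms, of N])
    show "N i \<in> subs E (insert \<theta> M.RW) {\<zero>\<^bsub>E\<^esub>} (carrier E)" for i
      unfolding subs_def using o[of i] opsub_zero[OF o[of i]] opsub_sub[OF o[of i]] by blast
  qed (use N in blast)+
  then show "\<exists>k. \<forall>n\<ge>k. N n = N k" by blast
qed

end

context skew_poly begin

lemma S_neg: assumes "f \<in> carrier S" shows "\<ominus>\<^bsub>S\<^esub> f = (\<lambda>n. \<ominus> f n)"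
proof (rule S.minus_equality)
  have "{n. \<ominus> f n \<noteq> \<zero>} = {n. f n \<noteq> \<zero>}" using S_coeff[OF assms] by (metis R.minus_minus R.minus_zero)
  then show "(\<lambda>n. \<ominus> f n) \<in> carrier S" using assms unfolding S_carrier by simp
  show "(\<lambda>n. \<ominus> f n) \<oplus>\<^bsub>S\<^esub> f = \<zero>\<^bsub>S\<^esub>" unfolding S_add S_zero using S_coeff[OF assms] by (simp add: R.l_neg)
qed fact

lemma th_pow: "th [^]\<^bsub>S\<^esub> k = (\<lambda>n. if n = k then \<one> else \<zero>)"
proof (induction k)
  case 0 show ?case by (auto simp: S_one skew_const_def)
next
  case (Suc k)
  have "th [^]\<^bsub>S\<^esub> Suc k = th [^]\<^bsub>S\<^esub> k \<otimes>\<^bsub>S\<^esub> th" by simp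
  also have "\<dots> = (\<lambda>n. case n of 0 \<Rightarrow> \<zero> | Suc m \<Rightarrow> (th [^]\<^bsub>S\<^esub> k) m)"
    by (rule mult_th) (rule S.nat_pow_closed[OF th_closed])
  finally show ?case unfolding Suc by (auto simp: fun_eq_iff split: nat.split)
qed

text \<open>Expands f into its monomials. Used contrapositively: an element of \<open>Q\<close>
  outside PS has a coefficient outside P.\<close>

lemma coeffs_in_prod:
  assumes f: "f \<in> carrier S" and I: "I \<subseteq> carrier R" "\<And>i. f i \<in> I"
  shows "f \<in> right_ideal_prod S (c ` I)"
proof -
  have m: "c (f i) \<otimes>\<^bsub>S\<^esub> th [^]\<^bsub>S\<^esub> i = (\<lambda>n. if n = i then f i else \<zero>)" for i
    by (subst c_mult[OF S.nat_pow_closed[OF th_closed] S_coeff[OF f]]) (use S_coeff[OF f] in \<open>auto simp: th_pow\<close>)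
  have mc: "c (f i) \<otimes>\<^bsub>S\<^esub> th [^]\<^bsub>S\<^esub> i \<in> carrier S" for i
    using c_closed[OF S_coeff[OF f]] S.nat_pow_closed[OF th_closed] by blast
  have fs: "finsum S (\<lambda>i. c (f i) \<otimes>\<^bsub>S\<^esub> th [^]\<^bsub>S\<^esub> i) {..<k} = (\<lambda>n. if n < k then f n else \<zero>)" for k
  proof (induction k)
    case 0 show ?case by (simp add: S_zero)
  next
    case (Suc k)
    have "finsum S (\<lambda>i. c (f i) \<otimes>\<^bsub>S\<^esub> th [^]\<^bsub>S\<^esub> i) {..<Suc k} =
      c (f k) \<otimes>\<^bsub>S\<^esub> th [^]\<^bsub>S\<^esub> k \<oplus>\<^bsub>S\<^esub> finsum S (\<lambda>i. c (f i) \<otimes>\<^bsub>S\<^esub> th [^]\<^bsub>S\<^esub> i) {..<k}"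
      unfolding lessThan_Suc by (rule S.finsum_insert) (use mc in auto)
    also have "\<dots> = (\<lambda>n. if n < Suc k then f n else \<zero>)"
      unfolding Suc unfolding m S_add using S_coeff[OF f] by (auto simp: fun_eq_iff less_Suc_eq)
    finally show ?case .
  qed
  have "finite {n. f n \<noteq> \<zero>}" using f unfolding S_carrier by blast
  then obtain k where "{n. f n \<noteq> \<zero>} \<subseteq> {..<k}" using finite_nat_iff_bounded by blast
  then have "f = (\<lambda>n. if n < k then f n else \<zero>)" by (auto simp: fun_eq_iff)
  then have 1: "f = finsum S (\<lambda>i. c (f i) \<otimes>\<^bsub>S\<^esub> th [^]\<^bsub>S\<^esub> i) {..<k}" using fs[of k] by simp
  have 2: "\<forall>i<k. c (f i) \<in> c ` I \<and> th [^]\<^bsub>S\<^esub> i \<in> carrier S"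
    using I(2) S.nat_pow_closed[OF th_closed] by blast
  show ?thesis unfolding right_ideal_prod_def mem_Collect_eq
    by (rule exI[of _ k], rule exI[of _ "\<lambda>i. c (f i)"], rule exI[of _ "\<lambda>i. th [^]\<^bsub>S\<^esub> i"], rule conjI[OF 1 2])
qed

end

section \<open>The simple module, its annihilator, and the order of \<alpha> modulo P\<close>

locale skew_poly_simple = skew_poly_module R \<alpha> V
  for R :: "('a, 'b) ring_scheme" (structure) and \<alpha> and V :: "(nat \<Rightarrow> 'a, 'v, 'w) rmod_scheme" +
  assumes simple: "simple_rmodule (skew_poly_ring R \<alpha>) V"
begin

definition Q where "Q = rannihilator S V"
definition P where "P = {r \<in> carrier R. c r \<in> Q}"

lemma V_simple: "opsub V (insert \<theta> M.RW) N \<Longrightarrow> N = {\<zero>\<^bsub>V\<^esub>} \<or> N = carrier V"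
  and V_nonzero: "carrier V \<noteq> {\<zero>\<^bsub>V\<^esub>}"
  using simple unfolding simple_rmodule_def rsubmodule_iff by blast+

lemma Q_iff: "s \<in> Q \<longleftrightarrow> s \<in> carrier S \<and> (\<forall>v\<in>carrier V. ract V v s = \<zero>\<^bsub>V\<^esub>)"
  unfolding Q_def rannihilator_def by blast

lemma P_iff: "r \<in> P \<longleftrightarrow> r \<in> carrier R \<and> (\<forall>v\<in>carrier V. act v r = \<zero>\<^bsub>V\<^esub>)"
  unfolding P_def using Q_iff c_closed by blast

text \<open>P is the kernel of the map sending r to its operator on V, viewed in the group of
  functions on V.\<close>

lemma P_ideal: "ideal P R"
proof -
  define h where "h r = (\<lambda>v. if v \<in> carrier V then act v r else \<zero>\<^bsub>V\<^esub>)" for r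
  have FV: "abelian_group (fungrp V :: ('v \<Rightarrow> 'v) ring)" by (rule abelian_group_fungrp[OF E])
  have we: "pointwise ` M.RW \<subseteq> endo (fungrp V :: ('v \<Rightarrow> 'v) ring)"
    using M.RW_endo pointwise_endo by blast
  have "ideal {r \<in> carrier R. h r \<in> {\<zero>\<^bsub>fungrp V\<^esub>}} R"
  proof (rule R.vimage_ideal[OF R.is_cring FV abelian_group.opsub_bot[OF FV we] R.oneideal])
    show "h r \<in> carrier (fungrp V)" if "r \<in> carrier R" for r using M.act_closed[OF _ that] by (auto simp: h_def)
    show "h (r \<oplus> s) = h r \<oplus>\<^bsub>fungrp V\<^esub> h s" if "r \<in> carrier R" "s \<in> carrier R" for r s
      using M.act_radd[OF _ that] by (auto simp: h_def fun_eq_iff)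
    show "\<exists>w\<in>pointwise ` M.RW. \<forall>a\<in>carrier R. h (a \<otimes> r) = w (h a)" if r: "r \<in> carrier R" for r
      by (rule bexI[of _ "pointwise (M.rop r)"])
        (use r M.act_mult M.act_zero in \<open>auto simp: h_def pointwise_def M.rop_def fun_eq_iff\<close>)
  qed
  moreover have "{r \<in> carrier R. h r \<in> {\<zero>\<^bsub>fungrp V\<^esub>}} = P"
    unfolding set_eq_iff P_iff by (auto simp: h_def fun_eq_iff)
  ultimately show ?thesis by simp
qed

lemma cyclic_all: assumes v: "v \<in> carrier V" "v \<noteq> \<zero>\<^bsub>V\<^esub>" shows "gen V (insert \<theta> M.RW) {v} = carrier V"
proof -
  have "opsub V (insert \<theta> M.RW) (gen V (insert \<theta> M.RW) {v})"
    by (rule M.E.opsub_gen[OF M.theta_RW_endo]) (use v in simp)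
  then show ?thesis using V_simple gen_incl1[of v "{v}" V "insert \<theta> M.RW"] v by blast
qed

lemma Q_add: "s \<in> Q \<Longrightarrow> t \<in> Q \<Longrightarrow> s \<oplus>\<^bsub>S\<^esub> t \<in> Q"
  unfolding Q_iff using ract_radd by simp

lemma Q_rmult: "s \<in> Q \<Longrightarrow> t \<in> carrier S \<Longrightarrow> s \<otimes>\<^bsub>S\<^esub> t \<in> Q"
proof -
  assume s: "s \<in> Q" and t: "t \<in> carrier S"
  have "ract V \<zero>\<^bsub>V\<^esub> t = \<zero>\<^bsub>V\<^esub>"
    using ract_add[of "\<zero>\<^bsub>V\<^esub>" "\<zero>\<^bsub>V\<^esub>" t] ract_closed[of "\<zero>\<^bsub>V\<^esub>" t] t
    by (metis M.E.add.l_cancel_one' M.E.l_zero M.E.zero_closed)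
  then show ?thesis using s t ract_mult unfolding Q_iff by simp
qed

lemma Q_lmult: "s \<in> Q \<Longrightarrow> t \<in> carrier S \<Longrightarrow> t \<otimes>\<^bsub>S\<^esub> s \<in> Q"
  unfolding Q_iff using ract_mult ract_closed by simp

lemma ract_rzero: "v \<in> carrier V \<Longrightarrow> ract V v \<zero>\<^bsub>S\<^esub> = \<zero>\<^bsub>V\<^esub>"
  using M.act_rzero[of v] by (simp add: c_zero)

lemma Q_neg: "s \<in> Q \<Longrightarrow> \<ominus>\<^bsub>S\<^esub> s \<in> Q"
proof -
  assume s: "s \<in> Q"
  have sc: "s \<in> carrier S" using s Q_iff by blast
  have "ract V v (\<ominus>\<^bsub>S\<^esub> s) = \<zero>\<^bsub>V\<^esub>" if v: "v \<in> carrier V" for v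
    using ract_radd[OF v sc S.a_inv_closed[OF sc]] S.r_neg[OF sc] ract_rzero[OF v] s v ract_closed[OF v S.a_inv_closed[OF sc]]
    unfolding Q_iff by simp
  then show ?thesis using sc unfolding Q_iff by simp
qed

lemma Q_ideal: "ideal Q S"
proof (rule idealI[OF S.ring_axioms])
  show "subgroup Q (add_monoid S)"
  proof (rule S.add.subgroupI)
    have "\<zero>\<^bsub>S\<^esub> \<in> Q" unfolding Q_iff using ract_rzero by simp
    then show "Q \<noteq> {}" by blast
  qed (use Q_add Q_neg in \<open>auto simp: Q_iff a_inv_def\<close>)
qed (use Q_rmult Q_lmult in auto)

text \<open>Schur's argument: \<theta> normalises the operators, so its kernel and its image are
  submodules although \<theta> is only semilinear.\<close>

lemma th_dichotomy:
  assumes "th \<notin> Q"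
  shows theta_inj: "v \<in> carrier V \<Longrightarrow> \<theta> v = \<zero>\<^bsub>V\<^esub> \<Longrightarrow> v = \<zero>\<^bsub>V\<^esub>" and theta_surj: "carrier V \<subseteq> \<theta> ` carrier V"
proof -
  obtain u where u: "u \<in> carrier V" "\<theta> u \<noteq> \<zero>\<^bsub>V\<^esub>" using assms th_closed unfolding Q_iff by blast
  note top = M.E.opsub_top[OF M.theta_RW_endo] and bot = M.E.opsub_bot[OF M.theta_RW_endo]
  have "opsub V (insert \<theta> M.RW) {v \<in> carrier V. \<theta> v \<in> {\<zero>\<^bsub>V\<^esub>}}"
  proof (rule M.E.preimage_opsub[OF E top bot])
    show "\<exists>w'\<in>insert \<theta> M.RW. \<forall>a\<in>carrier V. \<theta> (w a) = w' (\<theta> a)" if "w \<in> insert \<theta> M.RW" for w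
      using M.theta_norm_insert[OF that] .
  qed (use endo_closed[OF M.theta] endo_add[OF M.theta] in auto)
  then have "{v \<in> carrier V. \<theta> v \<in> {\<zero>\<^bsub>V\<^esub>}} = {\<zero>\<^bsub>V\<^esub>}" using V_simple u by blast
  then show "v \<in> carrier V \<Longrightarrow> \<theta> v = \<zero>\<^bsub>V\<^esub> \<Longrightarrow> v = \<zero>\<^bsub>V\<^esub>" by blast
  have "opsub V (insert \<theta> M.RW) (\<theta> ` carrier V)"
  proof (rule M.E.image_opsub[OF E top])
    show "\<exists>w'\<in>insert \<theta> M.RW. \<forall>a\<in>carrier V. w (\<theta> a) = \<theta> (w' a)" if "w \<in> insert \<theta> M.RW" for w
      using M.theta_norm_insert'[OF that] .
  qed (use endo_closed[OF M.theta] endo_add[OF M.theta] in auto)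
  then show "carrier V \<subseteq> \<theta> ` carrier V" using V_simple u by blast
qed

text \<open>Injectivity of \<theta> on V gives stability under \<alpha>; stability under the
  inverse, shown next, rests on surjectivity.\<close>

lemma P_alpha: assumes "th \<notin> Q" "r \<in> P" shows "\<alpha> r \<in> P"
proof -
  have r: "r \<in> carrier R" using assms(2) P_iff by blast
  note ar = ring_hom_closed[OF alpha_hom r]
  have "act v (\<alpha> r) = \<zero>\<^bsub>V\<^esub>" if v: "v \<in> carrier V" for v
  proof (rule theta_inj[OF assms(1)])
    show "act v (\<alpha> r) \<in> carrier V" using M.act_closed[OF v ar] .
    have "\<theta> (act v (\<alpha> r)) = act (\<theta> v) r" using M.act_theta[OF v r] by simp
    then show "\<theta> (act v (\<alpha> r)) = \<zero>\<^bsub>V\<^esub>" using assms(2) endo_closed[OF M.theta v] P_iff by simp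
  qed
  then show ?thesis using ar P_iff by blast
qed

lemma P_beta: assumes "th \<notin> Q" "r \<in> P" shows "\<beta> r \<in> P"
proof -
  have r: "r \<in> carrier R" using assms(2) P_iff by blast
  note br = ring_hom_closed[OF beta_hom r]
  have "act v (\<beta> r) = \<zero>\<^bsub>V\<^esub>" if v: "v \<in> carrier V" for v
  proof -
    obtain u where u: "u \<in> carrier V" "v = \<theta> u" using theta_surj[OF assms(1)] v by blast
    have "act v (\<beta> r) = \<theta> (act u r)" using M.act_theta[OF u(1) br] u(2) alpha_beta[OF r] by simp
    then show ?thesis using assms(2) u(1) P_iff M.E.endo_zero[OF M.theta] by simp
  qed
  then show ?thesis using br P_iff by blast
qed

text \<open>If \<open>f\<close> in \<open>Q\<close> has minimal degree \<open>n\<close> among the elements with a coefficient outside \<open>P\<close>, then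
  \<open>\<alpha>\<^sup>n(r) f - f r\<close> has smaller degree, so its constant coefficient \<open>f\<^sub>0 (\<alpha>\<^sup>n(r) - r)\<close> is in \<open>P\<close>,
  and simplicity of \<open>V\<close> removes the factor \<open>f\<^sub>0\<close>.\<close>

lemma finite_order:
  assumes thQ: "th \<notin> Q" and strict: "right_ideal_prod S (c ` P) \<subset> Q"
  shows "\<exists>n>0. \<forall>r\<in>carrier R. (\<alpha> ^^ n) r \<ominus> r \<in> P"
proof -
  interpret P: ideal P R by (rule P_ideal)
  have Psub: "P \<subseteq> carrier R" unfolding P_def by blast
  have zP: "\<zero> \<in> P" by (rule P.zero_closed)
  have Qc: "f \<in> carrier S" if "f \<in> Q" for f using that Q_iff by blast
  define good where "good k f \<longleftrightarrow> f \<in> Q \<and> (\<forall>i>k. f i = \<zero>) \<and> (\<exists>i. f i \<notin> P)" for k :: nat and f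
  have "\<exists>k f. good k f"
  proof -
    obtain f where f: "f \<in> Q" "f \<notin> right_ideal_prod S (c ` P)" using strict by blast
    have "\<exists>i. f i \<notin> P" using coeffs_in_prod[OF Qc[OF f(1)] Psub] f(2) by blast
    moreover have "finite {n. f n \<noteq> \<zero>}" using Qc[OF f(1)] unfolding S_carrier by blast
    then obtain k where "{n. f n \<noteq> \<zero>} \<subseteq> {..k}" using finite_nat_iff_bounded_le by blast
    then have "\<forall>i>k. f i = \<zero>" by (auto dest: subsetD)
    ultimately show ?thesis unfolding good_def using f(1) by blast
  qed
  define n where "n = (LEAST k. \<exists>f. good k f)"
  have "\<exists>f. good n f" unfolding n_def by (rule LeastI_ex) fact
  then obtain f where f: "good n f" by blast
  have least: "\<not> good k g" if "k < n" for k g using that not_less_Least unfolding n_def by blast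
  have fQ: "f \<in> Q" and fz: "\<And>i. i > n \<Longrightarrow> f i = \<zero>" using f unfolding good_def by auto
  obtain i0 where i0: "f i0 \<notin> P" using f unfolding good_def by blast
  note fS = Qc[OF fQ]
  note f0 = S_coeff[OF fS, of 0]
  \<comment> \<open>In degree zero f would be a constant in \<open>Q\<close>, that is, an element of
    P.\<close>
  have npos: "n > 0"
  proof (rule ccontr)
    assume "\<not> n > 0"
    then have "f = c (f 0)" using fz by (auto simp: fun_eq_iff skew_const_def)
    then have "f 0 \<in> P" unfolding P_def using fQ f0 by simp
    moreover have "f i \<in> P" if "i > 0" for i using fz[of i] that \<open>\<not> n > 0\<close> zP by simp
    ultimately show False using i0 by (cases "i0 = 0") auto
  qed
  \<comment> \<open>If the constant coefficient were in P, then in f = f_0 + g \<theta> the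
    injectivity of \<theta> would put g into \<open>Q\<close>, in degree n - 1 and still with a
    coefficient outside P.\<close>
  have f0P: "f 0 \<notin> P"
  proof
    assume f0P: "f 0 \<in> P"
    define g where "g = (\<lambda>i. f (Suc i))"
    have g: "g \<in> carrier S" unfolding g_def by (rule decompose(1)[OF fS])
    have fd: "f = c (f 0) \<oplus>\<^bsub>S\<^esub> g \<otimes>\<^bsub>S\<^esub> th" unfolding g_def by (rule decompose(2)[OF fS])
    have "ract V v g = \<zero>\<^bsub>V\<^esub>" if v: "v \<in> carrier V" for v
    proof (rule theta_inj[OF thQ ract_closed[OF v g]])
      have "ract V v f = act v (f 0) \<oplus>\<^bsub>V\<^esub> \<theta> (ract V v g)"
        using arg_cong[OF fd, of "ract V v"] ract_radd[OF v c_closed[OF f0] S.m_closed[OF g th_closed]] ract_mult[OF v g th_closed]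
        by (simp del: fun_upd_apply)
      moreover have "ract V v f = \<zero>\<^bsub>V\<^esub>" "act v (f 0) = \<zero>\<^bsub>V\<^esub>" using fQ f0P v unfolding Q_iff P_iff by auto
      ultimately show "\<theta> (ract V v g) = \<zero>\<^bsub>V\<^esub>" using endo_closed[OF M.theta ract_closed[OF v g]] by simp
    qed
    then have "g \<in> Q" using g Q_iff by blast
    moreover have "i0 \<noteq> 0" using f0P i0 by metis
    then have "g (i0 - 1) \<notin> P" using i0 unfolding g_def by simp
    moreover have "\<forall>i>n - 1. g i = \<zero>" using fz unfolding g_def by simp
    ultimately have "good (n - 1) g" unfolding good_def by blast
    then show False using least[of "n - 1" g] npos by simp
  qed
  have key: "f 0 \<otimes> ((\<alpha> ^^ n) r \<ominus> r) \<in> P" if r: "r \<in> carrier R" for r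
  proof -
    note ar = alpha_pow_c[OF r]
    define d where "d = c ((\<alpha> ^^ n) r) \<otimes>\<^bsub>S\<^esub> f \<oplus>\<^bsub>S\<^esub> (\<ominus>\<^bsub>S\<^esub> (f \<otimes>\<^bsub>S\<^esub> c r))"
    have fr: "f \<otimes>\<^bsub>S\<^esub> c r \<in> carrier S" using fS c_closed[OF r] by blast
    have dQ: "d \<in> Q" unfolding d_def
      by (intro Q_add Q_neg Q_lmult[OF fQ c_closed[OF ar]] Q_rmult[OF fQ c_closed[OF r]])
    have di: "d i = (\<alpha> ^^ n) r \<otimes> f i \<oplus> \<ominus> (f i \<otimes> (\<alpha> ^^ i) r)" for i
      unfolding d_def S_add S_neg[OF fr] unfolding c_mult[OF fS ar] mult_c[OF fS r] ..
    \<comment> \<open>At i = n both terms equal f_n \<alpha>^n(r) and cancel; this is why the left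
      factor is the twist of r by \<alpha>^n.\<close>
    have "d i = \<zero>" if "i > n - 1" for i
    proof (cases "i = n")
      case True
      then show ?thesis unfolding di using S_coeff[OF fS] ar by (simp add: R.m_comm R.r_neg)
    next
      case False
      then have "f i = \<zero>" using that fz[of i] by simp
      then show ?thesis unfolding di using ar[of n] ar[of i] by simp
    qed
    then have "d 0 \<in> P" using least[of "n - 1" d] npos dQ unfolding good_def by (metis diff_less zero_less_one)
    moreover have "d 0 = f 0 \<otimes> ((\<alpha> ^^ n) r \<ominus> r)"
      unfolding di a_minus_def using f0 r ar by (simp add: R.r_distr R.r_minus R.m_comm)
    ultimately show ?thesis by simp
  qed
  \<comment> \<open>The set of all \<alpha>^n(r) - r is stable under \<alpha>, so its annihilator in
    V is a submodule. It contains v f_0, which is nonzero for some v, and hence is all of V.\<close>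
  define I where "I = (\<lambda>r. (\<alpha> ^^ n) r \<ominus> r) ` carrier R"
  have Ic: "I \<subseteq> carrier R" unfolding I_def using alpha_pow_c by auto
  have "opsub V (insert \<theta> M.RW) (M.Ann I)"
  proof (rule M.Ann_opsub[OF Ic])
    fix a assume "a \<in> I"
    then obtain r where r: "r \<in> carrier R" "a = (\<alpha> ^^ n) r \<ominus> r" unfolding I_def by blast
    note ar = ring_hom_closed[OF alpha_hom r(1)]
    have "\<alpha> (\<ominus> r) = \<ominus> \<alpha> r"
      using ring_hom_add[OF alpha_hom R.a_inv_closed[OF r(1)] r(1)] R.l_neg[OF r(1)]
        ring_hom_zero[OF alpha_hom R.ring_axioms R.ring_axioms] ring_hom_closed[OF alpha_hom R.a_inv_closed[OF r(1)]] ar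
      by (metis R.minus_equality)
    then have "\<alpha> a = (\<alpha> ^^ n) (\<alpha> r) \<ominus> \<alpha> r"
      unfolding r(2) a_minus_def using ring_hom_add[OF alpha_hom alpha_pow_c[OF r(1)] R.a_inv_closed[OF r(1)]]
      by (simp add: funpow_swap1)
    then show "\<alpha> a \<in> I" unfolding I_def using ar by blast
  qed
  moreover have "M.Ann I \<noteq> {\<zero>\<^bsub>V\<^esub>}"
  proof -
    obtain v where v: "v \<in> carrier V" "act v (f 0) \<noteq> \<zero>\<^bsub>V\<^esub>" using f0P f0 P_iff by blast
    have "act (act v (f 0)) a = \<zero>\<^bsub>V\<^esub>" if a: "a \<in> I" for a
    proof -
      obtain r where r: "r \<in> carrier R" "a = (\<alpha> ^^ n) r \<ominus> r" using a unfolding I_def by blast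
      have "act (act v (f 0)) a = act v (f 0 \<otimes> a)" using M.act_mult[OF v(1) f0] a Ic by auto
      then show ?thesis using key[OF r(1)] r(2) v(1) P_iff by simp
    qed
    then have "act v (f 0) \<in> M.Ann I" unfolding M.Ann_def using M.act_closed[OF v(1) f0] by simp
    then show ?thesis using v(2) by blast
  qed
  ultimately have "M.Ann I = carrier V" using V_simple by blast
  then have "(\<alpha> ^^ n) r \<ominus> r \<in> P" if "r \<in> carrier R" for r
    using that Ic unfolding P_iff M.Ann_def I_def by blast
  then show ?thesis using npos by blast
qed

end

section \<open>Essential extensions\<close>

locale simple_extension = skew_poly_simple R \<alpha> V + E: skew_poly_module R \<alpha> E
  for R :: "('a, 'b) ring_scheme" (structure) and \<alpha> and V :: "(nat \<Rightarrow> 'a, 'v, 'w) rmod_scheme"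
    and E :: "(nat \<Rightarrow> 'a, 'e, 'f) rmod_scheme" +
  fixes f :: "'v \<Rightarrow> 'e"
  assumes hom: "rmod_hom (skew_poly_ring R \<alpha>) V E f" and inj: "inj_on f (carrier V)"
    and ess: "essential_rsubmodule (skew_poly_ring R \<alpha>) (f ` carrier V) E"
    and fg: "fin_gen_rmodule (skew_poly_ring R \<alpha>) E"
begin

abbreviation V' where "V' \<equiv> f ` carrier V"
abbreviation EW where "EW \<equiv> insert E.\<theta> E.M.RW"

lemma f_closed: "v \<in> carrier V \<Longrightarrow> f v \<in> carrier E"
  and f_add: "v \<in> carrier V \<Longrightarrow> u \<in> carrier V \<Longrightarrow> f (v \<oplus>\<^bsub>V\<^esub> u) = f v \<oplus>\<^bsub>E\<^esub> f u"
  and f_ract: "v \<in> carrier V \<Longrightarrow> s \<in> carrier S \<Longrightarrow> f (ract V v s) = ract E (f v) s"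
  using hom unfolding rmod_hom_def by blast+

lemma f_zero: "f \<zero>\<^bsub>V\<^esub> = \<zero>\<^bsub>E\<^esub>"
proof -
  have "f \<zero>\<^bsub>V\<^esub> \<oplus>\<^bsub>E\<^esub> f \<zero>\<^bsub>V\<^esub> = f \<zero>\<^bsub>V\<^esub>" using f_add[of "\<zero>\<^bsub>V\<^esub>" "\<zero>\<^bsub>V\<^esub>"] by simp
  then show ?thesis using f_closed[of "\<zero>\<^bsub>V\<^esub>"] by (metis E.M.E.add.l_cancel_one' M.E.zero_closed)
qed

lemma V'_opsub: "opsub E EW V'"
  using ess unfolding essential_rsubmodule_def E.rsubmodule_iff by blast

lemma V'_nonzero: "V' \<noteq> {\<zero>\<^bsub>E\<^esub>}"
proof
  assume eq: "V' = {\<zero>\<^bsub>E\<^esub>}"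
  obtain v where v: "v \<in> carrier V" "v \<noteq> \<zero>\<^bsub>V\<^esub>" using V_nonzero M.E.zero_closed by blast
  have "f v \<in> V'" using v(1) by blast
  then have "f v = f \<zero>\<^bsub>V\<^esub>" using eq f_zero by simp
  then show False using inj_onD[OF inj] v M.E.zero_closed by blast
qed

lemma V'_simple: assumes K: "opsub E EW K" "K \<subseteq> V'" shows "K = {\<zero>\<^bsub>E\<^esub>} \<or> K = V'"
proof -
  have "opsub V (insert \<theta> M.RW) {v \<in> carrier V. f v \<in> K}"
  proof (rule M.E.preimage_opsub[OF E.E M.E.opsub_top[OF M.theta_RW_endo] K(1)])
    fix w assume "w \<in> insert \<theta> M.RW"
    then consider "w = \<theta>" | r where "r \<in> carrier R" "w = M.rop r" by blast
    then show "\<exists>w'\<in>EW. \<forall>a\<in>carrier V. f (w a) = w' (f a)"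
    proof cases
      case 1 then show ?thesis using f_ract[OF _ th_closed] by (intro bexI[of _ E.\<theta>]) auto
    next
      case 2 then show ?thesis using f_ract[OF _ c_closed[OF 2(1)]]
        by (intro bexI[of _ "E.M.rop r"]) (auto simp: M.rop_def E.M.rop_def)
    qed
  qed (use f_closed f_add in auto)
  then consider "{v \<in> carrier V. f v \<in> K} = {\<zero>\<^bsub>V\<^esub>}" | "{v \<in> carrier V. f v \<in> K} = carrier V" using V_simple by blast
  then show ?thesis
  proof cases
    case 1
    have "k = \<zero>\<^bsub>E\<^esub>" if k: "k \<in> K" for k
    proof -
      obtain v where v: "v \<in> carrier V" "k = f v" using K(2) k by blast
      then have "v \<in> {v \<in> carrier V. f v \<in> K}" using k by simp
      then have "v = \<zero>\<^bsub>V\<^esub>" unfolding 1 by simp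
      then show ?thesis using v(2) f_zero by simp
    qed
    then have "K \<subseteq> {\<zero>\<^bsub>E\<^esub>}" by blast
    then show ?thesis using opsub_zero[OF K(1)] by blast
  next
    case 2 then show ?thesis using K(2) by blast
  qed
qed

lemma V'_P: "v \<in> V' \<Longrightarrow> p \<in> P \<Longrightarrow> E.act v p = \<zero>\<^bsub>E\<^esub>"
  using f_ract[OF _ c_closed] f_zero unfolding P_iff by fastforce

lemma V'_ess: assumes K: "opsub E EW K" "K \<noteq> {\<zero>\<^bsub>E\<^esub>}" shows "\<exists>v\<in>V' \<inter> K. v \<noteq> \<zero>\<^bsub>E\<^esub>"
proof -
  have "V' \<inter> K \<noteq> {\<zero>\<^bsub>E\<^esub>}" using ess K unfolding essential_rsubmodule_def E.rsubmodule_iff by blast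
  moreover have "\<zero>\<^bsub>E\<^esub> \<in> V' \<inter> K" using opsub_zero[OF V'_opsub] opsub_zero[OF K(1)] by blast
  ultimately show ?thesis by blast
qed

lemma gens: obtains A where "finite A" "A \<subseteq> carrier E" "gen E EW A = carrier E"
  using fg unfolding fin_gen_rmodule_def E.rspan_gen by blast

lemma artin_E_invertible:
  assumes thQ: "th \<notin> Q" and strict: "right_ideal_prod S (c ` P) \<subset> Q"
  shows "artin E EW (carrier E)"
proof -
  obtain n where n: "n > 0" "\<forall>r\<in>carrier R. (\<alpha> ^^ n) r \<ominus> r \<in> P" using finite_order[OF assms] by blast
  obtain A where A: "finite A" "A \<subseteq> carrier E" "gen E EW A = carrier E" by (rule gens)
  have surj: "V' \<subseteq> E.\<theta> ` V'"
  proof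
    fix e assume "e \<in> V'"
    then obtain v where v: "v \<in> carrier V" "e = f v" by blast
    then obtain u where "u \<in> carrier V" "v = \<theta> u" using theta_surj[OF thQ] by blast
    then show "e \<in> E.\<theta> ` V'" using v f_ract[OF _ th_closed] by auto
  qed
  interpret ES: essential_simple R E E.act E.\<theta> \<alpha> \<beta> P n A V'
  proof (rule essential_simple.intro[OF E.M.skew_module_axioms], rule essential_simple_axioms.intro)
    show "ideal P R" by (rule P_ideal)
    show "\<alpha> r \<in> P" if "r \<in> P" for r using P_alpha[OF thQ that] .
    show "\<beta> r \<in> P" if "r \<in> P" for r using P_beta[OF thQ that] .
    show "(\<alpha> ^^ n) r \<ominus> r \<in> P" if "r \<in> carrier R" for r using n(2) that by blast
    show "E.act v p = \<zero>\<^bsub>E\<^esub>" if "v \<in> V'" "p \<in> P" for v p using V'_P[OF that] .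
    show "K = {\<zero>\<^bsub>E\<^esub>} \<or> K = V'" if "opsub E EW K" "K \<subseteq> V'" for K using V'_simple[OF that] .
    show "\<exists>v\<in>V' \<inter> K. v \<noteq> \<zero>\<^bsub>E\<^esub>" if "opsub E EW K" "K \<noteq> {\<zero>\<^bsub>E\<^esub>}" for K using V'_ess[OF that] .
  qed (fact n(1) A V'_opsub V'_nonzero surj)+
  show ?thesis by (rule ES.artin_E)
qed

lemma theta_kernel_opsub: "opsub E EW {e \<in> carrier E. (E.\<theta> ^^ k) e = \<zero>\<^bsub>E\<^esub>}"
proof -
  have "opsub E EW {e \<in> carrier E. (E.\<theta> ^^ k) e \<in> {\<zero>\<^bsub>E\<^esub>}}"
  proof (induction k)
    case 0
    have "{e \<in> carrier E. (E.\<theta> ^^ 0) e \<in> {\<zero>\<^bsub>E\<^esub>}} = {\<zero>\<^bsub>E\<^esub>}" by auto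
    then show ?case using E.M.E.opsub_bot[OF E.M.theta_RW_endo] by simp
  next
    case (Suc k)
    have "opsub E EW {e \<in> carrier E. E.\<theta> e \<in> {e \<in> carrier E. (E.\<theta> ^^ k) e \<in> {\<zero>\<^bsub>E\<^esub>}}}"
    proof (rule E.M.E.preimage_opsub[OF E.E E.M.E.opsub_top[OF E.M.theta_RW_endo] Suc])
      show "\<exists>w'\<in>EW. \<forall>a\<in>carrier E. E.\<theta> (w a) = w' (E.\<theta> a)" if "w \<in> EW" for w
        using E.M.theta_norm_insert[OF that] .
    qed (use endo_closed[OF E.M.theta] endo_add[OF E.M.theta] in auto)
    moreover have sw: "(E.\<theta> ^^ Suc k) e = (E.\<theta> ^^ k) (E.\<theta> e)" for e
      by (simp only: funpow_Suc_right comp_def)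
    have "{e \<in> carrier E. E.\<theta> e \<in> {e \<in> carrier E. (E.\<theta> ^^ k) e \<in> {\<zero>\<^bsub>E\<^esub>}}}
        = {e \<in> carrier E. (E.\<theta> ^^ Suc k) e \<in> {\<zero>\<^bsub>E\<^esub>}}"
      unfolding sw using endo_closed[OF E.M.theta] by blast
    ultimately show ?case by simp
  qed
  then show ?thesis by simp
qed

lemma theta_image_opsub: assumes "opsub E EW N" shows "opsub E EW ((E.\<theta> ^^ k) ` N)"
proof (induction k)
  case 0 show ?case using assms by simp
next
  case (Suc k)
  have "opsub E EW (E.\<theta> ` (E.\<theta> ^^ k) ` N)"
  proof (rule E.M.E.image_opsub[OF E.E Suc])
    fix w assume "w \<in> EW"
    then obtain w' where "w' \<in> EW" "\<forall>a\<in>carrier E. w (E.\<theta> a) = E.\<theta> (w' a)" using E.M.theta_norm_insert' by blast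
    then show "\<exists>w'\<in>EW. \<forall>a\<in>(E.\<theta> ^^ k) ` N. w (E.\<theta> a) = E.\<theta> (w' a)"
      using opsub_sub[OF Suc] by (intro bexI[of _ w']) auto
  qed (use endo_closed[OF E.M.theta] endo_add[OF E.M.theta] opsub_carrier[OF Suc] in auto)
  then show ?case by (simp add: image_comp comp_def)
qed

text \<open>Fitting's argument: the kernels of the powers of \<theta> become stationary at some k. A
  nonzero image of \<theta>^k would meet V, which \<theta> kills, and so give an element in the
  kernel of \<theta>^(k+1) but not in that of \<theta>^k.\<close>

lemma theta_nilpotent:
  assumes thQ: "th \<in> Q"
  shows "\<exists>k. \<forall>e\<in>carrier E. (E.\<theta> ^^ k) e = \<zero>\<^bsub>E\<^esub>"
proof -
  obtain A where A: "finite A" "A \<subseteq> carrier E" "gen E EW A = carrier E" by (rule gens)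
  have nE: "noeth E EW (carrier E)" using E.M.noeth_theta_gen[OF A(1,2)] A(3) by simp
  let ?K = "\<lambda>k. {e \<in> carrier E. (E.\<theta> ^^ k) e = \<zero>\<^bsub>E\<^esub>}"
  obtain k where k: "\<And>i. i \<ge> k \<Longrightarrow> ?K i = ?K k"
  proof (rule ACC_D[OF nE, of ?K])
    show "?K i \<in> subs E EW {\<zero>\<^bsub>E\<^esub>} (carrier E)" for i
      using theta_kernel_opsub[of i] opsub_zero[OF theta_kernel_opsub[of i]] unfolding subs_def by blast
    show "?K i \<subseteq> ?K (Suc i)" for i using E.M.E.endo_zero[OF E.M.theta] by auto
  qed blast
  let ?I = "(E.\<theta> ^^ k) ` carrier E"
  have I: "opsub E EW ?I" by (rule theta_image_opsub[OF E.M.E.opsub_top[OF E.M.theta_RW_endo]])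
  have "?I = {\<zero>\<^bsub>E\<^esub>}"
  proof (rule ccontr)
    assume "?I \<noteq> {\<zero>\<^bsub>E\<^esub>}"
    then obtain e where e: "e \<in> V'" "e \<in> ?I" "e \<noteq> \<zero>\<^bsub>E\<^esub>" using V'_ess[OF I] by blast
    then obtain v u where v: "v \<in> carrier V" "e = f v" and u: "u \<in> carrier E" "e = (E.\<theta> ^^ k) u" by blast
    have "\<theta> v = \<zero>\<^bsub>V\<^esub>" using thQ v(1) unfolding Q_iff by blast
    then have "E.\<theta> e = \<zero>\<^bsub>E\<^esub>" using f_ract[OF v(1) th_closed] v(2) f_zero by simp
    then have "u \<in> ?K (Suc k)" using u by simp
    moreover have "?K (Suc k) = ?K k" by (rule k) simp
    ultimately have "u \<in> ?K k" by (simp only:)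
    then show False using u e by simp
  qed
  then show ?thesis by blast
qed

text \<open>On the kernel of \<theta> the S-submodules are just the R-submodules, and the theory of
  \<open>essential_simple\<close> applies with a trivial twist. The layer between the kernels of
  \<theta>^i and \<theta>^(i+1) embeds into the kernel of \<theta> by \<theta>^i, and nilpotency
  exhausts \<open>E\<close>.\<close>

lemma artin_E_nilpotent:
  assumes thQ: "th \<in> Q"
  shows "artin E EW (carrier E)"
proof -
  define K where "K k = {e \<in> carrier E. (E.\<theta> ^^ k) e = \<zero>\<^bsub>E\<^esub>}" for k
  have Ko: "opsub E EW (K k)" for k unfolding K_def by (rule theta_kernel_opsub)
  have Kc: "K k \<subseteq> carrier E" for k unfolding K_def by blast
  have K1: "E.\<theta> e = \<zero>\<^bsub>E\<^esub>" if "e \<in> K 1" for e using that unfolding K_def by simp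
  have V'K: "V' \<subseteq> K 1"
  proof
    fix e assume "e \<in> V'"
    then obtain v where v: "v \<in> carrier V" "e = f v" by blast
    have "\<theta> v = \<zero>\<^bsub>V\<^esub>" using thQ v(1) unfolding Q_iff by blast
    then have "E.\<theta> e = \<zero>\<^bsub>E\<^esub>" using f_ract[OF v(1) th_closed] v(2) f_zero by simp
    then show "e \<in> K 1" unfolding K_def using f_closed[OF v(1)] v(2) by simp
  qed
  let ?G = "E\<lparr>carrier := K 1\<rparr>"
  have G: "abelian_group ?G" by (rule abelian_group_restrict[OF E.E Ko])
  have kc: "e \<in> carrier E" if "e \<in> carrier ?G" for e using that Kc[of 1] by auto
  \<comment> \<open>The identity, not the zero map, takes the place of \<theta>. Both leave every
    submodule of the kernel stable, but \<open>V_theta\<close> demands surjectivity on V.\<close>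
  interpret G: skew_module R ?G E.act id id id
  proof (rule skew_module.intro[OF R.is_cring noetherian_ring_axioms G], rule skew_module_axioms.intro)
    show "E.act e r \<in> carrier ?G" if "e \<in> carrier ?G" "r \<in> carrier R" for e r
      using opsub_op[OF Ko[of 1], of "E.M.rop r" e] that by (simp add: E.M.rop_def)
    show "id \<in> ring_hom R R" "id \<in> ring_hom R R" by (auto simp: ring_hom_def)
    show "E.act (e \<oplus>\<^bsub>?G\<^esub> e') r = E.act e r \<oplus>\<^bsub>?G\<^esub> E.act e' r"
      if "e \<in> carrier ?G" "e' \<in> carrier ?G" "r \<in> carrier R" for e e' r
      using E.M.act_add[OF kc[OF that(1)] kc[OF that(2)] that(3)] by simp
    show "E.act e (r \<oplus> s) = E.act e r \<oplus>\<^bsub>?G\<^esub> E.act e s"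
      if "e \<in> carrier ?G" "r \<in> carrier R" "s \<in> carrier R" for e r s
      using E.M.act_radd[OF kc[OF that(1)] that(2,3)] by simp
    show "E.act e (r \<otimes> s) = E.act (E.act e r) s"
      if "e \<in> carrier ?G" "r \<in> carrier R" "s \<in> carrier R" for e r s
      by (rule E.M.act_mult[OF kc[OF that(1)] that(2,3)])
    show "E.act e \<one> = e" if "e \<in> carrier ?G" for e by (rule E.M.act_one[OF kc[OF that]])
  qed (auto simp: endo_def)
  have sub: "opsub ?G (insert id G.RW) N \<longleftrightarrow> opsub E EW N \<and> N \<subseteq> K 1" for N
  proof -
    have "opsub ?G (insert id G.RW) N \<longleftrightarrow> opsub E (insert id E.M.RW) N \<and> N \<subseteq> K 1"
      by (rule opsub_restrict[OF Kc])
    moreover have "opsub E (insert id E.M.RW) N \<longleftrightarrow> opsub E EW N" if "N \<subseteq> K 1"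
    proof -
      have "\<forall>a\<in>N. E.\<theta> a = \<zero>\<^bsub>E\<^esub>" using K1 that by blast
      then show ?thesis unfolding opsub_def by auto
    qed
    ultimately show ?thesis by blast
  qed
  have gen_eq: "gen ?G (insert id G.RW) A = gen E EW A" if "A \<subseteq> K 1" for A
  proof
    show "gen ?G (insert id G.RW) A \<subseteq> gen E EW A"
    proof (rule gen_min)
      have "opsub E EW (gen E EW A)" by (rule E.M.E.opsub_gen[OF E.M.theta_RW_endo]) (use that Kc[of 1] in blast)
      then show "opsub ?G (insert id G.RW) (gen E EW A)" using sub gen_min[OF Ko that] by blast
    qed (rule gen_incl)
    show "gen E EW A \<subseteq> gen ?G (insert id G.RW) A"
    proof (rule gen_min)
      have "opsub ?G (insert id G.RW) (gen ?G (insert id G.RW) A)"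
        by (rule G.E.opsub_gen[OF G.theta_RW_endo]) (use that in simp)
      then show "opsub E EW (gen ?G (insert id G.RW) A)" using sub by blast
    qed (rule gen_incl)
  qed
  obtain A where A: "finite A" "A \<subseteq> carrier E" "gen E EW A = carrier E" by (rule gens)
  have nE: "noeth E EW (carrier E)" using E.M.noeth_theta_gen[OF A(1,2)] A(3) by simp
  have "noeth E EW (K 1)" by (rule ACC_subset[OF nE subs_mono[OF subset_refl Kc]])
  from E.M.E.noeth_fg[OF E.M.theta_RW_endo Ko this]
  obtain B where B: "finite B" "B \<subseteq> K 1" "gen E EW B = K 1" .
  interpret ES: essential_simple R ?G E.act id id id P 1 B V'
  proof (rule essential_simple.intro[OF G.skew_module_axioms], rule essential_simple_axioms.intro)
    interpret P: ideal P R by (rule P_ideal)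
    show "ideal P R" by (rule P_ideal)
    show "(id ^^ 1) r \<ominus> r \<in> P" if "r \<in> carrier R" for r
      using that P.zero_closed by (simp add: a_minus_def R.r_neg)
    show "E.act v p = \<zero>\<^bsub>?G\<^esub>" if "v \<in> V'" "p \<in> P" for v p using V'_P[OF that] by simp
    show "opsub ?G (insert id G.RW) V'" using sub V'_opsub V'K by blast
    show "K = {\<zero>\<^bsub>?G\<^esub>} \<or> K = V'" if "opsub ?G (insert id G.RW) K" "K \<subseteq> V'" for K
      using V'_simple[of K] sub that by simp
    show "\<exists>v\<in>V' \<inter> K. v \<noteq> \<zero>\<^bsub>?G\<^esub>" if "opsub ?G (insert id G.RW) K" "K \<noteq> {\<zero>\<^bsub>?G\<^esub>}" for K
      using V'_ess[of K] sub that by simp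
    show "gen ?G (insert id G.RW) B = carrier ?G" using gen_eq[OF B(2)] B(3) by simp
    show "V' \<noteq> {\<zero>\<^bsub>?G\<^esub>}" using V'_nonzero by simp
    show "B \<subseteq> carrier ?G" using B(2) by simp
  qed (use B in auto)
  have subs_eq: "subs ?G (insert id G.RW) {\<zero>\<^bsub>?G\<^esub>} (carrier ?G) = subs E EW {\<zero>\<^bsub>E\<^esub>} (K 1)"
    unfolding subs_def sub by auto
  have art1: "artin E EW (K 1)" using ES.artin_E unfolding subs_eq .
  have inc: "K i \<subseteq> K (Suc i)" for i unfolding K_def using E.M.E.endo_zero[OF E.M.theta] by auto
  have tk: "E.\<theta> ^^ i \<in> endo E" for i by (rule endo_pow[OF E.M.theta])
  have layer: "DCC (subs E EW (K i) (K (Suc i)))" for i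
  proof (rule DCC_transfer[OF art1, of _ "\<lambda>N. (E.\<theta> ^^ i) ` N"])
    fix N assume "N \<in> subs E EW (K i) (K (Suc i))"
    then have N: "opsub E EW N" "N \<subseteq> K (Suc i)" unfolding subs_def by auto
    note o = theta_image_opsub[OF N(1), of i]
    have "(E.\<theta> ^^ i) ` N \<subseteq> K 1"
    proof
      fix e assume "e \<in> (E.\<theta> ^^ i) ` N"
      then obtain a where a: "a \<in> N" "e = (E.\<theta> ^^ i) a" by blast
      then have "a \<in> carrier E" "(E.\<theta> ^^ Suc i) a = \<zero>\<^bsub>E\<^esub>" using N(2) unfolding K_def by auto
      then show "e \<in> K 1" unfolding K_def using a(2) endo_closed[OF tk] by simp
    qed
    then show "(E.\<theta> ^^ i) ` N \<in> subs E EW {\<zero>\<^bsub>E\<^esub>} (K 1)" unfolding subs_def using o opsub_zero[OF o] by blast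
  next
    fix N N' assume "N \<in> subs E EW (K i) (K (Suc i))" "N' \<in> subs E EW (K i) (K (Suc i))" and NN: "N \<subseteq> N'"
      and eq: "(E.\<theta> ^^ i) ` N' = (E.\<theta> ^^ i) ` N"
    then have N: "opsub E EW N" "K i \<subseteq> N" and N': "opsub E EW N'" unfolding subs_def by auto
    note Nc' = opsub_carrier[OF N']
    show "N' \<subseteq> N"
    proof (rule E.M.E.kernel_cancel[OF E.E N(1) N' NN _ _ _ eq])
      show "a \<in> N" if "a \<in> N'" "(E.\<theta> ^^ i) a = \<zero>\<^bsub>E\<^esub>" for a
        using that N(2) Nc' unfolding K_def by blast
    qed (use endo_closed[OF tk Nc'] endo_add[OF tk Nc' Nc'] in auto)
  qed auto
  have "artin E EW (K i)" for i
  proof (induction i)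
    case 0
    have "subs E EW {\<zero>\<^bsub>E\<^esub>} (K 0) \<subseteq> {{\<zero>\<^bsub>E\<^esub>}, {\<zero>\<^bsub>E\<^esub>}}" unfolding subs_def K_def by auto
    then show ?case by (rule DCC_subset_pair)
  next
    case (Suc i)
    show ?case
      using E.M.E.DCC_subs_trans[OF E.M.theta_RW_endo Ko Ko _ inc Suc layer] opsub_zero[OF Ko] by blast
  qed
  moreover obtain k where "K k = carrier E" using theta_nilpotent[OF thQ] unfolding K_def by blast
  ultimately show ?thesis by metis
qed

theorem artinian_E:
  assumes "right_ideal_prod S (c ` P) \<subset> Q" shows "artinian_rmodule S E"
  using artin_E_nilpotent artin_E_invertible[OF _ assms] E.artinian_of_artin by blast

end

section \<open>The primitive quotient\<close>

context skew_poly_simple begin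

lemma quotient_artinian:
  assumes dcc: "DCC {I. right_ideal I S \<and> Q \<subseteq> I}"
  shows "right_artinian_ring (S Quot Q)"
proof -
  interpret Q: ideal Q S by (rule Q_ideal)
  interpret q: ring_hom_ring S "S Quot Q" "(+>\<^bsub>S\<^esub>) Q" by (rule Q.rcos_ring_hom_ring)
  define h where "h J = {s \<in> carrier S. Q +>\<^bsub>S\<^esub> s \<in> J}" for J
  have "DCC {J. right_ideal J (S Quot Q)}"
  proof (rule DCC_transfer[OF dcc, of _ h])
    fix J assume "J \<in> {J. right_ideal J (S Quot Q)}"
    then have add: "additive_subgroup J (S Quot Q)"
      and m: "\<And>a r. a \<in> J \<Longrightarrow> r \<in> carrier (S Quot Q) \<Longrightarrow> a \<otimes>\<^bsub>S Quot Q\<^esub> r \<in> J"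
      unfolding right_ideal_def by auto
    interpret J: additive_subgroup J "S Quot Q" by (rule add)
    have neg: "\<ominus>\<^bsub>S Quot Q\<^esub> a \<in> J" if "a \<in> J" for a
      using subgroup.m_inv_closed[OF J.a_subgroup that] by (simp add: a_inv_def)
    have "additive_subgroup (h J) S"
    proof (rule additive_subgroup.intro, rule S.add.subgroupI)
      have "\<zero>\<^bsub>S\<^esub> \<in> h J" unfolding h_def using J.zero_closed q.hom_zero by simp
      then show "h J \<noteq> {}" by blast
      show "\<ominus>\<^bsub>S\<^esub> a \<in> h J" if "a \<in> h J" for a
        using that neg q.hom_a_inv unfolding h_def by auto
      show "a \<oplus>\<^bsub>S\<^esub> b \<in> h J" if "a \<in> h J" "b \<in> h J" for a b
        using that J.a_closed unfolding h_def by simp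
    qed (auto simp: h_def)
    moreover have "\<forall>a\<in>h J. \<forall>r\<in>carrier S. a \<otimes>\<^bsub>S\<^esub> r \<in> h J"
      unfolding h_def using m by simp
    moreover have "Q \<subseteq> h J"
    proof
      fix s assume s: "s \<in> Q"
      then have sc: "s \<in> carrier S" using Q.a_subset by blast
      have e: "Q +>\<^bsub>S\<^esub> s = Q" by (rule S.a_coset_join2[OF sc Q.a_subgroup s])
      have "\<zero>\<^bsub>S Quot Q\<^esub> = Q" unfolding FactRing_def by simp
      then have "Q \<in> J" using J.zero_closed by (simp only:)
      then show "s \<in> h J" unfolding h_def mem_Collect_eq e using sc by blast
    qed
    ultimately show "h J \<in> {I. right_ideal I S \<and> Q \<subseteq> I}" unfolding right_ideal_def by blast
  next
    fix J J' assume "J' \<in> {J. right_ideal J (S Quot Q)}" and eq: "h J' = h J"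
    then have "J' \<subseteq> carrier (S Quot Q)" unfolding right_ideal_def using additive_subgroup.a_subset by blast
    then show "J' \<subseteq> J" using eq unfolding h_def FactRing_def A_RCOSETS_def' by auto
  qed (auto simp: h_def)
  then show ?thesis unfolding right_artinian_ring_def DCC_def using Q.quotient_is_ring by simp
qed

definition Sreg :: "(nat \<Rightarrow> 'a, nat \<Rightarrow> 'a) rmod" where
  "Sreg = \<lparr>partial_object.carrier = carrier S, monoid.mult = (\<otimes>\<^bsub>S\<^esub>), monoid.one = \<one>\<^bsub>S\<^esub>,
     ring.zero = \<zero>\<^bsub>S\<^esub>, ring.add = (\<oplus>\<^bsub>S\<^esub>), ract = (\<otimes>\<^bsub>S\<^esub>)\<rparr>"

lemma Sreg_simps [simp]: "carrier Sreg = carrier S" "\<zero>\<^bsub>Sreg\<^esub> = \<zero>\<^bsub>S\<^esub>" "a \<oplus>\<^bsub>Sreg\<^esub> b = a \<oplus>\<^bsub>S\<^esub> b"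
  unfolding Sreg_def by simp_all

lemma Sreg_ract: "ract Sreg a b = a \<otimes>\<^bsub>S\<^esub> b" unfolding Sreg_def by simp

lemma Sreg_group: "abelian_group Sreg"
proof (rule abelian_groupI)
  fix x assume "x \<in> carrier Sreg"
  then show "\<exists>y\<in>carrier Sreg. y \<oplus>\<^bsub>Sreg\<^esub> x = \<zero>\<^bsub>Sreg\<^esub>" by (intro bexI[of _ "\<ominus>\<^bsub>S\<^esub> x"]) (auto simp: S.l_neg)
qed (auto simp: S.a_ac)

sublocale SS: skew_poly_module R \<alpha> Sreg
proof (rule skew_poly_module.intro[OF skew_poly_axioms], rule skew_poly_module_axioms.intro)
  show "right_module S Sreg"
    unfolding right_module_def using S.ring_axioms Sreg_group by (auto simp: Sreg_ract S.l_distr S.r_distr S.m_assoc)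
qed

lemma Sreg_rop: "SS.M.rop r s = s \<otimes>\<^bsub>S\<^esub> c r" unfolding SS.M.rop_def unfolding Sreg_ract ..

abbreviation SW where "SW \<equiv> insert SS.\<theta> SS.M.RW"

lemma right_ideal_opsub: assumes "right_ideal I S" shows "opsub Sreg SW I"
proof -
  have "additive_subgroup I S" and m: "\<And>a r. a \<in> I \<Longrightarrow> r \<in> carrier S \<Longrightarrow> a \<otimes>\<^bsub>S\<^esub> r \<in> I"
    using assms unfolding right_ideal_def by auto
  then interpret I: additive_subgroup I S by simp
  show ?thesis
  proof (rule SS.M.E.opsubI)
    show "\<ominus>\<^bsub>Sreg\<^esub> a \<in> I" if a: "a \<in> I" for a
    proof -
      have "\<ominus>\<^bsub>S\<^esub> a \<in> I" using subgroup.m_inv_closed[OF I.a_subgroup a] by (simp add: a_inv_def)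
      moreover have "\<ominus>\<^bsub>Sreg\<^esub> a = \<ominus>\<^bsub>S\<^esub> a"
        by (rule SS.M.E.minus_equality) (use a I.a_subset in \<open>auto simp: S.l_neg\<close>)
      ultimately show ?thesis by simp
    qed
    show "w a \<in> I" if "w \<in> SW" "a \<in> I" for w a
      using that m th_closed c_closed unfolding SS.M.rop_def by (auto simp: Sreg_ract)
  qed (use I.a_subset I.zero_closed I.a_closed in auto)
qed

text \<open>As \<theta> kills V, a polynomial s acts on V through its constant coefficient, an
  element of the commutative ring R. So an s killing one nonzero v kills V, and sending s to v s
  embeds S/Q into the simple module V.\<close>

lemma DCC_right_ideals_nilpotent:
  assumes thQ: "th \<in> Q"
  shows "DCC {I. right_ideal I S \<and> Q \<subseteq> I}"
proof -
  obtain v where v: "v \<in> carrier V" "v \<noteq> \<zero>\<^bsub>V\<^esub>" using V_nonzero M.E.zero_closed by blast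
  have r0: "ract V u s = act u (s 0)" if u: "u \<in> carrier V" and s: "s \<in> carrier S" for u s
  proof -
    define g where "g = (\<lambda>n. s (Suc n))"
    have g: "g \<in> carrier S" unfolding g_def by (rule decompose(1)[OF s])
    have sd: "s = c (s 0) \<oplus>\<^bsub>S\<^esub> g \<otimes>\<^bsub>S\<^esub> th" unfolding g_def by (rule decompose(2)[OF s])
    have "ract V u s = act u (s 0) \<oplus>\<^bsub>V\<^esub> \<theta> (ract V u g)"
      using arg_cong[OF sd, of "ract V u"] ract_radd[OF u c_closed[OF S_coeff[OF s]] S.m_closed[OF g th_closed]] ract_mult[OF u g th_closed]
      by simp
    also have "\<theta> (ract V u g) = \<zero>\<^bsub>V\<^esub>" using thQ ract_closed[OF u g] unfolding Q_iff by blast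
    finally show ?thesis using M.act_closed[OF u S_coeff[OF s]] by simp
  qed
  have ann: "s \<in> Q" if s: "s \<in> carrier S" and z: "ract V v s = \<zero>\<^bsub>V\<^esub>" for s
  proof -
    have s0: "s 0 \<in> carrier R" using S_coeff[OF s] .
    have "opsub V (insert \<theta> M.RW) {u \<in> carrier V. M.rop (s 0) u \<in> {\<zero>\<^bsub>V\<^esub>}}"
    proof (rule M.E.preimage_opsub[OF E M.E.opsub_top[OF M.theta_RW_endo] M.E.opsub_bot[OF M.theta_RW_endo]])
      fix w assume "w \<in> insert \<theta> M.RW"
      then consider "w = \<theta>" | r where "r \<in> carrier R" "w = M.rop r" by blast
      then show "\<exists>w'\<in>insert \<theta> M.RW. \<forall>a\<in>carrier V. M.rop (s 0) (w a) = w' (M.rop (s 0) a)"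
      proof cases
        case 1
        have "M.rop (s 0) (\<theta> a) = \<theta> (M.rop (s 0) a)" if a: "a \<in> carrier V" for a
        proof -
          have "\<theta> a = \<zero>\<^bsub>V\<^esub>" "\<theta> (act a (s 0)) = \<zero>\<^bsub>V\<^esub>" using thQ a M.act_closed[OF a s0] unfolding Q_iff by auto
          then show ?thesis using M.act_zero[OF s0] by (simp add: M.rop_def)
        qed
        then show ?thesis using 1 by (intro bexI[of _ \<theta>]) auto
      next
        case 2
        have "M.rop (s 0) (M.rop r a) = M.rop r (M.rop (s 0) a)" if a: "a \<in> carrier V" for a
          using M.act_comm[OF a 2(1) s0] by (simp add: M.rop_def)
        then show ?thesis using 2 by (intro bexI[of _ "M.rop r"]) auto
      qed
    qed (use endo_closed[OF M.rop_endo[OF s0]] endo_add[OF M.rop_endo[OF s0]] in auto)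
    moreover have "v \<in> {u \<in> carrier V. M.rop (s 0) u \<in> {\<zero>\<^bsub>V\<^esub>}}" using v(1) z r0[OF v(1) s] by (simp add: M.rop_def)
    ultimately have eq: "{u \<in> carrier V. M.rop (s 0) u \<in> {\<zero>\<^bsub>V\<^esub>}} = carrier V" using V_simple v(2) by blast
    have "ract V u s = \<zero>\<^bsub>V\<^esub>" if u: "u \<in> carrier V" for u
    proof -
      have "u \<in> {u \<in> carrier V. M.rop (s 0) u \<in> {\<zero>\<^bsub>V\<^esub>}}" unfolding eq by (rule u)
      then show ?thesis using r0[OF u s] by (simp add: M.rop_def)
    qed
    then show ?thesis using s Q_iff by blast
  qed
  have d: "DCC {{\<zero>\<^bsub>V\<^esub>}, carrier V}" by (rule DCC_subset_pair[OF subset_refl])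
  show ?thesis
  proof (rule DCC_transfer[OF d, of _ "\<lambda>I. ract V v ` I"])
    fix I assume "I \<in> {I. right_ideal I S \<and> Q \<subseteq> I}"
    then have I: "opsub Sreg SW I" using right_ideal_opsub by blast
    have Ic: "s \<in> carrier S" if "s \<in> I" for s using opsub_carrier[OF I that] by simp
    have "opsub V (insert \<theta> M.RW) (ract V v ` I)"
    proof (rule SS.M.E.image_opsub[OF E I])
      fix w assume "w \<in> insert \<theta> M.RW"
      then consider "w = \<theta>" | r where "r \<in> carrier R" "w = M.rop r" by blast
      then show "\<exists>w'\<in>SW. \<forall>a\<in>I. w (ract V v a) = ract V v (w' a)"
      proof cases
        case 1 then show ?thesis using ract_mult[OF v(1) Ic th_closed] by (intro bexI[of _ SS.\<theta>]) (auto simp: Sreg_ract)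
      next
        case 2
        have "w (ract V v a) = ract V v (SS.M.rop r a)" if "a \<in> I" for a
          using ract_mult[OF v(1) Ic[OF that] c_closed[OF 2(1)]] unfolding 2(2) M.rop_def Sreg_rop by simp
        then show ?thesis using 2(1) by blast
      qed
    qed (use ract_closed[OF v(1) Ic] ract_radd[OF v(1) Ic Ic] in auto)
    then show "ract V v ` I \<in> {{\<zero>\<^bsub>V\<^esub>}, carrier V}" using V_simple by blast
  next
    fix I I' assume "I \<in> {I. right_ideal I S \<and> Q \<subseteq> I}" "I' \<in> {I. right_ideal I S \<and> Q \<subseteq> I}"
      and II: "I \<subseteq> I'" and eq: "ract V v ` I' = ract V v ` I"
    then have I: "opsub Sreg SW I" "Q \<subseteq> I" and I': "opsub Sreg SW I'" using right_ideal_opsub by auto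
    have Ic': "s \<in> carrier S" if "s \<in> I'" for s using opsub_carrier[OF I' that] by simp
    show "I' \<subseteq> I"
      by (rule SS.M.E.kernel_cancel[OF E I(1) I' II _ _ _ eq])
        (use ract_closed[OF v(1) Ic'] ract_radd[OF v(1) Ic' Ic'] ann[OF Ic'] I(2) in auto)
  qed auto
qed

text \<open>S/Q is Artinian already as a group with the right multiplications by R and \<theta>^n as
  operators: S is the sum of the groups T \<theta>^j with j < n, and T/(Q \<inter> T) embeds into
  finitely many copies of V, which is Artinian over R[x]. Right ideals containing Q are stable under
  these operators.\<close>

lemma DCC_right_ideals_invertible:
  assumes thQ: "th \<notin> Q" and n: "n > 0" "\<forall>r\<in>carrier R. (\<alpha> ^^ n) r \<ominus> r \<in> P"
  shows "DCC {I. right_ideal I S \<and> Q \<subseteq> I}"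
proof -
  obtain v0 where v0: "v0 \<in> carrier V" "v0 \<noteq> \<zero>\<^bsub>V\<^esub>" using V_nonzero M.E.zero_closed by blast
  interpret VE: essential_simple R V act \<theta> \<alpha> \<beta> P n "{v0}" "carrier V"
  proof (rule essential_simple.intro[OF M.skew_module_axioms], rule essential_simple_axioms.intro)
    show "ideal P R" by (rule P_ideal)
    show "\<alpha> r \<in> P" if "r \<in> P" for r using P_alpha[OF thQ that] .
    show "\<beta> r \<in> P" if "r \<in> P" for r using P_beta[OF thQ that] .
    show "(\<alpha> ^^ n) r \<ominus> r \<in> P" if "r \<in> carrier R" for r using n(2) that by blast
    show "act v p = \<zero>\<^bsub>V\<^esub>" if "v \<in> carrier V" "p \<in> P" for v p using that P_iff by blast
    show "K = {\<zero>\<^bsub>V\<^esub>} \<or> K = carrier V" if "opsub V (insert \<theta> M.RW) K" "K \<subseteq> carrier V" for K using V_simple[OF that(1)] .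
    show "\<exists>v\<in>carrier V \<inter> K. v \<noteq> \<zero>\<^bsub>V\<^esub>" if K: "opsub V (insert \<theta> M.RW) K" "K \<noteq> {\<zero>\<^bsub>V\<^esub>}" for K
      using opsub_zero[OF K(1)] opsub_sub[OF K(1)] K(2) by blast
    show "opsub V (insert \<theta> M.RW) (carrier V)" by (rule M.E.opsub_top[OF M.theta_RW_endo])
    show "carrier V \<subseteq> \<theta> ` carrier V" by (rule theta_surj[OF thQ])
  qed (use n(1) v0 V_nonzero cyclic_all[OF v0] in auto)
  have D1: "VE.D1 = carrier V" using VE.V_D1 opsub_sub[OF VE.D1] by blast
  have G1: "commuting V VE.TW" 
  proof -
    have "carrier (V\<lparr>carrier := carrier V\<rparr>) = carrier V" by simp
    then show ?thesis using VE.commuting1 unfolding commuting_def D1 by (simp only:)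
  qed
  let ?VT = "insert (\<theta> ^^ n) M.RW" and ?ST = "insert (SS.\<theta> ^^ n) SS.M.RW"
  have VT: "VE.TW = ?VT" unfolding VE.xop_def ..
  have artV: "artin V ?VT (carrier V)" using VE.artin_V unfolding VT .
  have noethV: "noeth V ?VT (carrier V)" using VE.noeth_D1 unfolding VT D1 .
  have VTe: "?VT \<subseteq> endo V" and STe: "?ST \<subseteq> endo Sreg" by (rule M.pow_ops_endo, rule SS.M.pow_ops_endo)
  \<comment> \<open>The polynomials in \<theta>^n. Passing from S to this smaller set makes the
    action on V commute with R[x].\<close>
  define T where "T = gen Sreg ?ST {\<one>\<^bsub>S\<^esub>}"
  have To: "opsub Sreg ?ST T" unfolding T_def by (rule SS.M.E.opsub_gen[OF STe]) simp
  have Tc: "t \<in> carrier S" if "t \<in> T" for t using opsub_carrier[OF To that] by simp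
  have Qo: "opsub Sreg ?ST Q"
  proof -
    have "right_ideal Q S" unfolding right_ideal_def using ideal.axioms(1)[OF Q_ideal] Q_rmult by blast
    from right_ideal_opsub[OF this] have o: "opsub Sreg SW Q" .
    have "(SS.\<theta> ^^ k) a \<in> Q" if "a \<in> Q" for k a
      by (induction k) (use that opsub_op[OF o, of SS.\<theta>] in auto)
    then show ?thesis using o unfolding opsub_def by auto
  qed
  have pow: "ract V v ((SS.\<theta> ^^ k) s) = (\<theta> ^^ k) (ract V v s)" if v: "v \<in> carrier V" and s: "s \<in> carrier S" for v s k
  proof (induction k)
    case (Suc k)
    have "(SS.\<theta> ^^ k) s \<in> carrier S" using endo_closed[OF endo_pow[OF SS.M.theta], of s k] s by simp
    from ract_mult[OF v this th_closed] have "ract V v (SS.\<theta> ((SS.\<theta> ^^ k) s)) = \<theta> (ract V v ((SS.\<theta> ^^ k) s))"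
      unfolding Sreg_ract .
    then show ?case using Suc by simp
  qed simp
  have lin: "\<exists>w'\<in>?VT. \<forall>v\<in>carrier V. \<forall>s\<in>carrier S. ract V v (w s) = w' (ract V v s)" if w: "w \<in> ?ST" for w
  proof -
    consider "w = SS.\<theta> ^^ n" | r where "r \<in> carrier R" "w = SS.M.rop r" using w by blast
    then show ?thesis
    proof cases
      case 1 then show ?thesis using pow by (intro bexI[of _ "\<theta> ^^ n"]) auto
    next
      case 2
      have "ract V v (w s) = M.rop r (ract V v s)" if "v \<in> carrier V" "s \<in> carrier S" for v s
        using ract_mult[OF that c_closed[OF 2(1)]] unfolding 2(2) M.rop_def Sreg_rop by simp
      then show ?thesis using 2(1) by blast
    qed
  qed
  have lin': "\<exists>w\<in>?ST. \<forall>v\<in>carrier V. \<forall>s\<in>carrier S. w' (ract V v s) = ract V v (w s)" if w: "w' \<in> ?VT" for w'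
  proof -
    consider "w' = \<theta> ^^ n" | r where "r \<in> carrier R" "w' = M.rop r" using w by blast
    then show ?thesis
    proof cases
      case 1 then show ?thesis using pow by (intro bexI[of _ "SS.\<theta> ^^ n"]) auto
    next
      case 2
      have "w' (ract V v s) = ract V v (SS.M.rop r s)" if "v \<in> carrier V" "s \<in> carrier S" for v s
        using ract_mult[OF that c_closed[OF 2(1)]] unfolding 2(2) M.rop_def Sreg_rop by simp
      then show ?thesis using 2(1) by blast
    qed
  qed
  \<comment> \<open>For fixed v, the s with (w v) s = w (v s) form a stable subgroup containing 1;
    stability holds because the operators from R[x] commute on V.\<close>
  have Tcomm: "ract V (w v) t = w (ract V v t)" if w: "w \<in> ?VT" and v: "v \<in> carrier V" and t: "t \<in> T" for w v t
  proof -
    have we: "w \<in> endo V" using w VTe by blast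
    note wv = endo_closed[OF we v]
    have "opsub Sreg ?ST {s \<in> carrier S. ract V (w v) s \<ominus>\<^bsub>V\<^esub> w (ract V v s) \<in> {\<zero>\<^bsub>V\<^esub>}}"
    proof (rule SS.M.E.preimage_opsub[OF E _ M.E.opsub_bot[OF VTe], of _ "carrier S", simplified Sreg_simps])
      show "opsub Sreg ?ST (carrier S)" using SS.M.E.opsub_top[OF STe] by simp
      show "ract V (w v) s \<ominus>\<^bsub>V\<^esub> w (ract V v s) \<in> carrier V" if "s \<in> carrier S" for s
        using ract_closed[OF wv that] endo_closed[OF we ract_closed[OF v that]] by simp
      show "ract V (w v) (a \<oplus>\<^bsub>S\<^esub> b) \<ominus>\<^bsub>V\<^esub> w (ract V v (a \<oplus>\<^bsub>S\<^esub> b)) =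
        (ract V (w v) a \<ominus>\<^bsub>V\<^esub> w (ract V v a)) \<oplus>\<^bsub>V\<^esub> (ract V (w v) b \<ominus>\<^bsub>V\<^esub> w (ract V v b))"
        if a: "a \<in> carrier S" and b: "b \<in> carrier S" for a b
        using ract_radd[OF wv a b] ract_radd[OF v a b] endo_add[OF we ract_closed[OF v a] ract_closed[OF v b]]
          ract_closed[OF wv a] ract_closed[OF wv b] endo_closed[OF we ract_closed[OF v a]] endo_closed[OF we ract_closed[OF v b]]
        by (simp add: a_minus_def M.E.minus_add M.E.a_ac)
      show "\<exists>x'\<in>?VT. \<forall>a\<in>carrier S. ract V (w v) (x a) \<ominus>\<^bsub>V\<^esub> w (ract V v (x a)) = x' (ract V (w v) a \<ominus>\<^bsub>V\<^esub> w (ract V v a))"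
        if x: "x \<in> ?ST" for x
      proof -
        obtain x' where x': "x' \<in> ?VT" "\<forall>v\<in>carrier V. \<forall>s\<in>carrier S. ract V v (x s) = x' (ract V v s)" using lin[OF x] by blast
        have xe: "x' \<in> endo V" using x'(1) VTe by blast
        have "ract V (w v) (x a) \<ominus>\<^bsub>V\<^esub> w (ract V v (x a)) = x' (ract V (w v) a \<ominus>\<^bsub>V\<^esub> w (ract V v a))" if a: "a \<in> carrier S" for a
        proof -
          have "w (x' (ract V v a)) = x' (w (ract V v a))"
            using G1 w x'(1) ract_closed[OF v a] unfolding VT commuting_def by blast
          then show ?thesis
            using x'(2) v wv a M.E.endo_minus[OF xe ract_closed[OF wv a] endo_closed[OF we ract_closed[OF v a]]] by simp
        qed
        then show ?thesis using x'(1) by blast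
      qed
    qed
    moreover have "{\<one>\<^bsub>S\<^esub>} \<subseteq> {s \<in> carrier S. ract V (w v) s \<ominus>\<^bsub>V\<^esub> w (ract V v s) \<in> {\<zero>\<^bsub>V\<^esub>}}"
      using ract_one[OF v] ract_one[OF wv] wv by (simp add: a_minus_def M.E.r_neg)
    ultimately have "T \<subseteq> {s \<in> carrier S. ract V (w v) s \<ominus>\<^bsub>V\<^esub> w (ract V v s) \<in> {\<zero>\<^bsub>V\<^esub>}}"
      unfolding T_def by (rule gen_min)
    then have "ract V (w v) t \<ominus>\<^bsub>V\<^esub> w (ract V v t) = \<zero>\<^bsub>V\<^esub>" using t by blast
    then show ?thesis
      by (rule M.E.eq_of_minus_zero[OF _ ract_closed[OF wv Tc[OF t]] endo_closed[OF we ract_closed[OF v Tc[OF t]]]])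
  qed
  \<comment> \<open>Annihilators in \<open>T\<close> of finite subsets of V. Each further element b
    contributes one factor that embeds into V by sending t to b t, read as the right action.\<close>
  define q where "q B = {t \<in> T. \<forall>b\<in>B. ract V b t = \<zero>\<^bsub>V\<^esub>}" for B
  have q_insert: "q (insert b B) = {t \<in> q B. ract V b t \<in> {\<zero>\<^bsub>V\<^esub>}}" for b B unfolding q_def by auto
  have q0: "q {} = T" unfolding q_def by simp
  have qT: "q B \<subseteq> T" for B unfolding q_def by blast
  have qc: "t \<in> carrier S" if "t \<in> q B" for t B using Tc qT that by blast
  have main: "opsub Sreg ?ST (q B) \<and> DCC (subs Sreg ?ST (q B) T)" if "finite B" "B \<subseteq> carrier V" for B
    using that
  proof (induction B rule: finite_induct)
    case empty
    have "subs Sreg ?ST T T \<subseteq> {T, T}" unfolding subs_def by blast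
    then show ?case using To DCC_subset_pair unfolding q0 by blast
  next
    case (insert b B)
    then have b: "b \<in> carrier V" and qo: "opsub Sreg ?ST (q B)" and qd: "DCC (subs Sreg ?ST (q B) T)" by auto
    have lin_b: "\<exists>w'\<in>?VT. \<forall>a\<in>q B. ract V b (w a) = w' (ract V b a)" if w: "w \<in> ?ST" for w
    proof -
      obtain w' where "w' \<in> ?VT" "\<forall>v\<in>carrier V. \<forall>s\<in>carrier S. ract V v (w s) = w' (ract V v s)" using lin[OF w] by blast
      then show ?thesis using b qc by (intro bexI[of _ w']) auto
    qed
    have o: "opsub Sreg ?ST (q (insert b B))" unfolding q_insert
      by (rule SS.M.E.preimage_opsub[OF E qo M.E.opsub_bot[OF VTe]])
        (use ract_closed[OF b qc] ract_radd[OF b qc qc] lin_b in auto)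
    have "DCC (subs Sreg ?ST (q (insert b B)) (q B))"
    proof (rule DCC_transfer[OF artV, of _ "\<lambda>N. ract V b ` N"])
      fix N assume "N \<in> subs Sreg ?ST (q (insert b B)) (q B)"
      then have N: "opsub Sreg ?ST N" unfolding subs_def by auto
      have Nc: "s \<in> carrier S" if "s \<in> N" for s using opsub_carrier[OF N that] by simp
      have "opsub V ?VT (ract V b ` N)"
      proof (rule SS.M.E.image_opsub[OF E N])
        fix w' assume "w' \<in> ?VT"
        then obtain w where "w \<in> ?ST" "\<forall>v\<in>carrier V. \<forall>s\<in>carrier S. w' (ract V v s) = ract V v (w s)" using lin' by blast
        then show "\<exists>w\<in>?ST. \<forall>a\<in>N. w' (ract V b a) = ract V b (w a)" using b Nc by (intro bexI[of _ w]) auto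
      qed (use ract_closed[OF b Nc] ract_radd[OF b Nc Nc] in auto)
      then show "ract V b ` N \<in> subs V ?VT {\<zero>\<^bsub>V\<^esub>} (carrier V)"
        unfolding subs_def using opsub_zero opsub_sub by blast
    next
      fix N N' assume "N \<in> subs Sreg ?ST (q (insert b B)) (q B)" "N' \<in> subs Sreg ?ST (q (insert b B)) (q B)"
        and NN: "N \<subseteq> N'" and eq: "ract V b ` N' = ract V b ` N"
      then have N: "opsub Sreg ?ST N" "q (insert b B) \<subseteq> N" and N': "opsub Sreg ?ST N'" "N' \<subseteq> q B" unfolding subs_def by auto
      note qc' = qc[OF subsetD[OF N'(2)]]
      show "N' \<subseteq> N"
        by (rule SS.M.E.kernel_cancel[OF E N(1) N'(1) NN _ _ _ eq])
          (use ract_closed[OF b qc'] ract_radd[OF b qc' qc'] N(2) N'(2) in \<open>auto simp: q_insert\<close>)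
    qed auto
    moreover have "q (insert b B) \<subseteq> q B" unfolding q_def by blast
    ultimately have "DCC (subs Sreg ?ST (q (insert b B)) T)"
      using SS.M.E.DCC_subs_trans[OF STe qo To _ qT _ qd] by blast
    then show ?case using o by blast
  qed
  have dT: "DCC (subs Sreg ?ST (Q \<inter> T) T)"
  proof -
    obtain B where B: "finite B" "B \<subseteq> carrier V" "gen V ?VT B = carrier V"
      by (rule M.E.noeth_fg[OF VTe M.E.opsub_top[OF VTe] noethV])
    \<comment> \<open>Here B generates V over R[x]. An element of \<open>T\<close> that kills B
      kills V, since its action commutes with R[x].\<close>
    have "q B \<subseteq> Q \<inter> T"
    proof
      fix t assume t: "t \<in> q B"
      then have tT: "t \<in> T" using qT by blast
      note tc = Tc[OF tT]
      have "opsub V ?VT {v \<in> carrier V. ract V v t \<in> {\<zero>\<^bsub>V\<^esub>}}"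
      proof (rule M.E.preimage_opsub[OF E M.E.opsub_top[OF VTe] M.E.opsub_bot[OF VTe]])
        show "\<exists>w'\<in>?VT. \<forall>a\<in>carrier V. ract V (w a) t = w' (ract V a t)" if w: "w \<in> ?VT" for w
          by (rule bexI[OF _ w]) (use Tcomm[OF w _ tT] in blast)
      qed (use ract_closed[OF _ tc] ract_add[OF _ _ tc] in auto)
      moreover have "B \<subseteq> {v \<in> carrier V. ract V v t \<in> {\<zero>\<^bsub>V\<^esub>}}" using t B(2) unfolding q_def by blast
      ultimately have "carrier V \<subseteq> {v \<in> carrier V. ract V v t \<in> {\<zero>\<^bsub>V\<^esub>}}" using gen_min B(3) by blast
      then show "t \<in> Q \<inter> T" using tT tc Q_iff by blast
    qed
    then show ?thesis using DCC_subset[OF _ subs_mono[OF _ subset_refl]] main[OF B(1,2)] by blast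
  qed
  let ?f = "filtration Sreg SS.\<theta> T"
  have fo: "opsub Sreg ?ST (?f j)" for j by (rule SS.M.filtration_opsub[OF To])
  have fi: "opsub Sreg ?ST ((SS.\<theta> ^^ j) ` T)" for j by (rule SS.M.filtration_image[OF To])
  \<comment> \<open>With \<open>Q\<close> added to the filtration, right multiplication by
    \<theta>^j maps T/(Q \<inter> T) onto the layer between \<open>B j\<close> and
    \<open>B (Suc j)\<close>.\<close>
  define B where "B j = ?f j <+>\<^bsub>Sreg\<^esub> Q" for j
  have Bo: "opsub Sreg ?ST (B j)" for j unfolding B_def by (rule SS.M.E.opsub_sum[OF STe fo Qo])
  have Bmono: "B j \<subseteq> B (Suc j)" for j unfolding B_def
    by (rule SS.M.E.set_add_mono) (use SS.M.E.set_add_incl1[OF fo fi] in auto)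
  have BQ: "Q \<subseteq> B j" for j unfolding B_def by (rule SS.M.E.set_add_incl2[OF fo Qo])
  have tj: "SS.\<theta> ^^ j \<in> endo Sreg" for j by (rule endo_pow[OF SS.M.theta])
  have Qj: "(SS.\<theta> ^^ j) a \<in> Q" if "a \<in> Q" for j a
  proof (induction j)
    case (Suc j) then show ?case using Q_rmult[OF Suc th_closed] by (simp add: Sreg_ract)
  qed (use that in simp)
  have layer: "DCC (subs Sreg ?ST (B j) (B (Suc j)))" for j
  proof (rule DCC_transfer[OF dT, of _ "\<lambda>N. {t \<in> T. (SS.\<theta> ^^ j) t \<in> N}"])
    fix N assume "N \<in> subs Sreg ?ST (B j) (B (Suc j))"
    then have N: "opsub Sreg ?ST N" "B j \<subseteq> N" unfolding subs_def by auto
    have "opsub Sreg ?ST {t \<in> T. (SS.\<theta> ^^ j) t \<in> N}"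
    proof (rule SS.M.E.preimage_opsub[OF Sreg_group To N(1)])
      fix w assume "w \<in> ?ST"
      then obtain w' where "w' \<in> ?ST" "\<forall>a\<in>carrier Sreg. (SS.\<theta> ^^ j) (w a) = w' ((SS.\<theta> ^^ j) a)"
        using SS.M.pow_norm by blast
      then show "\<exists>w'\<in>?ST. \<forall>a\<in>T. (SS.\<theta> ^^ j) (w a) = w' ((SS.\<theta> ^^ j) a)"
        using opsub_sub[OF To] by (intro bexI[of _ w']) auto
    qed (use endo_closed[OF tj] endo_add[OF tj] opsub_carrier[OF To] in auto)
    moreover have "Q \<inter> T \<subseteq> {t \<in> T. (SS.\<theta> ^^ j) t \<in> N}" using Qj BQ N(2) by blast
    ultimately show "{t \<in> T. (SS.\<theta> ^^ j) t \<in> N} \<in> subs Sreg ?ST (Q \<inter> T) T" unfolding subs_def by blast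
  next
    fix N N' assume "N \<in> subs Sreg ?ST (B j) (B (Suc j))" "N' \<in> subs Sreg ?ST (B j) (B (Suc j))"
      and NN: "N \<subseteq> N'" and eq: "{t \<in> T. (SS.\<theta> ^^ j) t \<in> N'} = {t \<in> T. (SS.\<theta> ^^ j) t \<in> N}"
    then have N: "opsub Sreg ?ST N" "B j \<subseteq> N" and N': "opsub Sreg ?ST N'" "N' \<subseteq> B (Suc j)" unfolding subs_def by auto
    show "N' \<subseteq> N"
    proof (rule SS.M.E.modular_cancel[OF N(1) N'(1) fi NN])
      show "N' \<inter> (SS.\<theta> ^^ j) ` T \<subseteq> N" using eq by blast
      have "B (Suc j) \<subseteq> N <+>\<^bsub>Sreg\<^esub> (SS.\<theta> ^^ j) ` T"
      proof -
        note o = SS.M.E.opsub_sum[OF STe N(1) fi]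
        have 1: "N \<subseteq> N <+>\<^bsub>Sreg\<^esub> (SS.\<theta> ^^ j) ` T" by (rule SS.M.E.set_add_incl1[OF N(1) fi])
        have 2: "(SS.\<theta> ^^ j) ` T \<subseteq> N <+>\<^bsub>Sreg\<^esub> (SS.\<theta> ^^ j) ` T" by (rule SS.M.E.set_add_incl2[OF N(1) fi])
        have "?f j \<subseteq> N" using N(2) SS.M.E.set_add_incl1[OF fo Qo] unfolding B_def by blast
        then have "?f (Suc j) \<subseteq> N <+>\<^bsub>Sreg\<^esub> (SS.\<theta> ^^ j) ` T"
          using SS.M.E.set_add_least[OF o _ 2] 1 by simp
        moreover have "Q \<subseteq> N <+>\<^bsub>Sreg\<^esub> (SS.\<theta> ^^ j) ` T" using BQ N(2) 1 by blast
        ultimately show ?thesis unfolding B_def using SS.M.E.set_add_least[OF o] by blast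
      qed
      then show "N' \<subseteq> N <+>\<^bsub>Sreg\<^esub> (SS.\<theta> ^^ j) ` T" using N'(2) by blast
    qed
  qed auto
  have dB: "DCC (subs Sreg ?ST Q (B j))" for j
  proof (induction j)
    case 0
    have "B 0 \<subseteq> Q" unfolding B_def using SS.M.E.set_add_least[OF Qo, of "?f 0" Q] opsub_zero[OF Qo] by simp
    then have "subs Sreg ?ST Q (B 0) \<subseteq> {Q, Q}" unfolding subs_def by blast
    then show ?case by (rule DCC_subset_pair)
  next
    case (Suc j)
    show ?case by (rule SS.M.E.DCC_subs_trans[OF STe Bo Bo BQ Bmono Suc layer])
  qed
  have "carrier S \<subseteq> ?f n"
  proof
    fix s assume s: "s \<in> carrier S"
    have ft: "opsub Sreg SW (?f n)" by (rule SS.M.filtration_top[OF To n(1)])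
    have "\<one>\<^bsub>S\<^esub> \<in> T" unfolding T_def by (rule gen_incl1) simp
    then have "\<one>\<^bsub>S\<^esub> \<in> ?f n" using SS.M.filtration_incl[OF To n(1)] by blast
    moreover have "rsubmodule S (?f n) Sreg" using SS.rsubmodule_iff ft by blast
    ultimately have "ract Sreg \<one>\<^bsub>S\<^esub> s \<in> ?f n" unfolding rsubmodule_def using s by blast
    then show "s \<in> ?f n" using s by (simp add: Sreg_ract)
  qed
  then have top: "carrier S \<subseteq> B n" unfolding B_def using SS.M.E.set_add_incl1[OF fo Qo] by blast
  have "{I. right_ideal I S \<and> Q \<subseteq> I} \<subseteq> subs Sreg ?ST Q (B n)"
  proof
    fix I assume "I \<in> {I. right_ideal I S \<and> Q \<subseteq> I}"
    then have o: "opsub Sreg SW I" and QI: "Q \<subseteq> I" using right_ideal_opsub by auto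
    have "(SS.\<theta> ^^ k) a \<in> I" if "a \<in> I" for k a
      by (induction k) (use that opsub_op[OF o, of SS.\<theta>] in auto)
    then have "opsub Sreg ?ST I" using o unfolding opsub_def by auto
    then show "I \<in> subs Sreg ?ST Q (B n)" unfolding subs_def using QI opsub_sub[OF o] top by auto
  qed
  then show ?thesis by (rule DCC_subset[OF dB])
qed

theorem artinian_quotient:
  assumes "right_ideal_prod S (c ` P) \<subset> Q" shows "right_artinian_ring (S Quot Q)"
proof (rule quotient_artinian, cases "th \<in> Q")
  case True then show "DCC {I. right_ideal I S \<and> Q \<subseteq> I}" by (rule DCC_right_ideals_nilpotent)
next
  case False
  then show "DCC {I. right_ideal I S \<and> Q \<subseteq> I}"
    using finite_order[OF False assms] DCC_right_ideals_invertible[OF False] by blast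
qed

end

theorem theorem3p4:
  fixes R :: "('a, 'b) ring_scheme" and \<alpha> :: "'a \<Rightarrow> 'a"
    and V :: "(nat \<Rightarrow> 'a, 'v, 'c) rmod_scheme"
  defines "S \<equiv> skew_poly_ring R \<alpha>"
  defines "Q \<equiv> rannihilator S V"
  assumes "cring R" and "noetherian_ring R"
    and "\<alpha> \<in> ring_iso R R"
    and "simple_rmodule S V"
    and "right_ideal_prod S (skew_const R ` {r \<in> carrier R. skew_const R r \<in> Q}) \<subset> Q"
  shows "right_artinian_ring (S Quot Q)
    \<and> (\<forall>E :: (nat \<Rightarrow> 'a, 'e, 'f) rmod_scheme.
          essential_extension S V E \<and> fin_gen_rmodule S E \<longrightarrow> artinian_rmodule S E)"
proof -
  have rm: "right_module S V" using assms(6) unfolding simple_rmodule_def by blast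
  then have "ring S" unfolding right_module_def by blast
  then have sp: "skew_poly R \<alpha>"
    using assms(3-5) unfolding S_def by (intro skew_poly.intro skew_poly_axioms.intro)
  interpret V: skew_poly_simple R \<alpha> V
    using sp rm assms(6) unfolding S_def
    by (intro skew_poly_simple.intro skew_poly_module.intro skew_poly_module_axioms.intro skew_poly_simple_axioms.intro)
  have Q: "Q = V.Q" unfolding Q_def S_def V.Q_def ..
  have strict: "right_ideal_prod V.S (V.c ` V.P) \<subset> V.Q" using assms(7) unfolding V.P_def Q S_def .
  have "artinian_rmodule S E" if E: "essential_extension S V E" "fin_gen_rmodule S E"
    for E :: "(nat \<Rightarrow> 'a, 'e, 'f) rmod_scheme"
  proof -
    obtain f where f: "rmod_hom S V E f" "inj_on f (carrier V)" "essential_rsubmodule S (f ` carrier V) E"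
      and rE: "right_module S E" using E(1) unfolding essential_extension_def by blast
    interpret X: simple_extension R \<alpha> V E f
      using rE f E(2) sp V.skew_poly_simple_axioms unfolding S_def
      by (intro simple_extension.intro skew_poly_module.intro skew_poly_module_axioms.intro simple_extension_axioms.intro)
    show ?thesis unfolding S_def by (rule X.artinian_E[OF strict])
  qed
  moreover have "right_artinian_ring (S Quot Q)" unfolding Q S_def by (rule V.artinian_quotient[OF strict])
  ultimately show ?thesis by blast
qed

end
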